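(* Let $H,K,U$, $A,B,R,Q,Q_T,\overline Q,\overline Q_T,S,S_T,\sigma$, $T>0$ and $z_0\in H$ be as in the context, and let $P\in C_s([0,T];\Sigma^+(H))$ be the unique mild solution of the backward Riccati equation $$P'(t)+P(t)A+A^*P(t)-P(t)BR^{-1}B^*P(t)+Q+\overline Q=0,\qquad P(T)=Q_T+\overline Q_T .$$ Let $A_n=n^2R(n,A)-nI$ be the Yosida approximations of $A$. Assume that: (H1) for every $n$ there exists $\eta_n\in C^1_s([0,T];\Sigma(H))$ which is a strict solution of the backward Riccati equation $$\eta_n'(t)=(P(t)BR^{-1}B^*-A_n^* )\eta_n(t)-\eta_n(t)(A_n-BR^{-1}B^*P(t))+\overline Q S+\eta_n(t)BR^{-1}B^*\eta_n(t),\qquad \eta_n(T)=-\overline Q_TS_T;$$ (H2) $\displaystyle\sup_{t\in[0,T],\,n}\|\eta_n(t)\|_{\mathcal L(H)}<\infty$. Then there exists an LQM mild solution $(P,r,z,s)$ to the mean field game.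
   Context: $H,K,U$ are separable real Hilbert spaces. $\mathcal L(\cdot;\cdot)$ denotes bounded linear operators with the operator norm, $\mathcal L(H)=\mathcal L(H;H)$; $\Sigma(H)$ is the set of self-adjoint operators in $\mathcal L(H)$, $\Sigma^+(H)$ the set of nonnegative ones in $\Sigma(H)$ (similarly for $U$). Standing assumptions: $A:D(A)\subset H\to H$ is closed, densely defined and generates a $C_0$-semigroup $(e^{tA})_{t\ge0}$ on $H$; $B\in\mathcal L(U;H)$; $Q,Q_T\in\Sigma^+(H)$; $\overline Q,\overline Q_T\in\Sigma(H)$; $Q+\overline Q,\ Q_T+\overline Q_T\in\Sigma^+(H)$; $R\in\Sigma(U)$ with $\langle R\alpha,\alpha\rangle_U\ge\varepsilon|\alpha|_U^2$ for all $\alpha\in U$ and some $\varepsilon>0$; $S,S_T\in\mathcal L(H)$; $\sigma\in\mathcal L(K;H)$; $T>0$; $z_0\in H$ (the mean $z_0=\int_H x\,m_0(dx)$ of the initial distribution $m_0$ of the agents). $M\ge1$ and $\omega\in\mathbb R$ are such that $\|e^{tA}\|_{\mathcal L(H)}\le Me^{\omega t}$ for all $t\ge 0$. $R(n,A)=(nI-A)^{-1}$ is the resolvent of $A$, and the index $n$ of the Yosida approximations $A_n\in\mathcal L(H)$ ranges over positive integers with $n>\omega$. $C_s([0,T];\Sigma^+(H))$ is the space of strongly continuous maps $f:[0,T]\to\Sigma^+(H)$, i.e. $t\mapsto f(t)x$ is continuous for each $x\in H$; $C^1_s([0,T];\Sigma(H))$ is the space of maps $f:[0,T]\to\Sigma(H)$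 with $t\mapsto f(t)x$ of class $C^1$ for each $x\in H$. A strict solution $\eta_n$ of the equation in (H1) is such a map satisfying the terminal condition and, for all $t\in[0,T]$, $x\in H$, the equation applied to $x$, with $\eta_n'(t)x:=\frac{d}{dt}(\eta_n(t)x)$. Mild solution of the Riccati equation for $P$: $P\in C_s([0,T];\Sigma^+(H))$ such that for all $x\in H$, $t\in[0,T]$, $$P(t)x=e^{(T-t)A^*}(Q_T+\overline Q_T)e^{(T-t)A}x+\int_t^Te^{(s-t)A^*}(Q+\overline Q)e^{(s-t)A}x\,ds-\int_t^Te^{(s-t)A^*}P(s)BR^{-1}B^*P(s)e^{(s-t)A}x\,ds .$$ It is known that such a $P$ exists and is unique. LQM (Linear-Quadratic-Mean) mild solution to the mean field game: a 4-tuple $(P,r,z,s)\in C_s([0,T];\Sigma^+(H))\times C([0,T];H)\times C([0,T];H)\times C([0,T];\mathbb R)$ such that $P$ is the mild solution of the Riccati equation above; for all $t\in[0,T]$, $$z(t)=e^{tA}z_0-\int_0^te^{(t-s)A}BR^{-1}B^*P(s)z(s)\,ds-\int_0^te^{(t-s)A}BR^{-1}B^*r(s)\,ds,$$ $$r(t)=-e^{(T-t)A^*}\overline Q_TS_Tz(T)-\int_t^Te^{(s-t)A^*}P(s)BR^{-1}B^*r(s)\,ds-\int_t^Te^{(s-t)A^*}\overline QSz(s)\,ds;$$ and $$s(t)=\tfrac12\langle\overline Q_TS_Tz(T),S_Tz(T)\rangle_H+\int_t^T\Big[\tfrac12\mathrm{Tr}[\sigma\sigma^*P(u)]-\tfrac12\langle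 BR^{-1}B^*r(u),r(u)\rangle_H+\tfrac12\langle\overline QSz(u),Sz(u)\rangle_H\Big]du .$$
   Formalization: The formal theorem additionally assumes that σσ*P(u) is trace class for almost every u in [0,T] with integrable trace; without this Tr[σσ*P(u)] can be infinite (e.g. σ=I, P=I on ℓ²) and no real-valued s exists. *)

theory Defs
  imports "HOL-Analysis.Analysis"
begin

(* Separable real Hilbert spaces are types of sort {real_inner, polish_space}
   (inner product, complete, second countable). *)

section \<open>Bounded operators on Hilbert spaces\<close>

(* Blinfun turns a bounded linear function into an element of the operator space;
   for adj this is justified by the Riesz representation theorem. *)
definition adj ::
  "('a::{real_inner, polish_space} \<Rightarrow>\<^sub>L 'b::{real_inner, polish_space}) \<Rightarrow> ('b \<Rightarrow>\<^sub>L 'a)" where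
  "adj X = Blinfun (adjoint (blinfun_apply X))"

definition selfadjoint_ops :: "('a::{real_inner, polish_space} \<Rightarrow>\<^sub>L 'a) set" where
  "selfadjoint_ops = {X. adj X = X}"

definition nonneg_ops :: "('a::{real_inner, polish_space} \<Rightarrow>\<^sub>L 'a) set" where
  "nonneg_ops = {X \<in> selfadjoint_ops. \<forall>x. 0 \<le> X x \<bullet> x}"

(* Used only for boundedly invertible X, such as a coercive R. *)
definition op_inverse ::
  "('a::{real_inner, polish_space} \<Rightarrow>\<^sub>L 'a) \<Rightarrow> ('a \<Rightarrow>\<^sub>L 'a)" where
  "op_inverse X = Blinfun (inv (blinfun_apply X))"

definition orthonormal_basis :: "'a::{real_inner, polish_space} set \<Rightarrow> bool" where
  "orthonormal_basis E \<longleftrightarrow>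
     pairwise orthogonal E \<and> (\<forall>e\<in>E. norm e = 1) \<and> closure (span E) = UNIV"

(* Trace class (nuclear) operators: absolutely convergent sums of rank-one operators.
   In a real Hilbert space, convergence of the diagonal sums in every orthonormal basis
   would not be enough (consider antisymmetric operators). *)
definition trace_class :: "('a::{real_inner, polish_space} \<Rightarrow>\<^sub>L 'a) \<Rightarrow> bool" where
  "trace_class X \<longleftrightarrow>
     (\<exists>a b :: nat \<Rightarrow> 'a. summable (\<lambda>j. norm (a j) * norm (b j)) \<and>
        (\<forall>x. (\<lambda>j. (b j \<bullet> x) *\<^sub>R a j) sums X x))"

(* The value common to all orthonormal bases; meaningful for trace class X. *)
definition trace_op :: "('a::{real_inner, polish_space} \<Rightarrow>\<^sub>L 'a) \<Rightarrow> real" where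
  "trace_op X = (THE c. \<forall>E. orthonormal_basis E \<longrightarrow> ((\<lambda>e. X e \<bullet> e) has_sum c) E)"

section \<open>Semigroups, resolvents and Yosida approximations\<close>

(* An unbounded operator is given by its domain D and a function A that matters only on D;
   a semigroup E matters only at nonnegative times. *)

definition C0_semigroup :: "(real \<Rightarrow> ('a::{real_inner, polish_space} \<Rightarrow>\<^sub>L 'a)) \<Rightarrow> bool" where
  "C0_semigroup E \<longleftrightarrow>
     E 0 = id_blinfun \<and>
     (\<forall>s\<ge>0. \<forall>t\<ge>0. E (s + t) = E s o\<^sub>L E t) \<and>
     (\<forall>x. continuous_on {0..} (\<lambda>t. E t x))"

definition generates ::
  "'a::{real_inner, polish_space} set \<Rightarrow> ('a \<Rightarrow> 'a) \<Rightarrow> (real \<Rightarrow> ('a \<Rightarrow>\<^sub>L 'a)) \<Rightarrow> bool" where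
  "generates D A E \<longleftrightarrow>
     C0_semigroup E \<and>
     D = {x. \<exists>y. ((\<lambda>h. (E h x - x) /\<^sub>R h) \<longlongrightarrow> y) (at_right 0)} \<and>
     (\<forall>x\<in>D. ((\<lambda>h. (E h x - x) /\<^sub>R h) \<longlongrightarrow> A x) (at_right 0))"

(* Used only for l in the resolvent set, in particular for l > \<omega>
   if norm (E t) \<le> M * exp (\<omega> * t). *)
definition resolvent ::
  "'a::{real_inner, polish_space} set \<Rightarrow> ('a \<Rightarrow> 'a) \<Rightarrow> real \<Rightarrow> ('a \<Rightarrow>\<^sub>L 'a)" where
  "resolvent D A l = Blinfun (inv_into D (\<lambda>x. l *\<^sub>R x - A x))"

definition yosida ::
  "'a::{real_inner, polish_space} set \<Rightarrow> ('a \<Rightarrow> 'a) \<Rightarrow> nat \<Rightarrow> ('a \<Rightarrow>\<^sub>L 'a)" where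
  "yosida D A n = (real n)\<^sup>2 *\<^sub>R resolvent D A (real n) - real n *\<^sub>R id_blinfun"

section \<open>The Riccati equations\<close>

definition C_s ::
  "real \<Rightarrow> ('a::{real_inner, polish_space} \<Rightarrow>\<^sub>L 'a) set \<Rightarrow> (real \<Rightarrow> ('a \<Rightarrow>\<^sub>L 'a)) set" where
  "C_s T \<Omega> = {f. (\<forall>t\<in>{0..T}. f t \<in> \<Omega>) \<and> (\<forall>x. continuous_on {0..T} (\<lambda>t. f t x))}"

(* Derivatives at the endpoints of the interval are one-sided. *)
definition C1_s ::
  "real \<Rightarrow> ('a::{real_inner, polish_space} \<Rightarrow>\<^sub>L 'a) set \<Rightarrow> (real \<Rightarrow> ('a \<Rightarrow>\<^sub>L 'a)) set" where
  "C1_s T \<Omega> = {f. (\<forall>t\<in>{0..T}. f t \<in> \<Omega>) \<and>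
     (\<forall>x. \<exists>g. continuous_on {0..T} g \<and>
        (\<forall>t\<in>{0..T}. ((\<lambda>t. f t x) has_vector_derivative g t) (at t within {0..T})))}"

definition BRB ::
  "('u::{real_inner, polish_space} \<Rightarrow>\<^sub>L 'h::{real_inner, polish_space}) \<Rightarrow> ('u \<Rightarrow>\<^sub>L 'u) \<Rightarrow> ('h \<Rightarrow>\<^sub>L 'h)" where
  "BRB B R = B o\<^sub>L op_inverse R o\<^sub>L adj B"

(* All vector-valued integrands below are continuous, so the Henstock-Kurzweil
   integral is the usual one. *)
definition riccati_mild_solution ::
  "(real \<Rightarrow> ('h::{real_inner, polish_space} \<Rightarrow>\<^sub>L 'h)) \<Rightarrow> ('u::{real_inner, polish_space} \<Rightarrow>\<^sub>L 'h) \<Rightarrow>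
   ('u \<Rightarrow>\<^sub>L 'u) \<Rightarrow> ('h \<Rightarrow>\<^sub>L 'h) \<Rightarrow> ('h \<Rightarrow>\<^sub>L 'h) \<Rightarrow> ('h \<Rightarrow>\<^sub>L 'h) \<Rightarrow> ('h \<Rightarrow>\<^sub>L 'h) \<Rightarrow> real \<Rightarrow>
   (real \<Rightarrow> ('h \<Rightarrow>\<^sub>L 'h)) \<Rightarrow> bool" where
  "riccati_mild_solution E B R Q QT Qbar QTbar T P \<longleftrightarrow>
     P \<in> C_s T nonneg_ops \<and>
     (\<forall>x. \<forall>t\<in>{0..T}.
        P t x = (adj (E (T - t)) o\<^sub>L (QT + QTbar) o\<^sub>L E (T - t)) x
          + integral {t..T} (\<lambda>s. (adj (E (s - t)) o\<^sub>L (Q + Qbar) o\<^sub>L E (s - t)) x)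
          - integral {t..T} (\<lambda>s. (adj (E (s - t)) o\<^sub>L P s o\<^sub>L BRB B R o\<^sub>L P s o\<^sub>L E (s - t)) x))"

(* An stands for a bounded approximation of the generator. *)
definition eta_strict_solution ::
  "('h::{real_inner, polish_space} \<Rightarrow>\<^sub>L 'h) \<Rightarrow> ('u::{real_inner, polish_space} \<Rightarrow>\<^sub>L 'h) \<Rightarrow> ('u \<Rightarrow>\<^sub>L 'u) \<Rightarrow>
   ('h \<Rightarrow>\<^sub>L 'h) \<Rightarrow> ('h \<Rightarrow>\<^sub>L 'h) \<Rightarrow> ('h \<Rightarrow>\<^sub>L 'h) \<Rightarrow> ('h \<Rightarrow>\<^sub>L 'h) \<Rightarrow> real \<Rightarrow>
   (real \<Rightarrow> ('h \<Rightarrow>\<^sub>L 'h)) \<Rightarrow> (real \<Rightarrow> ('h \<Rightarrow>\<^sub>L 'h)) \<Rightarrow> bool" where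
  "eta_strict_solution An B R Qbar QTbar S ST T P \<eta> \<longleftrightarrow>
     \<eta> \<in> C1_s T selfadjoint_ops \<and>
     \<eta> T = - (QTbar o\<^sub>L ST) \<and>
     (\<forall>t\<in>{0..T}. \<forall>x.
        ((\<lambda>t. \<eta> t x) has_vector_derivative
           (((P t o\<^sub>L BRB B R) - adj An) o\<^sub>L \<eta> t) x
           - (\<eta> t o\<^sub>L (An - (BRB B R o\<^sub>L P t))) x
           + (Qbar o\<^sub>L S) x
           + (\<eta> t o\<^sub>L BRB B R o\<^sub>L \<eta> t) x)
        (at t within {0..T}))"

section \<open>The mean field game\<close>

(* The trace in the equation for s is finite for almost every time and integrable. This is not
   automatic for a merely bounded \<sigma>; it is if \<sigma> is Hilbert-Schmidt or H finite-dimensional. *)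
definition trace_term_defined ::
  "('k::{real_inner, polish_space} \<Rightarrow>\<^sub>L 'h::{real_inner, polish_space}) \<Rightarrow> real \<Rightarrow>
   (real \<Rightarrow> ('h \<Rightarrow>\<^sub>L 'h)) \<Rightarrow> bool" where
  "trace_term_defined \<sigma> T P \<longleftrightarrow>
     negligible {u \<in> {0..T}. \<not> trace_class (\<sigma> o\<^sub>L adj \<sigma> o\<^sub>L P u)} \<and>
     (\<lambda>u. trace_op (\<sigma> o\<^sub>L adj \<sigma> o\<^sub>L P u)) integrable_on {0..T}"

definition LQM_mild_solution ::
  "(real \<Rightarrow> ('h::{real_inner, polish_space} \<Rightarrow>\<^sub>L 'h)) \<Rightarrow> ('u::{real_inner, polish_space} \<Rightarrow>\<^sub>L 'h) \<Rightarrow>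
   ('u \<Rightarrow>\<^sub>L 'u) \<Rightarrow> ('h \<Rightarrow>\<^sub>L 'h) \<Rightarrow> ('h \<Rightarrow>\<^sub>L 'h) \<Rightarrow> ('h \<Rightarrow>\<^sub>L 'h) \<Rightarrow> ('h \<Rightarrow>\<^sub>L 'h) \<Rightarrow>
   ('h \<Rightarrow>\<^sub>L 'h) \<Rightarrow> ('h \<Rightarrow>\<^sub>L 'h) \<Rightarrow> ('k::{real_inner, polish_space} \<Rightarrow>\<^sub>L 'h) \<Rightarrow> real \<Rightarrow> 'h \<Rightarrow>
   (real \<Rightarrow> ('h \<Rightarrow>\<^sub>L 'h)) \<Rightarrow> (real \<Rightarrow> 'h) \<Rightarrow> (real \<Rightarrow> 'h) \<Rightarrow> (real \<Rightarrow> real) \<Rightarrow> bool" where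
  "LQM_mild_solution E B R Q QT Qbar QTbar S ST \<sigma> T z0 P r z s \<longleftrightarrow>
     riccati_mild_solution E B R Q QT Qbar QTbar T P \<and>
     continuous_on {0..T} r \<and> continuous_on {0..T} z \<and> continuous_on {0..T} s \<and>
     (\<forall>t\<in>{0..T}.
        z t = E t z0
          - integral {0..t} (\<lambda>u. (E (t - u) o\<^sub>L BRB B R o\<^sub>L P u) (z u))
          - integral {0..t} (\<lambda>u. (E (t - u) o\<^sub>L BRB B R) (r u))) \<and>
     (\<forall>t\<in>{0..T}.
        r t = - ((adj (E (T - t)) o\<^sub>L QTbar o\<^sub>L ST) (z T))
          - integral {t..T} (\<lambda>u. (adj (E (u - t)) o\<^sub>L P u o\<^sub>L BRB B R) (r u))
          - integral {t..T} (\<lambda>u. (adj (E (u - t)) o\<^sub>L Qbar o\<^sub>L S) (z u))) \<and>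
     trace_term_defined \<sigma> T P \<and>
     (\<forall>t\<in>{0..T}.
        s t = 1/2 * (QTbar (ST (z T)) \<bullet> ST (z T))
          + integral {t..T} (\<lambda>u. 1/2 * trace_op (\<sigma> o\<^sub>L adj \<sigma> o\<^sub>L P u)
              - 1/2 * (BRB B R (r u) \<bullet> r u)
              + 1/2 * (Qbar (S (z u)) \<bullet> S (z u))))"

end

theory Submission
  imports Defs
begin

text \<open>
Write \<open>G = B R\<inverse> B*\<close>. Once \<open>P\<close> is fixed, the equations for \<open>z\<close> and \<open>r\<close> form a linear forward-backward
system, and \<open>s\<close> is given by an explicit formula. For bounded \<open>A\<close> such a system is decoupled by the
ansatz \<open>r = \<eta> z\<close>: with \<open>\<eta>\<^sub>n\<close> from the Riccati equation for \<open>A\<^sub>n\<close>, let \<open>z\<^sub>n\<close> solve the linear equation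
\<open>z\<^sub>n' = A\<^sub>n z\<^sub>n - G P z\<^sub>n - G \<eta>\<^sub>n z\<^sub>n\<close>, \<open>z\<^sub>n(0) = z\<^sub>0\<close>, and put \<open>r\<^sub>n = \<eta>\<^sub>n z\<^sub>n\<close>. The product rule gives
\<open>r\<^sub>n' = (P G - A\<^sub>n*) r\<^sub>n + Qbar S z\<^sub>n\<close> with \<open>r\<^sub>n(T) = - QTbar ST z\<^sub>n(T)\<close>, so that \<open>(z\<^sub>n, r\<^sub>n)\<close> solves the system
with \<open>A\<^sub>n\<close> in place of \<open>A\<close>. It remains to let \<open>n\<close> tend to infinity.

Uniform bounds. In the equivalent norm \<open>N x = sup exp(-\<omega> t) |E(t) x|\<close> the resolvent satisfies
\<open>N (R(n,A) x) \<le> N x / (n - \<omega>)\<close>, and Gronwall's inequality for \<open>exp(n t) z\<^sub>n(t)\<close>, whose equation contains only the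
part \<open>n\<^sup>2 R(n,A)\<close> of \<open>A\<^sub>n\<close>, bounds \<open>z\<^sub>n\<close> (\<open>yosida_growth\<close>). The uniform bound on \<open>\<eta>\<^sub>n\<close> then bounds \<open>r\<^sub>n\<close>.

The limit. No compactness of the semigroup is available, but the system is linear and weak limits
suffice. The key is that \<open>A\<^sub>n\<close> converges to \<open>A\<close> in operator norm after regularisation: for a fixed \<open>l > \<omega>\<close>,
\<open>R(l,A)\<^sup>2 A\<^sub>n = A R(l,A)\<^sup>2 + R(n,A) (A R(l,A))\<^sup>2\<close> (\<open>yosida_identity\<close>), and the last term is of order \<open>1/n\<close>.
Therefore the functions \<open>R(l,A)\<^sup>2 z\<^sub>n\<close> are uniformly Lipschitz in time, which yields a subsequence of
\<open>z\<^sub>n\<close> that converges weakly at every time (\<open>weakly_convergent_subsequence\<close>). Moreover, the mild equation,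
tested against vectors in the range of \<open>(R(l,A)\<^sup>2)*\<close>, passes to the limit by dominated convergence; this range
is dense because \<open>R(l,A)\<close> is injective (\<open>weak_mild_limit\<close>). The adjoint semigroup in reversed time treats \<open>r\<^sub>n\<close>
in the same way, so these arguments are made once, for a \<open>smoothed_semigroup\<close>. Finally, a bounded function
that satisfies a mild equation weakly is strongly continuous (\<open>continuous_if_near_orbit\<close>), which turns
the weak equations into the required ones.
\<close>

section \<open>Calculus in complete normed spaces\<close>

text \<open>
The sort of real normed and complete spaces satisfies the axioms of the class \<^class>\<open>banach\<close> without being a
subsort of it. The isometric copy below is an instance of that class, and facts about integrals of
continuous functions are carried back along \<open>of_copy\<close>.
\<close>

typedef (overloaded) 'a banach_copy = "UNIV :: 'a::{real_normed_vector, complete_space} set"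
  morphisms of_copy to_copy ..

lemma to_copy_inverse' [simp]: "of_copy (to_copy x) = x"
  by (simp add: to_copy_inverse)

instantiation banach_copy :: ("{real_normed_vector, complete_space}") real_normed_vector
begin

definition "0 = to_copy 0"
definition "x + y = to_copy (of_copy x + of_copy y)"
definition "x - y = to_copy (of_copy x - of_copy y)"
definition "- x = to_copy (- of_copy x)"
definition "c *\<^sub>R x = to_copy (c *\<^sub>R of_copy x)"
definition "norm x = norm (of_copy x)"
definition "dist x y = norm (x - y :: 'a banach_copy)"
definition "sgn x = inverse (norm x) *\<^sub>R (x :: 'a banach_copy)"
definition "uniformity = (INF e\<in>{0<..}. principal {(x, y :: 'a banach_copy). dist x y < e})"
definition "open U \<longleftrightarrow> (\<forall>x\<in>U. eventually (\<lambda>(x', y :: 'a banach_copy). x' = x \<longrightarrow> y \<in> U) uniformity)"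

instance
proof
  fix x y z :: "'a banach_copy" and a b :: real
  note defs = zero_banach_copy_def plus_banach_copy_def minus_banach_copy_def
    uminus_banach_copy_def scaleR_banach_copy_def norm_banach_copy_def
  show "x + y + z = x + (y + z)" "x + y = y + x" "0 + x = x" "- x + x = 0" "x - y = x + - y"
    "a *\<^sub>R (x + y) = a *\<^sub>R x + a *\<^sub>R y" "(a + b) *\<^sub>R x = a *\<^sub>R x + b *\<^sub>R x"
    "a *\<^sub>R b *\<^sub>R x = (a * b) *\<^sub>R x" "1 *\<^sub>R x = x"
    by (rule of_copy_inject[THEN iffD1], simp add: defs algebra_simps)+
  show "norm (a *\<^sub>R x) = \<bar>a\<bar> * norm x" "norm (x + y) \<le> norm x + norm y"
    by (simp_all add: defs norm_triangle_ineq)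
  have "of_copy x = 0 \<longleftrightarrow> x = to_copy 0"
    by (metis of_copy_inverse to_copy_inverse')
  then show "norm x = 0 \<longleftrightarrow> x = 0"
    by (simp add: defs)
qed (rule dist_banach_copy_def sgn_banach_copy_def uniformity_banach_copy_def open_banach_copy_def)+

end

lemma bounded_linear_of_copy: "bounded_linear of_copy"
  by (rule bounded_linear_intro[where K = 1])
    (simp_all add: plus_banach_copy_def scaleR_banach_copy_def norm_banach_copy_def)

lemma bounded_linear_to_copy: "bounded_linear to_copy"
  by (rule bounded_linear_intro[where K = 1])
    (simp_all add: plus_banach_copy_def scaleR_banach_copy_def norm_banach_copy_def)

instance banach_copy :: ("{real_normed_vector, complete_space}") banach
proof
  fix X :: "nat \<Rightarrow> 'a banach_copy"
  assume "Cauchy X"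
  then have "Cauchy (\<lambda>n. of_copy (X n))"
    by (rule bounded_linear.Cauchy[OF bounded_linear_of_copy])
  then obtain l where "(\<lambda>n. of_copy (X n)) \<longlonglongrightarrow> l"
    using Cauchy_convergent convergent_def by blast
  from bounded_linear.tendsto[OF bounded_linear_to_copy this]
  show "convergent X"
    by (auto simp: of_copy_inverse convergent_def)
qed

lemma has_integral_of_copy:
  assumes "((\<lambda>t. to_copy (f t)) has_integral to_copy y) S"
  shows "(f has_integral y) S"
  using has_integral_linear[OF assms bounded_linear_of_copy] by (simp add: o_def)

lemma continuous_integrable:
  fixes f :: "real \<Rightarrow> 'a::{real_normed_vector, complete_space}"
  assumes "continuous_on {a..b} f"
  shows "f integrable_on {a..b}"
proof -
  have "(\<lambda>t. to_copy (f t)) integrable_on {a..b}"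
    by (intro integrable_continuous_real bounded_linear.continuous_on[OF bounded_linear_to_copy] assms)
  from integrable_linear[OF this bounded_linear_of_copy] show ?thesis
    by (simp add: o_def)
qed

lemma ftc_has_integral:
  fixes f :: "real \<Rightarrow> 'a::{real_normed_vector, complete_space}"
  assumes "a \<le> b" "\<And>t. t \<in> {a..b} \<Longrightarrow> (f has_vector_derivative f' t) (at t within {a..b})"
  shows "(f' has_integral (f b - f a)) {a..b}"
proof -
  have "((\<lambda>t. to_copy (f' t)) has_integral (to_copy (f b) - to_copy (f a))) {a..b}"
    using assms(1) bounded_linear.has_vector_derivative[OF bounded_linear_to_copy assms(2)]
    by (rule fundamental_theorem_of_calculus)
  then have "((\<lambda>t. to_copy (f' t)) has_integral to_copy (f b - f a)) {a..b}"
    by (simp only: linear_diff[OF bounded_linear.linear[OF bounded_linear_to_copy]])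
  then show ?thesis
    by (rule has_integral_of_copy)
qed

lemma integral_vector_derivative:
  fixes f :: "real \<Rightarrow> 'a::{real_normed_vector, complete_space}"
  assumes "continuous_on {a..b} f" "t \<in> {a..b}"
  shows "((\<lambda>u. integral {a..u} f) has_vector_derivative f t) (at t within {a..b})"
proof -
  have eq: "integral {a..u} f = of_copy (integral {a..u} (\<lambda>t. to_copy (f t)))" if "u \<in> {a..b}" for u
  proof -
    have "(\<lambda>t. to_copy (f t)) integrable_on {a..u}"
      using that by (intro integrable_continuous_real
          bounded_linear.continuous_on[OF bounded_linear_to_copy] continuous_on_subset[OF assms(1)]) auto
    from integral_linear[OF this bounded_linear_of_copy] show ?thesis by (simp add: o_def)
  qed
  have "((\<lambda>u. integral {a..u} (\<lambda>t. to_copy (f t))) has_vector_derivative to_copy (f t))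
      (at t within {a..b})"
    by (intro integral_has_vector_derivative
        bounded_linear.continuous_on[OF bounded_linear_to_copy] assms)
  from bounded_linear.has_vector_derivative[OF bounded_linear_of_copy this]
  have deriv: "((\<lambda>u. of_copy (integral {a..u} (\<lambda>t. to_copy (f t)))) has_vector_derivative f t)
      (at t within {a..b})"
    by simp
  show ?thesis
    by (rule has_vector_derivative_transform[OF assms(2) _ deriv]) (simp add: eq)
qed

lemma has_integral_reverse:
  fixes f :: "real \<Rightarrow> 'a::real_normed_vector"
  assumes "(f has_integral i) {0..T - t}" "t \<le> T"
  shows "((\<lambda>u. f (T - u)) has_integral i) {t..T}"
proof -
  have "(\<lambda>x. - x + T) ` {0..T - t} = {t..T}"
  proof
    show "{t..T} \<subseteq> (\<lambda>x. - x + T) ` {0..T - t}"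
      by (rule subsetI, rule_tac x = "T - x" in image_eqI) auto
  qed auto
  with has_integral_affinity[of f i 0 "T - t" "-1" T] assms show ?thesis by simp
qed

section \<open>Operators on Hilbert spaces\<close>

text \<open>
By the parallelogram law a minimising sequence for the distance to \<open>V\<close> is Cauchy; minimality of its limit
along the lines in \<open>V\<close> is orthogonality.
\<close>

lemma closed_subspace_projection:
  fixes V :: "'a::{real_inner, complete_space} set"
  assumes V: "subspace V" "closed V"
  obtains p where "p \<in> V" "\<And>v. v \<in> V \<Longrightarrow> (x - p) \<bullet> v = 0"
proof -
  define d where "d = (INF v\<in>V. (norm (x - v))\<^sup>2)"
  have bdd: "bdd_below ((\<lambda>v. (norm (x - v))\<^sup>2) ` V)"
    by (rule bdd_belowI2[of _ 0]) simp
  have d_le: "d \<le> (norm (x - v))\<^sup>2" if "v \<in> V" for v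
    unfolding d_def by (rule cINF_lower[OF bdd that])
  have "\<exists>v\<in>V. (norm (x - v))\<^sup>2 < d + inverse (real (Suc n))" for n
  proof (rule ccontr)
    assume "\<not> ?thesis"
    then have "d + inverse (real (Suc n)) \<le> d"
      unfolding d_def using subspace_0[OF V(1)] by (intro cINF_greatest) (auto simp: not_less)
    then show False by (simp add: field_simps)
  qed
  then obtain p where p: "\<And>n. p n \<in> V" "\<And>n. (norm (x - p n))\<^sup>2 < d + inverse (real (Suc n))"
    by metis
  have close: "(norm (p m - p n))\<^sup>2 \<le> 4 * inverse (real (Suc k))" if "k \<le> m" "k \<le> n" for k m n
  proof -
    have "inverse (real (Suc m)) \<le> inverse (real (Suc k))" "inverse (real (Suc n)) \<le> inverse (real (Suc k))"
      using that by (auto simp: field_simps)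
    moreover have "d \<le> (norm (x - (1/2) *\<^sub>R (p m + p n)))\<^sup>2"
      by (intro d_le subspace_scale subspace_add V p)
    moreover have "(norm (p m - p n))\<^sup>2 = 2 * (norm (x - p m))\<^sup>2 + 2 * (norm (x - p n))\<^sup>2
        - 4 * (norm (x - (1/2) *\<^sub>R (p m + p n)))\<^sup>2"
      unfolding power2_norm_eq_inner by (simp add: inner_simps inner_commute algebra_simps)
    ultimately show ?thesis
      using p(2)[of m] p(2)[of n] by linarith
  qed
  have "Cauchy p"
  proof (rule metric_CauchyI)
    fix e :: real assume "e > 0"
    then obtain k where k: "inverse (real (Suc k)) < e\<^sup>2 / 4"
      using reals_Archimedean[of "e\<^sup>2 / 4"] by auto
    have "dist (p m) (p n) < e" if "k \<le> m" "k \<le> n" for m n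
    proof -
      have "(norm (p m - p n))\<^sup>2 < e\<^sup>2" using close[OF that] k by linarith
      then show ?thesis
        using \<open>e > 0\<close> by (simp add: dist_norm power2_less_imp_less)
    qed
    then show "\<exists>M. \<forall>m\<ge>M. \<forall>n\<ge>M. dist (p m) (p n) < e" by blast
  qed
  then obtain q where q: "p \<longlonglongrightarrow> q"
    using Cauchy_convergent convergent_def by blast
  have "q \<in> V"
    using closed_sequentially[OF V(2) _ q] p by blast
  have "(\<lambda>n. (norm (x - p n))\<^sup>2) \<longlonglongrightarrow> (norm (x - q))\<^sup>2"
    by (intro tendsto_intros q)
  moreover have "(\<lambda>n. d + inverse (real (Suc n))) \<longlonglongrightarrow> d + 0"
    by (intro tendsto_intros LIMSEQ_inverse_real_of_nat)
  ultimately have q_min: "(norm (x - q))\<^sup>2 \<le> d + 0"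
    by (rule LIMSEQ_le) (use p(2) less_imp_le in blast)
  have "(x - q) \<bullet> v = 0" if "v \<in> V" for v
  proof (rule ccontr)
    assume neq: "(x - q) \<bullet> v \<noteq> 0"
    then have "v \<bullet> v > 0" by auto
    define c where "c = (x - q) \<bullet> v / (v \<bullet> v)"
    have "d \<le> (norm (x - (q + c *\<^sub>R v)))\<^sup>2"
      by (intro d_le subspace_add subspace_scale V \<open>q \<in> V\<close> that)
    also have "\<dots> = (norm (x - q))\<^sup>2 - 2 * c * ((x - q) \<bullet> v) + c\<^sup>2 * (v \<bullet> v)"
      unfolding power2_norm_eq_inner by (simp add: inner_simps inner_commute algebra_simps power2_eq_square)
    also have "\<dots> = (norm (x - q))\<^sup>2 - ((x - q) \<bullet> v)\<^sup>2 / (v \<bullet> v)"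
      using \<open>v \<bullet> v > 0\<close> by (simp add: c_def power2_eq_square)
    also have "\<dots> < (norm (x - q))\<^sup>2"
      using neq \<open>v \<bullet> v > 0\<close> by simp
    finally show False using q_min by simp
  qed
  with \<open>q \<in> V\<close> show thesis by (rule that)
qed

text \<open>
The representing vector spans the orthogonal complement of the kernel.
\<close>

lemma riesz_representation:
  fixes f :: "'a::{real_inner, complete_space} \<Rightarrow> real"
  assumes "bounded_linear f"
  obtains y where "\<And>x. f x = x \<bullet> y"
proof (cases "\<forall>x. f x = 0")
  case True
  then show thesis using that[of 0] by simp
next
  case False
  interpret bounded_linear f by fact
  from False obtain x0 where x0: "f x0 \<noteq> 0" by blast
  define V where "V = {x. f x = 0}"
  have "subspace V"
    by (auto simp: V_def subspace_def zero add scaleR)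
  moreover have "closed V"
    unfolding V_def by (intro closed_Collect_eq continuous_intros continuous_on)
  ultimately obtain p where p: "p \<in> V" "\<And>v. v \<in> V \<Longrightarrow> (x0 - p) \<bullet> v = 0"
    using closed_subspace_projection by blast
  define e where "e = x0 - p"
  have e: "f e \<noteq> 0"
    using x0 p(1) by (simp add: e_def diff V_def)
  then have "e \<noteq> 0" using zero by auto
  have "f x = x \<bullet> ((f e / (e \<bullet> e)) *\<^sub>R e)" for x
  proof -
    have "x - (f x / f e) *\<^sub>R e \<in> V"
      using e by (simp add: V_def diff scaleR)
    from p(2)[OF this] have "x \<bullet> e = (f x / f e) * (e \<bullet> e)"
      by (simp add: e_def[symmetric] inner_simps inner_commute)
    then show ?thesis using e \<open>e \<noteq> 0\<close> by simp
  qed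
  then show thesis by (rule that)
qed

text \<open>
The Riesz theorem supplies the function that the choice in \<^const>\<open>adjoint\<close> needs, and its boundedness makes
\<^const>\<open>Blinfun\<close> harmless in the definition of \<^const>\<open>adj\<close>.
\<close>

lemma adj_inner_right: "x \<bullet> adj X y = X x \<bullet> y"
proof -
  have "\<exists>z. \<forall>x. X x \<bullet> y = x \<bullet> z" for y
  proof -
    have "bounded_linear (\<lambda>x. X x \<bullet> y)"
      by (intro bounded_linear_inner_left_comp blinfun.bounded_linear_right)
    then show ?thesis by (metis riesz_representation)
  qed
  then have "\<exists>f'. \<forall>x y. X x \<bullet> y = x \<bullet> f' y" by metis
  then have works: "X x \<bullet> y = x \<bullet> adjoint X y" for x y
    unfolding adjoint_def by (rule someI2_ex) blast
  have "bounded_linear (adjoint X)"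
  proof (rule bounded_linear_intro[where K = "norm X"])
    fix y z and c :: real
    show "adjoint X (y + z) = adjoint X y + adjoint X z" "adjoint X (c *\<^sub>R y) = c *\<^sub>R adjoint X y"
      by (rule vector_eq_ldot[THEN iffD1]; simp add: inner_simps flip: works)+
    have "(norm (adjoint X y))\<^sup>2 = X (adjoint X y) \<bullet> y"
      by (simp add: power2_norm_eq_inner works)
    also have "\<dots> \<le> norm X * norm (adjoint X y) * norm y"
      by (rule order_trans[OF norm_cauchy_schwarz]) (simp add: mult_right_mono norm_blinfun)
    finally show "norm (adjoint X y) \<le> norm y * norm X"
      by (cases "norm (adjoint X y) = 0") (auto simp: power2_eq_square mult_ac)
  qed
  then show ?thesis
    by (simp add: adj_def bounded_linear_Blinfun_apply works)
qed

lemma adj_inner_left: "adj X y \<bullet> x = y \<bullet> X x"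
  by (metis adj_inner_right inner_commute)

lemma adj_eqI:
  fixes X :: "'a::{real_inner, polish_space} \<Rightarrow>\<^sub>L 'b::{real_inner, polish_space}" and Y :: "'b \<Rightarrow>\<^sub>L 'a"
  assumes "\<And>x y. X x \<bullet> y = x \<bullet> Y y"
  shows "adj X = Y"
  by (rule blinfun_eqI, rule vector_eq_ldot[THEN iffD1]) (simp add: adj_inner_right assms)

lemma norm_adj_le: "norm (adj X) \<le> norm X"
proof (rule norm_blinfun_bound)
  fix y
  have "(norm (adj X y))\<^sup>2 = X (adj X y) \<bullet> y"
    by (simp add: power2_norm_eq_inner adj_inner_right)
  also have "\<dots> \<le> norm X * norm (adj X y) * norm y"
    by (rule order_trans[OF norm_cauchy_schwarz]) (simp add: mult_right_mono norm_blinfun)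
  finally show "norm (adj X y) \<le> norm X * norm y"
    by (cases "norm (adj X y) = 0") (auto simp: power2_eq_square mult_ac)
qed simp

lemma subspace_closure:
  fixes V :: "'a::real_normed_vector set"
  assumes "subspace V"
  shows "subspace (closure V)"
proof (rule subspaceI)
  show "0 \<in> closure V"
    using subspace_0[OF assms] closure_subset by blast
next
  fix x y assume "x \<in> closure V" "y \<in> closure V"
  then obtain f g where "\<And>n. f n \<in> V" "f \<longlonglongrightarrow> x" "\<And>n. g n \<in> V" "g \<longlonglongrightarrow> y"
    unfolding closure_sequential by blast
  then show "x + y \<in> closure V"
    unfolding closure_sequential by (intro exI[of _ "\<lambda>n. f n + g n"]) (auto intro: subspace_add[OF assms] tendsto_add)
next
  fix c :: real and x assume "x \<in> closure V"
  then obtain f where "\<And>n. f n \<in> V" "f \<longlonglongrightarrow> x"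
    unfolding closure_sequential by blast
  then show "c *\<^sub>R x \<in> closure V"
    unfolding closure_sequential by (intro exI[of _ "\<lambda>n. c *\<^sub>R f n"]) (auto intro: subspace_scale[OF assms] tendsto_intros)
qed

text \<open>
A vector orthogonal to the range of the adjoint lies in the kernel of \<open>X\<close>.
\<close>

lemma closure_range_adj:
  fixes X :: "'a::{real_inner, polish_space} \<Rightarrow>\<^sub>L 'b::{real_inner, polish_space}"
  assumes "\<And>x. X x = 0 \<Longrightarrow> x = 0"
  shows "closure (range (adj X)) = UNIV"
proof (rule UNIV_eq_I[symmetric])
  fix x
  have "subspace (range (adj X))"
    by (intro linear_subspace_image subspace_UNIV bounded_linear.linear blinfun.bounded_linear_right)
  then have "subspace (closure (range (adj X)))"
    by (rule subspace_closure)
  then obtain p where p: "p \<in> closure (range (adj X))"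
      "\<And>v. v \<in> closure (range (adj X)) \<Longrightarrow> (x - p) \<bullet> v = 0"
    using closed_subspace_projection closed_closure by blast
  have "X (x - p) \<bullet> y = 0" for y
    using p(2)[of "adj X y"] closure_subset[of "range (adj X)"] by (auto simp: adj_inner_right)
  then have "x - p = 0"
    by (intro assms) (metis inner_eq_zero_iff)
  then show "x \<in> closure (range (adj X))" using p by simp
qed

text \<open>
The principle of uniform boundedness, by the Baire category theorem. It is needed for \<open>P\<close>, which is
only strongly continuous.
\<close>

lemma uniform_boundedness:
  fixes X :: "'i \<Rightarrow> 'a::{real_normed_vector, complete_space} \<Rightarrow>\<^sub>L 'b::real_normed_vector"
  assumes "\<And>x. \<exists>c. \<forall>i\<in>I. norm (X i x) \<le> c"
  obtains c where "c \<ge> 0" "\<And>i. i \<in> I \<Longrightarrow> norm (X i) \<le> c"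
proof -
  define F where "F n = {x. \<forall>i\<in>I. norm (X i x) \<le> real n}" for n :: nat
  have closed: "closed (F n)" for n
  proof -
    have "F n = (\<Inter>i\<in>I. {x. norm (X i x) \<le> real n})" by (auto simp: F_def)
    then show ?thesis
      by (auto intro!: closed_INT closed_Collect_le continuous_intros)
  qed
  have "x \<in> (\<Union>n. F n)" for x
  proof -
    obtain c where "\<forall>i\<in>I. norm (X i x) \<le> c" using assms by blast
    moreover obtain n where "c \<le> real n" using real_arch_simple by blast
    ultimately show ?thesis unfolding F_def by (auto intro!: exI[of _ n] intro: order_trans)
  qed
  then have UN: "(\<Union>n. F n) = UNIV" by blast
  have "\<exists>n. interior (F n) \<noteq> {}"
  proof (rule ccontr)
    assume "\<not> ?thesis"
    then have "euclidean interior_of \<Union> (range F) = {}"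
      using closed by (intro Baire_category_alt) (auto simp: completely_metrizable_space_euclidean)
    then show False using UN by simp
  qed
  then obtain n x where "x \<in> interior (F n)" by blast
  then obtain e where e: "e > 0" "cball x e \<subseteq> F n"
    using mem_interior_cball by blast
  have "norm (X i) \<le> 2 * real n / e" if i: "i \<in> I" for i
  proof (rule norm_blinfun_bound)
    fix y
    show "norm (X i y) \<le> 2 * real n / e * norm y"
    proof (cases "y = 0")
      case False
      define r where "r = e / norm y"
      have r: "r > 0" using e False by (simp add: r_def)
      have "x \<in> F n" "x + r *\<^sub>R y \<in> F n"
        using e False by (auto intro!: subsetD[OF e(2)] simp: r_def dist_norm)
      then have "norm (X i x) \<le> real n" "norm (X i (x + r *\<^sub>R y)) \<le> real n"
        using i by (auto simp: F_def)
      moreover have "r * norm (X i y) = norm (X i (x + r *\<^sub>R y) - X i x)"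
        using r by (simp add: blinfun.bilinear_simps)
      ultimately have "r * norm (X i y) \<le> 2 * real n"
        using norm_triangle_ineq4[of "X i (x + r *\<^sub>R y)" "X i x"] by linarith
      then show ?thesis using e False by (simp add: r_def field_simps)
    qed simp
  qed (use e in simp)
  then show thesis using that[of "2 * real n / e"] e by simp
qed

lemma continuous_on_strong_apply:
  fixes X :: "'t::topological_space \<Rightarrow> 'a::real_normed_vector \<Rightarrow>\<^sub>L 'b::real_normed_vector"
  assumes X: "\<And>x. continuous_on S (\<lambda>t. X t x)"
    and bound: "\<And>t. t \<in> S \<Longrightarrow> norm (X t) \<le> c"
    and f: "continuous_on S f"
  shows "continuous_on S (\<lambda>t. X t (f t))"
  unfolding continuous_on_def
proof
  fix t assume t: "t \<in> S"
  have "((\<lambda>s. f s - f t) \<longlongrightarrow> 0) (at t within S)"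
    using f t by (auto simp: continuous_on_def LIM_zero_iff)
  then have lim0: "((\<lambda>s. norm (f s - f t) * c) \<longlongrightarrow> 0) (at t within S)"
    by (intro tendsto_mult_left_zero tendsto_norm_zero)
  have "((\<lambda>s. X s (f s - f t)) \<longlongrightarrow> 0) (at t within S)"
  proof (rule Lim_null_comparison[OF _ lim0])
    have "norm (X s (f s - f t)) \<le> norm (f s - f t) * c" if "s \<in> S" for s
    proof -
      have "norm (X s (f s - f t)) \<le> norm (X s) * norm (f s - f t)" by (rule norm_blinfun)
      also have "\<dots> \<le> c * norm (f s - f t)" by (intro mult_right_mono bound that) simp
      finally show ?thesis by (simp add: mult.commute)
    qed
    then show "\<forall>\<^sub>F s in at t within S. norm (X s (f s - f t)) \<le> norm (f s - f t) * c"
      by (simp add: eventually_at_filter)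
  qed
  moreover have "((\<lambda>s. X s (f t)) \<longlongrightarrow> X t (f t)) (at t within S)"
    using X[of "f t"] t by (auto simp: continuous_on_def)
  ultimately have "((\<lambda>s. X s (f s - f t) + X s (f t)) \<longlongrightarrow> 0 + X t (f t)) (at t within S)"
    by (rule tendsto_add)
  then show "((\<lambda>s. X s (f s)) \<longlongrightarrow> X t (f t)) (at t within S)"
    by (simp add: blinfun.bilinear_simps)
qed

text \<open>
The product rule survives when \<open>X\<close> is differentiable only along the single vector \<open>w t\<close>: in
\<open>X s (w s) - X t (w t) = (X s (w t) - X t (w t)) + X s (w s - w t)\<close> the second term needs no more than
boundedness and strong continuity of \<open>X\<close>.
\<close>

lemma has_vector_derivative_strong_apply:
  fixes X :: "real \<Rightarrow> 'a::real_normed_vector \<Rightarrow>\<^sub>L 'b::real_normed_vector"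
  assumes t: "t \<in> S"
    and X: "\<And>x. continuous_on S (\<lambda>t. X t x)"
    and bound: "\<And>t. t \<in> S \<Longrightarrow> norm (X t) \<le> c"
    and dX: "((\<lambda>s. X s (w t)) has_vector_derivative d) (at t within S)"
    and dw: "(w has_vector_derivative w') (at t within S)"
  shows "((\<lambda>s. X s (w s)) has_vector_derivative d + X t w') (at t within S)"
proof -
  have "((\<lambda>s. (1 / norm (s - t)) *\<^sub>R (X s (w t) - (X t (w t) + (s - t) *\<^sub>R d))) \<longlongrightarrow> 0) (at t within S)"
    using dX by (simp add: has_vector_derivative_def has_derivative_within)
  moreover have w: "((\<lambda>s. (1 / norm (s - t)) *\<^sub>R (w s - (w t + (s - t) *\<^sub>R w'))) \<longlongrightarrow> 0) (at t within S)"
    using dw by (simp add: has_vector_derivative_def has_derivative_within)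
  have "((\<lambda>s. X s ((1 / norm (s - t)) *\<^sub>R (w s - (w t + (s - t) *\<^sub>R w')))) \<longlongrightarrow> 0) (at t within S)"
  proof (rule Lim_null_comparison)
    have *: "norm (X s y) \<le> c * norm y" if "s \<in> S" for s y
      using order_trans[OF norm_blinfun mult_right_mono[OF bound[OF that] norm_ge_zero]] .
    then show "\<forall>\<^sub>F s in at t within S. norm (X s ((1 / norm (s - t)) *\<^sub>R (w s - (w t + (s - t) *\<^sub>R w'))))
        \<le> c * norm ((1 / norm (s - t)) *\<^sub>R (w s - (w t + (s - t) *\<^sub>R w')))"
      unfolding eventually_at_filter by (intro always_eventually allI impI) (rule *)
    show "((\<lambda>s. c * norm ((1 / norm (s - t)) *\<^sub>R (w s - (w t + (s - t) *\<^sub>R w')))) \<longlongrightarrow> 0) (at t within S)"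
      by (intro tendsto_mult_right_zero tendsto_norm_zero w)
  qed
  moreover have "((\<lambda>s. ((s - t) / norm (s - t)) *\<^sub>R (X s w' - X t w')) \<longlongrightarrow> 0) (at t within S)"
  proof (rule Lim_null_comparison)
    show "\<forall>\<^sub>F s in at t within S. norm (((s - t) / norm (s - t)) *\<^sub>R (X s w' - X t w')) \<le> norm (X s w' - X t w')"
      by (intro always_eventually allI) (auto simp: mult_le_cancel_right1)
    show "((\<lambda>s. norm (X s w' - X t w')) \<longlongrightarrow> 0) (at t within S)"
      using X[of w'] t by (intro tendsto_norm_zero) (auto simp: continuous_on_def LIM_zero_iff)
  qed
  ultimately have "((\<lambda>s. (1 / norm (s - t)) *\<^sub>R (X s (w t) - (X t (w t) + (s - t) *\<^sub>R d))
      + X s ((1 / norm (s - t)) *\<^sub>R (w s - (w t + (s - t) *\<^sub>R w')))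
      + ((s - t) / norm (s - t)) *\<^sub>R (X s w' - X t w')) \<longlongrightarrow> 0) (at t within S)"
    using tendsto_add[OF tendsto_add, of _ 0 _ _ 0 _ 0] by simp
  moreover have "(1 / norm (s - t)) *\<^sub>R (X s (w t) - (X t (w t) + (s - t) *\<^sub>R d))
      + X s ((1 / norm (s - t)) *\<^sub>R (w s - (w t + (s - t) *\<^sub>R w')))
      + ((s - t) / norm (s - t)) *\<^sub>R (X s w' - X t w')
    = (1 / norm (s - t)) *\<^sub>R (X s (w s) - (X t (w t) + (s - t) *\<^sub>R (d + X t w')))" for s
    by (simp add: blinfun.bilinear_simps algebra_simps diff_divide_distrib)
  ultimately show ?thesis
    by (simp add: has_vector_derivative_def has_derivative_within bounded_linear_scaleR_left)
qed

section \<open>Weak limits\<close>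

text \<open>
Boundedness extends the convergence from \<open>W\<close> to all test vectors, and the limit functional is represented
by the Riesz theorem.
\<close>

lemma weak_limit_from_dense:
  fixes u :: "nat \<Rightarrow> 'a::{real_inner, complete_space}"
  assumes bound: "\<And>n. norm (u n) \<le> c"
    and dense: "closure W = UNIV"
    and conv: "\<And>v. v \<in> W \<Longrightarrow> convergent (\<lambda>n. u n \<bullet> v)"
  obtains w where "norm w \<le> c" "\<And>v. (\<lambda>n. u n \<bullet> v) \<longlonglongrightarrow> w \<bullet> v"
proof -
  have c: "0 \<le> c" using bound[of 0] norm_ge_zero order_trans by blast
  have "convergent (\<lambda>n. u n \<bullet> v)" for v
    unfolding Cauchy_convergent_iff[symmetric]
  proof (rule metric_CauchyI)
    fix e :: real assume "e > 0"
    then have "e / (3 * (c + 1)) > 0" using c by simp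
    then obtain v' where v': "v' \<in> W" "dist v' v < e / (3 * (c + 1))"
      using dense closure_approachable[of v W] by auto
    have close: "\<bar>u n \<bullet> v - u n \<bullet> v'\<bar> < e / 3" for n
    proof -
      have "\<bar>u n \<bullet> v - u n \<bullet> v'\<bar> \<le> norm (u n) * norm (v - v')"
        by (metis Cauchy_Schwarz_ineq2 inner_diff_right)
      also have "\<dots> \<le> (c + 1) * norm (v - v')"
        using bound[of n] by (intro mult_right_mono) auto
      also have "\<dots> < (c + 1) * (e / (3 * (c + 1)))"
        using v'(2) c by (intro mult_strict_left_mono) (auto simp: dist_norm norm_minus_commute)
      also have "\<dots> = e / 3" using c by (simp add: divide_simps)
      finally show ?thesis .
    qed
    have "Cauchy (\<lambda>n. u n \<bullet> v')"
      using conv[OF v'(1)] by (simp add: Cauchy_convergent_iff)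
    then obtain N where N: "\<And>m n. m \<ge> N \<Longrightarrow> n \<ge> N \<Longrightarrow> dist (u m \<bullet> v') (u n \<bullet> v') < e / 3"
      using \<open>e > 0\<close> metric_CauchyD[of "\<lambda>n. u n \<bullet> v'" "e/3"] by auto
    have "dist (u m \<bullet> v) (u n \<bullet> v) < e" if "m \<ge> N" "n \<ge> N" for m n
      using N[OF that] close[of m] close[of n] unfolding dist_real_def by linarith
    then show "\<exists>N. \<forall>m\<ge>N. \<forall>n\<ge>N. dist (u m \<bullet> v) (u n \<bullet> v) < e" by blast
  qed
  then have lim: "(\<lambda>n. u n \<bullet> v) \<longlonglongrightarrow> lim (\<lambda>n. u n \<bullet> v)" for v
    by (simp add: convergent_LIMSEQ_iff)
  define f where "f v = lim (\<lambda>n. u n \<bullet> v)" for v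
  have f: "(\<lambda>n. u n \<bullet> v) \<longlonglongrightarrow> f v" for v
    using lim by (simp add: f_def)
  have f_bound: "norm (f v) \<le> norm v * c" for v
  proof (rule LIMSEQ_le_const2[OF tendsto_norm[OF f]], intro exI allI impI)
    fix n
    have "\<bar>u n \<bullet> v\<bar> \<le> norm (u n) * norm v" by (rule Cauchy_Schwarz_ineq2)
    also have "\<dots> \<le> c * norm v" using bound[of n] by (intro mult_right_mono) auto
    finally show "norm (u n \<bullet> v) \<le> norm v * c" by (simp add: mult.commute)
  qed
  have "bounded_linear f"
  proof (rule bounded_linear_intro[OF _ _ f_bound])
    fix v w and r :: real
    show "f (v + w) = f v + f w"
      using f[of "v + w"] tendsto_add[OF f f, of v w] LIMSEQ_unique by (simp add: inner_add_right) blast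
    show "f (r *\<^sub>R v) = r *\<^sub>R f v"
      using f[of "r *\<^sub>R v"] tendsto_mult_left[OF f, of r v] LIMSEQ_unique by simp blast
  qed
  then obtain w where w: "\<And>v. f v = v \<bullet> w" by (rule riesz_representation) blast
  show thesis
  proof (rule that[of w])
    have "norm w * norm w \<le> norm w * c"
      using f_bound[of w] by (simp add: w power2_norm_eq_inner[symmetric] power2_eq_square)
    then show "norm w \<le> c" using c by (cases "norm w = 0") auto
    show "(\<lambda>n. u n \<bullet> v) \<longlonglongrightarrow> w \<bullet> v" for v
      using f[of v] by (simp add: w inner_commute)
  qed
qed

lemma norm_weak_limit_le:
  fixes w :: "'a::real_inner"
  assumes "\<And>v. (\<lambda>n. u n \<bullet> v) \<longlonglongrightarrow> w \<bullet> v" "\<And>n. norm (u n) \<le> c"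
  shows "norm w \<le> c"
proof (cases "w = 0")
  case True
  then show ?thesis using order_trans[OF norm_ge_zero assms(2)] by simp
next
  case False
  have "w \<bullet> w \<le> c * norm w"
  proof (rule LIMSEQ_le_const2[OF assms(1)], intro exI allI impI)
    fix n
    have "u n \<bullet> w \<le> norm (u n) * norm w" by (rule norm_cauchy_schwarz)
    also have "\<dots> \<le> c * norm w" by (intro mult_right_mono assms) simp
    finally show "u n \<bullet> w \<le> c * norm w" .
  qed
  then have "norm w * norm w \<le> c * norm w"
    by (simp add: power2_norm_eq_inner[symmetric] power2_eq_square)
  then show ?thesis using False by simp
qed

lemma weak_limit_unique:
  fixes x y :: "'a::real_inner"
  assumes "\<And>v. (\<lambda>n. u n \<bullet> v) \<longlonglongrightarrow> x \<bullet> v" "\<And>v. (\<lambda>n. u n \<bullet> v) \<longlonglongrightarrow> y \<bullet> v"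
  shows "x = y"
  by (rule vector_eq_rdot[THEN iffD1, OF allI]) (rule LIMSEQ_unique[OF assms])

lemma compact_box_fun:
  fixes b :: "'i::countable \<Rightarrow> real"
  shows "compact {f. \<forall>i. \<bar>f i\<bar> \<le> b i}"
proof -
  have "compactin (product_topology (\<lambda>_. euclidean) UNIV) (PiE UNIV (\<lambda>i. {- b i..b i}))"
    by (subst compactin_PiE) auto
  moreover have "f i \<in> {- b i..b i} \<longleftrightarrow> \<bar>f i\<bar> \<le> b i" for f :: "'i \<Rightarrow> real" and i
    unfolding atLeastAtMost_iff by linarith
  then have "PiE UNIV (\<lambda>i. {- b i..b i}) = {f. \<forall>i. \<bar>f i\<bar> \<le> b i}"
    by (simp only: PiE_UNIV_domain Pi_def UNIV_I simp_thms)
  ultimately show ?thesis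
    by (simp add: euclidean_product_topology)
qed

text \<open>
Cantor's diagonal argument, obtained from sequential compactness of a product of countably many compact
intervals, which is metrizable.
\<close>

lemma diagonal_subsequence:
  fixes \<Phi> :: "nat \<Rightarrow> 'i::countable \<Rightarrow> real"
  assumes "\<And>n i. \<bar>\<Phi> n i\<bar> \<le> b i"
  obtains k l where "strict_mono (k :: nat \<Rightarrow> nat)" "\<And>i. (\<lambda>n. \<Phi> (k n) i) \<longlonglongrightarrow> l i"
proof -
  have "seq_compact {f. \<forall>i. \<bar>f i\<bar> \<le> b i}"
    using compact_box_fun compact_eq_seq_compact_metric by blast
  moreover have "\<forall>n. \<Phi> n \<in> {f. \<forall>i. \<bar>f i\<bar> \<le> b i}" using assms by simp
  ultimately obtain l k where k: "strict_mono (k :: nat \<Rightarrow> nat)" "(\<Phi> \<circ> k) \<longlonglongrightarrow> l"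
    unfolding seq_compact_def by blast
  have "(\<lambda>n. \<Phi> (k n) i) \<longlonglongrightarrow> l i" for i
    using continuous_on_tendsto_compose[OF continuous_on_product_coordinates[of i] k(2)] by simp
  with k(1) show thesis by (rule that)
qed

text \<open>
The numbers \<open>J (u n t) \<bullet> y\<close> are made to converge for countably many pairs of a time and a test vector. The
Lipschitz condition passes from these times to all times, and the vectors \<open>adj J y\<close> are dense because \<open>J\<close>
is injective.
\<close>

lemma weakly_convergent_subsequence:
  fixes u :: "nat \<Rightarrow> real \<Rightarrow> 'h::{real_inner, polish_space}" and J :: "'h \<Rightarrow>\<^sub>L 'h"
  assumes T: "0 \<le> T" and J: "\<And>x. J x = 0 \<Longrightarrow> x = 0"
    and bound: "\<And>n t. t \<in> {0..T} \<Longrightarrow> norm (u n t) \<le> c"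
    and lip: "\<And>n s t. s \<in> {0..T} \<Longrightarrow> t \<in> {0..T} \<Longrightarrow> norm (J (u n t) - J (u n s)) \<le> L * \<bar>t - s\<bar>"
  obtains k u' where "strict_mono (k :: nat \<Rightarrow> nat)"
    "\<And>t v. t \<in> {0..T} \<Longrightarrow> (\<lambda>n. u (k n) t \<bullet> v) \<longlonglongrightarrow> u' t \<bullet> v"
proof -
  obtain Y :: "'h set" where Y: "countable Y" "\<And>X. open X \<Longrightarrow> X \<noteq> {} \<Longrightarrow> \<exists>d\<in>Y. d \<in> X"
    by (rule countable_dense_setE) blast
  have "x \<in> closure Y" for x
  proof (unfold closure_approachable, intro allI impI)
    fix e :: real assume "e > 0"
    then obtain d where "d \<in> Y" "d \<in> ball x e" using Y(2)[of "ball x e"] by auto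
    then show "\<exists>d\<in>Y. dist d x < e" by (auto simp: dist_commute)
  qed
  then have Y_dense: "closure Y = UNIV" by blast
  define y where "y = from_nat_into Y"
  define \<tau> where "\<tau> i = max 0 (min T (of_rat (nat_to_rat_surj i)))" for i
  have \<tau>: "\<tau> i \<in> {0..T}" for i using T by (auto simp: \<tau>_def)
  have c: "0 \<le> c" using order_trans[OF norm_ge_zero bound[of 0]] T by simp
  define \<Phi> where "\<Phi> n ij = J (u n (\<tau> (fst ij))) \<bullet> y (snd ij)" for n ij
  have \<Phi>_bound: "\<bar>\<Phi> n ij\<bar> \<le> norm J * c * norm (y (snd ij))" for n ij
    unfolding \<Phi>_def
    by (intro order_trans[OF Cauchy_Schwarz_ineq2] mult_right_mono order_trans[OF norm_blinfun]
        mult_left_mono bound \<tau>) auto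
  obtain k l where k: "strict_mono (k :: nat \<Rightarrow> nat)" and l: "\<And>ij. (\<lambda>n. \<Phi> (k n) ij) \<longlonglongrightarrow> l ij"
    by (rule diagonal_subsequence[of \<Phi>, OF \<Phi>_bound]) (rule that)
  have conv_y: "convergent (\<lambda>n. u (k n) t \<bullet> adj J (y j))" if t: "t \<in> {0..T}" for t j
    unfolding Cauchy_convergent_iff[symmetric]
  proof (rule metric_CauchyI)
    fix e :: real assume e: "e > 0"
    define a where "a = \<bar>L\<bar> * norm (y j) + 1"
    have a: "a > 0" unfolding a_def by (intro add_nonneg_pos mult_nonneg_nonneg) auto
    define d where "d = e / (3 * a)"
    have d: "d > 0" using e a by (simp add: d_def)
    obtain q where q: "t < of_rat q" "of_rat q < t + d" using of_rat_dense[of t "t + d"] d by auto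
    obtain i where i: "nat_to_rat_surj i = q" using surj_nat_to_rat_surj by (metis surjD)
    have close: "\<bar>\<tau> i - t\<bar> \<le> d" using q t i by (auto simp: \<tau>_def)
    have near: "\<bar>u (k n) t \<bullet> adj J (y j) - \<Phi> (k n) (i, j)\<bar> < e / 3" for n
    proof -
      have "\<bar>u (k n) t \<bullet> adj J (y j) - \<Phi> (k n) (i, j)\<bar> = \<bar>(J (u (k n) t) - J (u (k n) (\<tau> i))) \<bullet> y j\<bar>"
        by (simp add: \<Phi>_def adj_inner_right inner_diff_left)
      also have "\<dots> \<le> norm (J (u (k n) t) - J (u (k n) (\<tau> i))) * norm (y j)" by (rule Cauchy_Schwarz_ineq2)
      also have "\<dots> \<le> (\<bar>L\<bar> * d) * norm (y j)"
      proof (rule mult_right_mono)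
        have "norm (J (u (k n) t) - J (u (k n) (\<tau> i))) \<le> L * \<bar>t - \<tau> i\<bar>" by (rule lip[OF \<tau> t])
        also have "\<dots> \<le> \<bar>L\<bar> * d" using close by (intro mult_mono) auto
        finally show "norm (J (u (k n) t) - J (u (k n) (\<tau> i))) \<le> \<bar>L\<bar> * d" .
      qed simp
      also have "\<dots> = (\<bar>L\<bar> * norm (y j)) * d" by simp
      also have "\<dots> < a * d" using d by (intro mult_strict_right_mono) (auto simp: a_def)
      also have "\<dots> = e / 3" using a by (simp add: d_def)
      finally show ?thesis .
    qed
    have "Cauchy (\<lambda>n. \<Phi> (k n) (i, j))" by (rule LIMSEQ_imp_Cauchy[OF l])
    then obtain m where m: "\<And>p q. p \<ge> m \<Longrightarrow> q \<ge> m \<Longrightarrow> dist (\<Phi> (k p) (i, j)) (\<Phi> (k q) (i, j)) < e / 3"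
      using metric_CauchyD[of "\<lambda>n. \<Phi> (k n) (i, j)" "e / 3"] e by auto
    have "dist (u (k p) t \<bullet> adj J (y j)) (u (k q) t \<bullet> adj J (y j)) < e" if "p \<ge> m" "q \<ge> m" for p q
      using m[OF that] near[of p] near[of q] unfolding dist_real_def by linarith
    then show "\<exists>m. \<forall>p\<ge>m. \<forall>q\<ge>m. dist (u (k p) t \<bullet> adj J (y j)) (u (k q) t \<bullet> adj J (y j)) < e" by blast
  qed
  have dense: "closure (adj J ` Y) = UNIV"
  proof -
    have "adj J ` closure Y \<subseteq> closure (adj J ` Y)"
      by (rule image_closure_subset[OF linear_continuous_on[OF blinfun.bounded_linear_right]
          closed_closure closure_subset])
    then have "closure (range (adj J)) \<subseteq> closure (adj J ` Y)"
      unfolding Y_dense by (rule closure_minimal) simp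
    then show ?thesis using closure_range_adj[OF J] by auto
  qed
  have "\<exists>w. \<forall>v. (\<lambda>n. u (k n) t \<bullet> v) \<longlonglongrightarrow> w \<bullet> v" if t: "t \<in> {0..T}" for t
  proof -
    have conv: "convergent (\<lambda>n. u (k n) t \<bullet> v)" if v: "v \<in> adj J ` Y" for v
    proof -
      obtain x where x: "x \<in> Y" "v = adj J x" using v by blast
      obtain j where "from_nat_into Y j = x"
        using from_nat_into_surj[OF Y(1) x(1)] by blast
      then show ?thesis using conv_y[OF t, of j] x(2) by (simp add: y_def)
    qed
    obtain w where "\<And>v. (\<lambda>n. u (k n) t \<bullet> v) \<longlonglongrightarrow> w \<bullet> v"
      by (rule weak_limit_from_dense[where u = "\<lambda>n. u (k n) t", OF bound[OF t] dense conv], assumption, rule that)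
    then show ?thesis by blast
  qed
  then have "\<forall>t. \<exists>w. t \<in> {0..T} \<longrightarrow> (\<forall>v. (\<lambda>n. u (k n) t \<bullet> v) \<longlonglongrightarrow> w \<bullet> v)" by blast
  then obtain u' where "\<And>t v. t \<in> {0..T} \<Longrightarrow> (\<lambda>n. u (k n) t \<bullet> v) \<longlonglongrightarrow> u' t \<bullet> v"
    unfolding choice_iff by blast
  with k show thesis by (rule that)
qed

section \<open>Linear evolution equations with bounded coefficients\<close>

lemma gronwall:
  fixes u :: "real \<Rightarrow> real"
  assumes u: "continuous_on {0..T} u" and a: "0 \<le> a"
    and le: "\<And>t. t \<in> {0..T} \<Longrightarrow> u t \<le> c + a * integral {0..t} u"
    and t: "t \<in> {0..T}"
  shows "u t \<le> c * exp (a * t)"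
proof -
  define v where "v s = exp (- a * s) * (c + a * integral {0..s} u)" for s
  have dI: "((\<lambda>s. integral {0..s} u) has_real_derivative u s) (at s within {0..T})" if "s \<in> {0..T}" for s
    using integral_has_vector_derivative[OF u that]
    by (simp add: has_real_derivative_iff_has_vector_derivative)
  have dv: "(v has_real_derivative (a * exp (- a * s)) * (u s - (c + a * integral {0..s} u)))
      (at s within {0..T})" if "s \<in> {0..T}" for s
    unfolding v_def by (auto intro!: derivative_eq_intros dI[OF that] simp: algebra_simps)
  have "v t \<le> v 0"
  proof (rule DERIV_nonpos_imp_decreasing_open[of 0 t v])
    show "0 \<le> t" using t by simp
    show "continuous_on {0..t} v"
      using t by (intro DERIV_continuous_on[where D = "\<lambda>s. (a * exp (- a * s)) * (u s - (c + a * integral {0..s} u))"])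
        (rule DERIV_subset[OF dv], auto)
    fix s assume s: "0 < s" "s < t"
    then have "at s within {0..T} = at s" using t by (intro at_within_interior) auto
    then have "(v has_real_derivative (a * exp (- a * s)) * (u s - (c + a * integral {0..s} u))) (at s)"
      using dv[of s] s t by simp
    moreover have "(a * exp (- a * s)) * (u s - (c + a * integral {0..s} u)) \<le> 0"
      using le[of s] s t a by (intro mult_nonneg_nonpos) auto
    ultimately show "\<exists>y. (v has_real_derivative y) (at s) \<and> y \<le> 0" by blast
  qed
  then have "exp (- a * t) * (c + a * integral {0..t} u) \<le> c"
    by (simp add: v_def)
  then have "c + a * integral {0..t} u \<le> c * exp (a * t)"
    by (simp add: exp_minus field_simps)
  with le[OF t] show ?thesis by linarith
qed

lemma norm_diff_le_of_derivative:
  fixes f :: "real \<Rightarrow> 'a::real_normed_vector"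
  assumes "a \<le> b"
    and f: "\<And>t. t \<in> {a..b} \<Longrightarrow> (f has_vector_derivative f' t) (at t within {a..b})"
    and \<phi>: "\<And>t. t \<in> {a..b} \<Longrightarrow> (\<phi> has_vector_derivative \<phi>' t) (at t within {a..b})"
    and le: "\<And>t. t \<in> {a..b} \<Longrightarrow> norm (f' t) \<le> \<phi>' t"
  shows "norm (f b - f a) \<le> \<phi> b - \<phi> a"
proof (cases "a = b")
  case False
  show ?thesis
  proof (rule differentiable_bound_general[where f' = f' and \<phi>' = \<phi>'])
    show "a < b" using assms False by simp
    show "continuous_on {a..b} f" "continuous_on {a..b} \<phi>"
      by (rule continuous_on_vector_derivative, erule f \<phi>)+
    fix t assume t: "a < t" "t < b"
    then have "at t within {a..b} = at t" by (intro at_within_interior) auto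
    with f[of t] \<phi>[of t] le[of t] t
    show "(f has_vector_derivative f' t) (at t)" "(\<phi> has_vector_derivative \<phi>' t) (at t)" "norm (f' t) \<le> \<phi>' t"
      by auto
  qed
qed simp

lemma norm_diff_le_of_bounded_derivative:
  fixes f :: "real \<Rightarrow> 'a::real_normed_vector"
  assumes "a \<le> b"
    and f: "\<And>t. t \<in> {a..b} \<Longrightarrow> (f has_vector_derivative f' t) (at t within {a..b})"
    and le: "\<And>t. t \<in> {a..b} \<Longrightarrow> norm (f' t) \<le> C"
  shows "norm (f b - f a) \<le> C * (b - a)"
proof -
  have "((\<lambda>t. C * t) has_vector_derivative C) (at t within {a..b})" for t
    unfolding has_real_derivative_iff_has_vector_derivative[symmetric]
    by (auto intro!: derivative_eq_intros)
  from norm_diff_le_of_derivative[OF assms(1) f this le] show ?thesis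
    by (simp add: right_diff_distrib)
qed

text \<open>
Picard iteration for \<open>w t = exp (- b * t) *\<^sub>R z t\<close>. With the weight \<open>b = 2 * c + 1\<close> the integral operator is a
contraction with constant \<open>c / b \<le> 1/2\<close> on the whole interval at once. Functions on \<open>{0..T}\<close> are
extended by constants, by means of the projection \<open>p\<close>, to become bounded continuous functions on the line.
\<close>

lemma linear_ode_solution:
  fixes L :: "real \<Rightarrow> 'a::{real_normed_vector, complete_space} \<Rightarrow>\<^sub>L 'a"
  assumes T: "0 \<le> T"
    and L: "\<And>x. continuous_on {0..T} (\<lambda>t. L t x)"
    and bound: "\<And>t. t \<in> {0..T} \<Longrightarrow> norm (L t) \<le> c"
  obtains z where "z 0 = z0"
    "\<And>t. t \<in> {0..T} \<Longrightarrow> (z has_vector_derivative L t (z t)) (at t within {0..T})"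
proof -
  have c: "0 \<le> c" using order_trans[OF norm_ge_zero bound[of 0]] T by simp
  define b where "b = 2 * c + 1"
  have b: "b > 0" using c by (simp add: b_def)
  define I where "I w t = integral {0..t} (\<lambda>s. exp (b * s) *\<^sub>R L s (w s))" for w :: "real \<Rightarrow> 'a" and t
  define F where "F w t = exp (- b * t) *\<^sub>R (z0 + I w t)" for w :: "real \<Rightarrow> 'a" and t
  define p where "p t = max 0 (min T t)" for t :: real
  have p: "p t \<in> {0..T}" for t using T by (auto simp: p_def)
  have p_id: "p t = t" if "t \<in> {0..T}" for t using that by (auto simp: p_def)
  have cont_w: "continuous_on S (apply_bcontfun w)" for w :: "real \<Rightarrow>\<^sub>C 'a" and S
    by (rule continuous_on_subset[of UNIV]) (use apply_bcontfun[of w] in \<open>auto simp: bcontfun_def\<close>)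
  have cont_int: "continuous_on {0..T} (\<lambda>s. exp (b * s) *\<^sub>R L s (w s))" if "continuous_on {0..T} w" for w
    by (intro continuous_intros continuous_on_strong_apply[OF L bound] that)
  have dI: "(I w has_vector_derivative exp (b * t) *\<^sub>R L t (w t)) (at t within {0..T})"
    if "continuous_on {0..T} w" "t \<in> {0..T}" for w t
    unfolding I_def by (rule integral_vector_derivative[OF cont_int]) fact+
  have cont_F: "continuous_on {0..T} (F w)" if "continuous_on {0..T} w" for w
  proof -
    have "continuous_on {0..T} (I w)"
      by (rule continuous_on_vector_derivative) (rule dI[OF that])
    then show ?thesis unfolding F_def by (intro continuous_intros)
  qed
  have mem: "(\<lambda>t. F w (p t)) \<in> bcontfun" if "continuous_on {0..T} w" for w
  proof -
    have "continuous_on UNIV (\<lambda>t. F w (p t))"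
      by (rule continuous_on_compose2[OF cont_F[OF that]]) (use p in \<open>auto simp: p_def intro!: continuous_intros\<close>)
    moreover have "bounded (range (\<lambda>t. F w (p t)))"
      by (rule bounded_subset[OF compact_imp_bounded[OF compact_continuous_image[OF cont_F[OF that] compact_Icc]]])
        (use p in auto)
    ultimately show ?thesis by (simp add: bcontfun_def)
  qed
  define G where "G w = Bcontfun (\<lambda>t. F (apply_bcontfun w) (p t))" for w
  have G: "apply_bcontfun (G w) t = F (apply_bcontfun w) (p t)" for w t
    unfolding G_def by (subst Bcontfun_inverse[OF mem[OF cont_w]]) simp
  have contraction: "dist (G w) (G v) \<le> 1/2 * dist w v" for w v
  proof (rule dist_bound)
    fix t0
    define t where "t = p t0"
    have t: "0 \<le> t" "t \<le> T" using p[of t0] by (auto simp: t_def)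
    define d where "d = dist w v"
    have d: "0 \<le> d" by (simp add: d_def)
    define f where "f s = I w s - I v s" for s
    have df: "(f has_vector_derivative exp (b * s) *\<^sub>R L s (w s - v s)) (at s within {0..t})"
      if "s \<in> {0..t}" for s
    proof -
      have s: "s \<in> {0..T}" using that t by auto
      from has_vector_derivative_diff[OF dI[OF cont_w s] dI[OF cont_w s], of w v]
      have "(f has_vector_derivative exp (b * s) *\<^sub>R L s (w s - v s)) (at s within {0..T})"
        by (simp only: f_def[abs_def] blinfun.diff_right scaleR_diff_right)
      then show ?thesis
        by (rule has_vector_derivative_within_subset) (use t in auto)
    qed
    have "norm (f t - f 0) \<le> c * d / b * exp (b * t) - c * d / b * exp (b * 0)"
    proof (rule norm_diff_le_of_derivative[OF t(1) df])
      fix s assume s: "s \<in> {0..t}"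
      show "((\<lambda>t. c * d / b * exp (b * t)) has_vector_derivative exp (b * s) * (c * d)) (at s within {0..t})"
        unfolding has_real_derivative_iff_has_vector_derivative[symmetric]
        using b by (auto intro!: derivative_eq_intros)
      have "norm (L s (w s - v s)) \<le> norm (L s) * norm (w s - v s)" by (rule norm_blinfun)
      also have "\<dots> \<le> c * d"
        using bound[of s] s t c dist_bounded[of w s v] unfolding d_def
        by (intro mult_mono) (auto simp: dist_norm)
      finally show "norm (exp (b * s) *\<^sub>R L s (w s - v s)) \<le> exp (b * s) * (c * d)" by simp
    qed
    moreover have "f 0 = 0" by (simp add: f_def I_def)
    moreover have "0 \<le> c * d / b" using c d b by simp
    ultimately have f_le: "norm (f t) \<le> c * d / b * exp (b * t)" by simp
    have "F w t - F v t = exp (- b * t) *\<^sub>R f t"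
      by (simp add: F_def f_def algebra_simps)
    then have "dist (G w t0) (G v t0) = exp (- b * t) * norm (f t)"
      by (simp add: G t_def[symmetric] dist_norm)
    also have "\<dots> \<le> exp (- b * t) * (c * d / b * exp (b * t))"
      by (rule mult_left_mono[OF f_le]) simp
    also have "\<dots> = (c / b) * d * (exp (- b * t) * exp (b * t))"
      by simp
    also have "\<dots> = (c / b) * d"
      by (simp flip: exp_add)
    also have "\<dots> \<le> 1/2 * d"
      using c d by (intro mult_right_mono) (auto simp: b_def divide_simps)
    finally show "dist (G w t0) (G v t0) \<le> 1/2 * dist w v" by (simp add: d_def)
  qed
  have "\<exists>!w. G w = w"
    by (rule banach_fix_type[of "1/2"]) (simp, simp, intro allI contraction)
  then obtain w where w: "G w = w" by blast
  define z where "z t = exp (b * t) *\<^sub>R apply_bcontfun w t" for t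
  have z: "z t = z0 + I (apply_bcontfun w) t" if "t \<in> {0..T}" for t
    using G[of w t] unfolding w p_id[OF that] by (simp add: z_def F_def exp_minus)
  show thesis
  proof (rule that[of z])
    show "z 0 = z0" using z[of 0] T by (simp add: I_def)
    fix t assume t: "t \<in> {0..T}"
    have "((\<lambda>t. z0 + I (apply_bcontfun w) t) has_vector_derivative exp (b * t) *\<^sub>R L t (w t)) (at t within {0..T})"
      using has_vector_derivative_add[OF has_vector_derivative_const dI[OF cont_w t]] by simp
    then have deriv: "((\<lambda>t. z0 + I (apply_bcontfun w) t) has_vector_derivative L t (z t)) (at t within {0..T})"
      by (simp add: z_def blinfun.scaleR_right)
    show "(z has_vector_derivative L t (z t)) (at t within {0..T})"
      by (rule has_vector_derivative_transform[OF t z deriv])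
  qed
qed

section \<open>Semigroups of operators and their resolvents\<close>

lemma difference_quotient_at_right:
  assumes "(f has_vector_derivative d) (at 0 within {0..1})"
  shows "((\<lambda>h. (f h - f 0) /\<^sub>R h) \<longlongrightarrow> d) (at_right 0)"
proof -
  have "((\<lambda>h. (1 / norm (h - 0)) *\<^sub>R (f h - (f 0 + (h - 0) *\<^sub>R d))) \<longlongrightarrow> 0) (at_right 0)"
    using assms by (simp only: has_vector_derivative_def has_derivative_within at_within_Icc_at_right[OF zero_less_one])
  then have "((\<lambda>h. (f h - f 0) /\<^sub>R h - d) \<longlongrightarrow> 0) (at_right 0)"
  proof (rule Lim_transform_eventually)
    show "\<forall>\<^sub>F h in at_right 0. (1 / norm (h - 0)) *\<^sub>R (f h - (f 0 + (h - 0) *\<^sub>R d)) = (f h - f 0) /\<^sub>R h - d"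
      using eventually_at_right_less
      by eventually_elim (simp add: scaleR_diff_right scaleR_add_right divide_inverse)
  qed
  then show ?thesis by (simp add: LIM_zero_iff)
qed

locale semigroup_generator =
  fixes D :: "'h::{real_inner, polish_space} set"
    and A :: "'h \<Rightarrow> 'h"
    and E :: "real \<Rightarrow> ('h \<Rightarrow>\<^sub>L 'h)"
    and M \<omega> :: real
  assumes A_closed: "closed ((\<lambda>x. (x, A x)) ` D)"
    and A_dense: "closure D = UNIV"
    and A_gen: "generates D A E"
    and M_ge: "M \<ge> 1"
    and growth: "\<And>t. t \<ge> 0 \<Longrightarrow> norm (E t) \<le> M * exp (\<omega> * t)"
begin

lemma E_zero [simp]: "E 0 = id_blinfun"
  using A_gen by (simp add: generates_def C0_semigroup_def)

lemma E_add: "s \<ge> 0 \<Longrightarrow> t \<ge> 0 \<Longrightarrow> E (s + t) x = E s (E t x)"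
  using A_gen by (simp add: generates_def C0_semigroup_def)

lemma E_continuous: "continuous_on {0..} (\<lambda>t. E t x)"
  using A_gen by (simp add: generates_def C0_semigroup_def)

lemma generator_iff: "x \<in> D \<longleftrightarrow> (\<exists>y. ((\<lambda>h. (E h x - x) /\<^sub>R h) \<longlongrightarrow> y) (at_right 0))"
  using A_gen by (auto simp: generates_def)

lemma generator_lim: "x \<in> D \<Longrightarrow> ((\<lambda>h. (E h x - x) /\<^sub>R h) \<longlongrightarrow> A x) (at_right 0)"
  using A_gen by (simp add: generates_def)

lemma generatorI:
  assumes "((\<lambda>h. (E h x - x) /\<^sub>R h) \<longlongrightarrow> y) (at_right 0)"
  shows "x \<in> D" "A x = y"
proof -
  show "x \<in> D" using assms generator_iff by blast
  from tendsto_unique[OF _ generator_lim[OF this] assms] show "A x = y" by simp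
qed

lemma generator_add:
  assumes "x \<in> D" "y \<in> D"
  shows "x + y \<in> D" "A (x + y) = A x + A y"
proof -
  have "((\<lambda>h. (E h (x + y) - (x + y)) /\<^sub>R h) \<longlongrightarrow> A x + A y) (at_right 0)"
    using tendsto_add[OF generator_lim[OF assms(1)] generator_lim[OF assms(2)]]
    by (simp add: blinfun.add_right algebra_simps)
  from generatorI[OF this] show "x + y \<in> D" "A (x + y) = A x + A y" by auto
qed

lemma generator_scaleR:
  assumes "x \<in> D"
  shows "c *\<^sub>R x \<in> D" "A (c *\<^sub>R x) = c *\<^sub>R A x"
proof -
  have "((\<lambda>h. (E h (c *\<^sub>R x) - c *\<^sub>R x) /\<^sub>R h) \<longlongrightarrow> c *\<^sub>R A x) (at_right 0)"
    using tendsto_scaleR[OF tendsto_const generator_lim[OF assms], of c]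
    by (simp add: blinfun.scaleR_right algebra_simps)
  from generatorI[OF this] show "c *\<^sub>R x \<in> D" "A (c *\<^sub>R x) = c *\<^sub>R A x" by auto
qed

lemma generator_diff:
  assumes "x \<in> D" "y \<in> D"
  shows "x - y \<in> D" "A (x - y) = A x - A y"
  using generator_add[OF assms(1) generator_scaleR(1)[OF assms(2), of "-1"]]
    generator_scaleR(2)[OF assms(2), of "-1"] by auto

lemma generator_semigroup:
  assumes x: "x \<in> D" and t: "t \<ge> 0"
  shows "E t x \<in> D" "A (E t x) = E t (A x)"
proof -
  have "((\<lambda>h. E t ((E h x - x) /\<^sub>R h)) \<longlongrightarrow> E t (A x)) (at_right 0)"
    by (intro tendsto_intros generator_lim x)
  then have "((\<lambda>h. (E h (E t x) - E t x) /\<^sub>R h) \<longlongrightarrow> E t (A x)) (at_right 0)"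
  proof (rule Lim_transform_eventually)
    show "\<forall>\<^sub>F h in at_right 0. E t ((E h x - x) /\<^sub>R h) = (E h (E t x) - E t x) /\<^sub>R h"
      using eventually_at_right_less
    proof eventually_elim
      case (elim h)
      then show ?case
        using E_add[of h t x] E_add[of t h x] t
        by (simp add: blinfun.bilinear_simps add.commute)
    qed
  qed
  from generatorI[OF this] show "E t x \<in> D" "A (E t x) = E t (A x)" by auto
qed

lemma norm_E_le:
  assumes "0 \<le> t" "t \<le> T"
  shows "norm (E t) \<le> M * exp (\<bar>\<omega>\<bar> * T)"
proof -
  have "\<omega> * t \<le> \<bar>\<omega>\<bar> * t" using assms by (intro mult_right_mono) auto
  also have "\<dots> \<le> \<bar>\<omega>\<bar> * T" using assms by (intro mult_left_mono) auto
  finally have "M * exp (\<omega> * t) \<le> M * exp (\<bar>\<omega>\<bar> * T)" using M_ge by simp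
  with growth[OF assms(1)] show ?thesis by linarith
qed

subsection \<open>An equivalent norm\<close>

text \<open>
In this norm the semigroup is quasi-contractive, \<open>N (E h x) \<le> exp (\<omega> * h) * N x\<close>, so that the
resolvent estimate holds without the factor \<open>M\<close> and does not deteriorate under iteration.
\<close>

definition N :: "'h \<Rightarrow> real" where
  "N x = (SUP t\<in>{0..}. exp (- \<omega> * t) * norm (E t x))"

lemma N_term_bound: "t \<ge> 0 \<Longrightarrow> exp (- \<omega> * t) * norm (E t x) \<le> M * norm x"
proof -
  assume "t \<ge> 0"
  have "exp (- \<omega> * t) * norm (E t x) \<le> exp (- \<omega> * t) * (M * exp (\<omega> * t) * norm x)"
    by (intro mult_left_mono order_trans[OF norm_blinfun] mult_right_mono growth \<open>t \<ge> 0\<close>) auto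
  also have "\<dots> = M * norm x * (exp (- \<omega> * t) * exp (\<omega> * t))" by simp
  also have "\<dots> = M * norm x" by (simp flip: exp_add)
  finally show ?thesis .
qed

lemma N_term_le: "t \<ge> 0 \<Longrightarrow> exp (- \<omega> * t) * norm (E t x) \<le> N x"
  unfolding N_def by (rule cSUP_upper, simp, rule bdd_aboveI2, rule N_term_bound) simp

lemma N_least: "(\<And>t. t \<ge> 0 \<Longrightarrow> exp (- \<omega> * t) * norm (E t x) \<le> c) \<Longrightarrow> N x \<le> c"
  unfolding N_def by (rule cSUP_least) auto

lemma norm_le_N: "norm x \<le> N x"
  using N_term_le[of 0 x] by simp

lemma N_le_norm: "N x \<le> M * norm x"
  by (rule N_least) (rule N_term_bound)

lemma N_nonneg: "0 \<le> N x"
  using norm_le_N[of x] norm_ge_zero[of x] by linarith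

lemma N_add: "N (x + y) \<le> N x + N y"
proof (rule N_least)
  fix t :: real assume t: "t \<ge> 0"
  have "exp (- \<omega> * t) * norm (E t (x + y)) \<le> exp (- \<omega> * t) * (norm (E t x) + norm (E t y))"
    by (intro mult_left_mono) (auto simp: blinfun.add_right norm_triangle_ineq)
  also have "\<dots> \<le> N x + N y"
    using N_term_le[OF t, of x] N_term_le[OF t, of y] by (simp add: distrib_left)
  finally show "exp (- \<omega> * t) * norm (E t (x + y)) \<le> N x + N y" .
qed

lemma N_scaleR_le: "N (c *\<^sub>R x) \<le> \<bar>c\<bar> * N x"
proof (rule N_least)
  fix t :: real assume "t \<ge> 0"
  from mult_left_mono[OF N_term_le[OF this, of x], of "\<bar>c\<bar>"]
  show "exp (- \<omega> * t) * norm (E t (c *\<^sub>R x)) \<le> \<bar>c\<bar> * N x"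
    by (simp add: blinfun.scaleR_right mult_ac)
qed

lemma N_scaleR: "N (c *\<^sub>R x) = \<bar>c\<bar> * N x"
proof (cases "c = 0")
  case True
  then show ?thesis using N_scaleR_le[of c x] N_nonneg[of "c *\<^sub>R x"] by simp
next
  case False
  have "\<bar>c\<bar> * N (inverse c *\<^sub>R c *\<^sub>R x) \<le> \<bar>c\<bar> * (\<bar>inverse c\<bar> * N (c *\<^sub>R x))"
    by (intro mult_left_mono N_scaleR_le) simp
  then show ?thesis using False N_scaleR_le[of c x] by (simp add: abs_mult[symmetric] mult.assoc[symmetric])
qed

lemma N_diff: "\<bar>N x - N y\<bar> \<le> M * norm (x - y)"
  using N_add[of "x - y" y] N_add[of "y - x" x] N_le_norm[of "x - y"] N_le_norm[of "y - x"]
  by (simp add: norm_minus_commute)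

lemma N_continuous: "continuous_on S N"
proof -
  have "M-lipschitz_on S N"
    by (rule lipschitz_onI) (use N_diff M_ge in \<open>auto simp: dist_norm dist_real_def\<close>)
  then show ?thesis by (rule lipschitz_on_continuous_on)
qed

lemma N_semigroup:
  assumes "h \<ge> 0"
  shows "N (E h x) \<le> exp (\<omega> * h) * N x"
proof (rule N_least)
  fix t :: real assume t: "t \<ge> 0"
  have "exp (- \<omega> * t) = exp (\<omega> * h) * exp (- \<omega> * (t + h))"
    by (simp add: algebra_simps flip: exp_add)
  then have "exp (- \<omega> * t) * norm (E t (E h x)) = exp (\<omega> * h) * (exp (- \<omega> * (t + h)) * norm (E (t + h) x))"
    by (simp only: E_add[OF t assms] mult.assoc)
  also have "\<dots> \<le> exp (\<omega> * h) * N x"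
    by (intro mult_left_mono N_term_le) (use t assms in auto)
  finally show "exp (- \<omega> * t) * norm (E t (E h x)) \<le> exp (\<omega> * h) * N x" .
qed

lemma exp_difference_quotient: "((\<lambda>h::real. (1 - exp (- l * h)) / h) \<longlongrightarrow> l) (at_right 0)"
proof -
  have "((\<lambda>h. 1 - exp (- l * h)) has_real_derivative l) (at 0)"
    by (auto intro!: derivative_eq_intros)
  then have "((\<lambda>h. (1 - exp (- l * h)) / h) \<longlongrightarrow> l) (at 0)"
    by (simp add: has_field_derivative_iff)
  then show ?thesis by (rule tendsto_within_subset) simp
qed

text \<open>
The vector \<open>l *\<^sub>R x - A x\<close> is the limit of \<open>(x - exp (- l * h) *\<^sub>R E h x) /\<^sub>R h\<close>, whose \<open>N\<close>-norm is at least
\<open>(1 - exp (- (l - \<omega>) * h)) / h * N x\<close>.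
\<close>

lemma generator_dissipative:
  assumes x: "x \<in> D"
  shows "(l - \<omega>) * N x \<le> N (l *\<^sub>R x - A x)"
proof -
  define g where "g h = ((1 - exp (- l * h)) / h) *\<^sub>R x - exp (- l * h) *\<^sub>R ((E h x - x) /\<^sub>R h)" for h
  have "((\<lambda>h. exp (- l * h)) \<longlongrightarrow> exp (- l * 0)) (at_right 0)"
    by (intro tendsto_intros)
  then have "(g \<longlongrightarrow> l *\<^sub>R x - exp (- l * 0) *\<^sub>R A x) (at_right 0)"
    unfolding g_def
    by (intro tendsto_intros exp_difference_quotient generator_lim x)
  then have "((\<lambda>h. N (g h)) \<longlongrightarrow> N (l *\<^sub>R x - A x)) (at_right 0)"
    using continuous_on_tendsto_compose[OF N_continuous[of UNIV], of g] by simp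
  moreover have "((\<lambda>h. (1 - exp (- (l - \<omega>) * h)) / h * N x) \<longlongrightarrow> (l - \<omega>) * N x) (at_right 0)"
    by (intro tendsto_intros exp_difference_quotient)
  moreover have "\<forall>\<^sub>F h in at_right 0. (1 - exp (- (l - \<omega>) * h)) / h * N x \<le> N (g h)"
    using eventually_at_right_less
  proof eventually_elim
    case (elim h)
    have "N x \<le> N (h *\<^sub>R g h) + N (exp (- l * h) *\<^sub>R E h x)"
    proof -
      define q where "q = (E h x - x) /\<^sub>R h"
      have g_q: "g h = ((1 - exp (- l * h)) / h) *\<^sub>R x - exp (- l * h) *\<^sub>R q"
        by (simp only: g_def q_def)
      have "h *\<^sub>R g h = (h * ((1 - exp (- l * h)) / h)) *\<^sub>R x - exp (- l * h) *\<^sub>R (h *\<^sub>R q)"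
        by (simp add: g_q scaleR_diff_right mult.commute)
      also have "\<dots> = (1 - exp (- l * h)) *\<^sub>R x - exp (- l * h) *\<^sub>R (E h x - x)"
        using elim by (simp add: q_def)
      finally have "h *\<^sub>R g h = (1 - exp (- l * h)) *\<^sub>R x - exp (- l * h) *\<^sub>R (E h x - x)" .
      then have "h *\<^sub>R g h + exp (- l * h) *\<^sub>R E h x = x"
        by (simp add: algebra_simps)
      then show ?thesis using N_add[of "h *\<^sub>R g h" "exp (- l * h) *\<^sub>R E h x"] by simp
    qed
    also have "N (exp (- l * h) *\<^sub>R E h x) \<le> exp (- l * h) * (exp (\<omega> * h) * N x)"
      unfolding N_scaleR using N_semigroup[of h x] elim by simp
    also have "exp (- l * h) * (exp (\<omega> * h) * N x) = exp (- (l - \<omega>) * h) * N x"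
      by (simp add: algebra_simps exp_add[symmetric] flip: mult.assoc)
    finally have "(1 - exp (- (l - \<omega>) * h)) * N x \<le> h * N (g h)"
      using elim by (simp add: N_scaleR algebra_simps)
    then show ?case using elim by (simp add: field_simps)
  qed
  ultimately show ?thesis
    by (intro tendsto_le[OF trivial_limit_at_right_real])
qed

subsection \<open>The resolvent\<close>

text \<open>
A truncated Laplace transform is an approximate resolvent. Shifting the integrand by \<open>h\<close> writes
\<open>E h v\<close> in terms of the primitive \<open>V\<close>, which can be differentiated at \<open>h = 0\<close>.
\<close>

lemma generator_integral:
  fixes y l a
  defines "v \<equiv> integral {0..a} (\<lambda>t. exp (- l * t) *\<^sub>R E t y)"
  assumes a: "a > 0"
  shows "v \<in> D" "l *\<^sub>R v - A v = y - exp (- l * a) *\<^sub>R E a y"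
proof -
  define u where "u t = exp (- l * t) *\<^sub>R E t y" for t
  have cont_u: "continuous_on {0..a+1} u"
    unfolding u_def by (intro continuous_intros continuous_on_subset[OF E_continuous]) auto
  define V where "V t = integral {0..t} u" for t
  have dV: "(V has_vector_derivative u t) (at t within {0..a+1})" if "t \<in> {0..a+1}" for t
    unfolding V_def by (rule integral_vector_derivative[OF cont_u that])
  have shift: "((\<lambda>h. V (c + h)) has_vector_derivative u (c + h)) (at h within {0..d})"
    if "0 \<le> c" "c + d \<le> a + 1" "h \<in> {0..d}" for c d h
  proof -
    have "(V has_vector_derivative u (c + h)) (at (c + h) within {c..c + d})"
      by (rule has_vector_derivative_within_subset[OF dV]) (use that in auto)
    moreover have "{c..c + d} = (\<lambda>h. c + h) ` {0..d}" by (simp add: add.commute)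
    ultimately have dV: "(V has_vector_derivative u (c + h)) (at (c + h) within (\<lambda>h. c + h) ` {0..d})" by (simp only:)
    have "((\<lambda>h. c + h) has_vector_derivative 1) (at h within {0..d})"
      unfolding has_real_derivative_iff_has_vector_derivative[symmetric]
      by (auto intro!: derivative_eq_intros)
    from vector_diff_chain_within[OF this dV] show ?thesis
      by (simp add: o_def)
  qed
  have EV: "E h (V a) = exp (l * h) *\<^sub>R (V (a + h) - V h)" if h: "h \<in> {0..1}" for h
  proof -
    have "(u has_integral V a) {0..a}"
      unfolding V_def by (intro integrable_integral continuous_integrable continuous_on_subset[OF cont_u]) auto
    from has_integral_linear[OF this blinfun.bounded_linear_right]
    have "((\<lambda>t. E h (u t)) has_integral E h (V a)) {0..a}" by (simp add: o_def)
    moreover have "((\<lambda>t. exp (l * h) *\<^sub>R u (h + t)) has_integral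
        exp (l * h) *\<^sub>R V (h + a) - exp (l * h) *\<^sub>R V (h + 0)) {0..a}"
      by (rule ftc_has_integral)
        (use a h in \<open>auto intro!: bounded_linear.has_vector_derivative[OF bounded_linear_scaleR_right] shift\<close>)
    moreover have "exp (l * h) *\<^sub>R u (h + t) = E h (u t)" if "t \<in> {0..a}" for t
      using E_add[of h t y] h that
      by (simp add: u_def blinfun.scaleR_right algebra_simps exp_add[symmetric])
    ultimately have "E h (V a) = exp (l * h) *\<^sub>R V (h + a) - exp (l * h) *\<^sub>R V (h + 0)"
      by (metis (no_types, lifting) has_integral_eq has_integral_unique)
    then show ?thesis by (simp add: scaleR_diff_right add.commute)
  qed
  have "((\<lambda>h. exp (l * h) *\<^sub>R (V (a + h) - V (0 + h))) has_vector_derivative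
      exp (l * 0) *\<^sub>R (u (a + 0) - u (0 + 0)) + (l * exp (l * 0)) *\<^sub>R (V (a + 0) - V (0 + 0))) (at 0 within {0..1})"
    by (intro has_vector_derivative_scaleR has_vector_derivative_diff shift)
      (use a in \<open>auto intro!: derivative_eq_intros\<close>)
  then have "((\<lambda>h. exp (l * h) *\<^sub>R (V (a + h) - V h)) has_vector_derivative u a - u 0 + l *\<^sub>R V a)
      (at 0 within {0..1})"
    by (simp add: V_def)
  from has_vector_derivative_transform[OF _ EV this]
  have "((\<lambda>h. E h (V a)) has_vector_derivative u a - u 0 + l *\<^sub>R V a) (at 0 within {0..1})"
    by simp
  from difference_quotient_at_right[OF this]
  have "((\<lambda>h. (E h (V a) - V a) /\<^sub>R h) \<longlongrightarrow> u a - u 0 + l *\<^sub>R V a) (at_right 0)"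
    by simp
  from generatorI[OF this] have "V a \<in> D" "l *\<^sub>R V a - A (V a) = y - exp (- l * a) *\<^sub>R E a y"
    by (auto simp: u_def)
  moreover have "V a = v" by (simp add: V_def v_def u_def[abs_def])
  ultimately show "v \<in> D" "l *\<^sub>R v - A v = y - exp (- l * a) *\<^sub>R E a y" by auto
qed


text \<open>
For \<open>a\<close> tending to infinity the truncated transforms have images tending to \<open>y\<close>, so \<open>l - A\<close> has dense range;
by dissipativity the transforms form a Cauchy sequence, and closedness of \<open>A\<close> identifies the limit.
\<close>

lemma resolvent_exists:
  assumes l: "l > \<omega>"
  shows "\<exists>x\<in>D. l *\<^sub>R x - A x = y"
proof -
  have "\<exists>x. x \<in> D \<and> l *\<^sub>R x - A x = y - exp (- l * real (Suc n)) *\<^sub>R E (real (Suc n)) y" for n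
    using generator_integral[of "real (Suc n)" l y] by auto
  then obtain x where x: "\<And>n. x n \<in> D"
      "\<And>n. l *\<^sub>R x n - A (x n) = y - exp (- l * real (Suc n)) *\<^sub>R E (real (Suc n)) y"
    by metis
  define w where "w n = l *\<^sub>R x n - A (x n)" for n
  have w: "w \<longlonglongrightarrow> y"
  proof -
    have "(\<lambda>n. exp (- l * real (Suc n)) *\<^sub>R E (real (Suc n)) y) \<longlonglongrightarrow> 0"
    proof (rule Lim_null_comparison)
      have "norm (exp (- l * real (Suc n)) *\<^sub>R E (real (Suc n)) y) \<le> M * norm y * exp (- (l - \<omega>)) ^ Suc n" for n
      proof -
        have "exp (- l * real (Suc n)) * norm (E (real (Suc n)) y)
            \<le> exp (- l * real (Suc n)) * (M * exp (\<omega> * real (Suc n)) * norm y)"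
          by (intro mult_left_mono order_trans[OF norm_blinfun] mult_right_mono growth) auto
        also have "\<dots> = M * norm y * exp (- (l - \<omega>) * real (Suc n))"
          by (simp add: algebra_simps flip: exp_add)
        also have "exp (- (l - \<omega>) * real (Suc n)) = exp (- (l - \<omega>)) ^ Suc n"
          by (metis exp_of_nat2_mult)
        finally show ?thesis by simp
      qed
      then show "\<forall>\<^sub>F n in sequentially. norm (exp (- l * real (Suc n)) *\<^sub>R E (real (Suc n)) y)
          \<le> M * norm y * exp (- (l - \<omega>)) ^ Suc n" by simp
      show "(\<lambda>n. M * norm y * exp (- (l - \<omega>)) ^ Suc n) \<longlonglongrightarrow> 0"
        using l by (intro tendsto_mult_right_zero LIMSEQ_Suc LIMSEQ_realpow_zero) auto
    qed
    then have "(\<lambda>n. y - exp (- l * real (Suc n)) *\<^sub>R E (real (Suc n)) y) \<longlonglongrightarrow> y - 0"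
      by (intro tendsto_diff tendsto_const)
    then show ?thesis by (simp add: w_def[abs_def] x(2))
  qed
  have x_close: "(l - \<omega>) * norm (x m - x n) \<le> M * norm (w m - w n)" for m n
  proof -
    have "(l - \<omega>) * norm (x m - x n) \<le> (l - \<omega>) * N (x m - x n)"
      using l norm_le_N by (intro mult_left_mono) auto
    also have "\<dots> \<le> N (l *\<^sub>R (x m - x n) - A (x m - x n))"
      by (rule generator_dissipative) (rule generator_diff[OF x(1) x(1)])
    also have "l *\<^sub>R (x m - x n) - A (x m - x n) = w m - w n"
      by (simp add: w_def generator_diff[OF x(1) x(1)] algebra_simps)
    finally show ?thesis using N_le_norm[of "w m - w n"] by linarith
  qed
  have "Cauchy x"
  proof (rule metric_CauchyI)
    fix e :: real assume "e > 0"
    then have "(l - \<omega>) * e / M > 0" using l M_ge by simp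
    then obtain k where k: "\<And>m n. m \<ge> k \<Longrightarrow> n \<ge> k \<Longrightarrow> dist (w m) (w n) < (l - \<omega>) * e / M"
      using metric_CauchyD[OF LIMSEQ_imp_Cauchy[OF w]] by blast
    have "dist (x m) (x n) < e" if "m \<ge> k" "n \<ge> k" for m n
    proof -
      have "M * norm (w m - w n) < (l - \<omega>) * e"
        using k[OF that] M_ge by (simp add: dist_norm field_simps)
      then have "(l - \<omega>) * norm (x m - x n) < (l - \<omega>) * e"
        using x_close[of m n] by linarith
      then show ?thesis using l by (simp add: dist_norm)
    qed
    then show "\<exists>k. \<forall>m\<ge>k. \<forall>n\<ge>k. dist (x m) (x n) < e" by blast
  qed
  then obtain z where z: "x \<longlonglongrightarrow> z"
    using Cauchy_convergent convergent_def by blast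
  have "(\<lambda>n. l *\<^sub>R x n - w n) \<longlonglongrightarrow> l *\<^sub>R z - y"
    by (intro tendsto_intros z w)
  then have "(\<lambda>n. (x n, A (x n))) \<longlonglongrightarrow> (z, l *\<^sub>R z - y)"
    by (intro tendsto_Pair z) (simp add: w_def)
  with A_closed x(1) have "(z, l *\<^sub>R z - y) \<in> (\<lambda>x. (x, A x)) ` D"
    by (intro closed_sequentially[OF A_closed _ \<open>(\<lambda>n. (x n, A (x n))) \<longlonglongrightarrow> _\<close>]) auto
  then have "z \<in> D" "A z = l *\<^sub>R z - y" by auto
  then show ?thesis by (intro bexI[of _ z]) auto
qed

lemma resolvent_inj:
  assumes l: "l > \<omega>" and "x \<in> D" "y \<in> D" "l *\<^sub>R x - A x = l *\<^sub>R y - A y"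
  shows "x = y"
proof -
  have "l *\<^sub>R (x - y) - A (x - y) = 0"
    using assms by (simp add: generator_diff algebra_simps)
  then have "(l - \<omega>) * N (x - y) \<le> 0"
    using generator_dissipative[OF generator_diff(1)[OF assms(2,3)], of l] N_le_norm[of 0] by simp
  then have "N (x - y) \<le> 0" using l by (simp add: mult_le_0_iff)
  then have "norm (x - y) \<le> 0" using norm_le_N[of "x - y"] by linarith
  then show ?thesis by simp
qed

definition Res :: "real \<Rightarrow> 'h \<Rightarrow>\<^sub>L 'h" where
  "Res l = resolvent D A l"

lemma
  assumes l: "l > \<omega>"
  shows Res_mem: "Res l y \<in> D" and Res_right: "l *\<^sub>R Res l y - A (Res l y) = y"
    and N_Res: "N (Res l y) \<le> N y / (l - \<omega>)"
proof -
  define f where "f = inv_into D (\<lambda>x. l *\<^sub>R x - A x)"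
  have img: "y \<in> (\<lambda>x. l *\<^sub>R x - A x) ` D" for y
    using resolvent_exists[OF l, of y] by blast
  have f: "f y \<in> D" "l *\<^sub>R f y - A (f y) = y" for y
    using inv_into_into[OF img] f_inv_into_f[OF img] by (auto simp: f_def)
  have N_f: "N (f y) \<le> N y / (l - \<omega>)" for y
    using generator_dissipative[OF f(1)[of y], of l] l by (simp add: f(2) field_simps)
  have "bounded_linear f"
  proof (rule bounded_linear_intro[where K = "M / (l - \<omega>)"])
    fix x y and c :: real
    have "l *\<^sub>R (f x + f y) - A (f x + f y) = (l *\<^sub>R f x - A (f x)) + (l *\<^sub>R f y - A (f y))"
      by (simp add: generator_add(2)[OF f(1) f(1)] scaleR_add_right)
    then show "f (x + y) = f x + f y"
      by (intro resolvent_inj[OF l f(1) generator_add(1)[OF f(1) f(1)]]) (simp add: f(2))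
    have "l *\<^sub>R (c *\<^sub>R f x) - A (c *\<^sub>R f x) = c *\<^sub>R (l *\<^sub>R f x - A (f x))"
      by (simp add: generator_scaleR(2)[OF f(1)] scaleR_diff_right mult.commute)
    then show "f (c *\<^sub>R x) = c *\<^sub>R f x"
      by (intro resolvent_inj[OF l f(1) generator_scaleR(1)[OF f(1)]]) (simp add: f(2))
    have "norm (f x) \<le> N x / (l - \<omega>)" using norm_le_N[of "f x"] N_f[of x] by linarith
    also have "\<dots> \<le> M * norm x / (l - \<omega>)" using l N_le_norm by (intro divide_right_mono) auto
    finally show "norm (f x) \<le> norm x * (M / (l - \<omega>))" by (simp add: mult.commute)
  qed
  then have "Res l y = f y"
    by (simp add: Res_def resolvent_def f_def bounded_linear_Blinfun_apply)
  with f N_f show "Res l y \<in> D" "l *\<^sub>R Res l y - A (Res l y) = y" "N (Res l y) \<le> N y / (l - \<omega>)" by auto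
qed

lemma Res_unique: "l > \<omega> \<Longrightarrow> x \<in> D \<Longrightarrow> l *\<^sub>R x - A x = y \<Longrightarrow> Res l y = x"
  by (rule resolvent_inj[of l]) (auto simp: Res_mem Res_right)

lemma norm_Res: "l > \<omega> \<Longrightarrow> norm (Res l) \<le> M / (l - \<omega>)"
proof (rule norm_blinfun_bound)
  fix y assume l: "l > \<omega>"
  have "norm (Res l y) \<le> N y / (l - \<omega>)" using norm_le_N[of "Res l y"] N_Res[OF l, of y] by linarith
  also have "\<dots> \<le> M * norm y / (l - \<omega>)" using l N_le_norm by (intro divide_right_mono) auto
  finally show "norm (Res l y) \<le> M / (l - \<omega>) * norm y" by simp
qed (use M_ge in simp)

lemma Res_injective: "l > \<omega> \<Longrightarrow> Res l y = 0 \<Longrightarrow> y = 0"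
  using Res_right[of l y] generator_scaleR(2)[OF Res_mem, of l 0 y] by simp

lemma dense_range_Res: "l > \<omega> \<Longrightarrow> closure (range (Res l)) = UNIV"
proof -
  assume l: "l > \<omega>"
  have "x \<in> range (Res l)" if "x \<in> D" for x
    using Res_unique[OF l that refl] by (metis rangeI)
  then have "closure D \<subseteq> closure (range (Res l))" by (intro closure_mono) auto
  then show ?thesis using A_dense by auto
qed

lemma Res_semigroup_commute:
  assumes l: "l > \<omega>" and t: "t \<ge> 0"
  shows "Res l (E t y) = E t (Res l y)"
proof (rule Res_unique[OF l])
  show "E t (Res l y) \<in> D" by (rule generator_semigroup[OF Res_mem[OF l] t])
  have "l *\<^sub>R E t (Res l y) - A (E t (Res l y)) = E t (l *\<^sub>R Res l y - A (Res l y))"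
    by (simp add: generator_semigroup[OF Res_mem[OF l] t] blinfun.scaleR_right blinfun.diff_right)
  then show "l *\<^sub>R E t (Res l y) - A (E t (Res l y)) = E t y" by (simp add: Res_right[OF l])
qed

text \<open>
This is \<open>A (Res l x)\<close>, the bounded operator obtained by composing \<open>A\<close> with the resolvent.
\<close>

definition ARes :: "real \<Rightarrow> 'h \<Rightarrow>\<^sub>L 'h" where
  "ARes l = l *\<^sub>R Res l - id_blinfun"

lemma Res_generator:
  assumes l: "l > \<omega>" and "x \<in> D"
  shows "Res l (A x) = ARes l x"
  using Res_unique[OF l assms(2) refl] by (simp add: ARes_def blinfun.bilinear_simps algebra_simps)

lemma Res_ARes_commute: "Res l (ARes l x) = ARes l (Res l x)"
  by (simp add: ARes_def blinfun.bilinear_simps)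

text \<open>
For \<open>v\<close> the integral of the orbit of \<open>x\<close>, \<open>A v = E t x - x\<close>; apply the resolvent and use that
\<open>Res l (A v) = ARes l v\<close>.
\<close>

lemma semigroup_Res_integral:
  assumes l: "l > \<omega>" and t: "t \<ge> 0"
  shows "E t (Res l x) = Res l x + integral {0..t} (\<lambda>s. E s (ARes l x))"
proof (cases "t = 0")
  case False
  define v where "v = integral {0..t} (\<lambda>s. E s x)"
  have v: "v \<in> D" "- A v = x - E t x"
    using generator_integral[of t 0 x] t False by (simp_all add: v_def)
  from v(2) have Av: "A v = E t x - x"
    by (metis minus_diff_eq minus_minus)
  have "((\<lambda>s. E s x) has_integral v) {0..t}"
    unfolding v_def
    by (intro integrable_integral continuous_integrable continuous_on_subset[OF E_continuous]) auto
  from has_integral_linear[OF this blinfun.bounded_linear_right[of "ARes l"]]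
  have "((\<lambda>s. ARes l (E s x)) has_integral ARes l v) {0..t}" by (simp add: o_def)
  moreover have "ARes l (E s x) = E s (ARes l x)" if "s \<in> {0..t}" for s
    using Res_semigroup_commute[OF l, of s x] that by (simp add: ARes_def blinfun.bilinear_simps)
  ultimately have "((\<lambda>s. E s (ARes l x)) has_integral ARes l v) {0..t}"
    by (metis (no_types, lifting) has_integral_eq)
  moreover have "ARes l v = Res l (E t x) - Res l x"
    using Res_generator[OF l v(1)] by (simp add: Av blinfun.diff_right)
  ultimately show ?thesis
    using Res_semigroup_commute[OF l t, of x] by (simp add: integral_unique)
qed simp

lemma semigroup_Res_derivative:
  assumes l: "l > \<omega>" and t: "t \<in> {0..b}"
  shows "((\<lambda>t. E t (Res l x)) has_vector_derivative E t (ARes l x)) (at t within {0..b})"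
proof -
  have "continuous_on {0..b} (\<lambda>s. E s (ARes l x))"
    by (rule continuous_on_subset[OF E_continuous]) auto
  from has_vector_derivative_add[OF has_vector_derivative_const integral_vector_derivative[OF this t]]
  have deriv: "((\<lambda>t. Res l x + integral {0..t} (\<lambda>s. E s (ARes l x))) has_vector_derivative E t (ARes l x))
      (at t within {0..b})" by simp
  show ?thesis
    by (rule has_vector_derivative_transform[OF t _ deriv]) (simp add: semigroup_Res_integral[OF l])
qed

lemma resolvent_identity:
  assumes l: "l > \<omega>" and m: "m > \<omega>"
  shows "Res l y - Res m y = (m - l) *\<^sub>R Res l (Res m y)"
proof -
  have "Res l (y + (l - m) *\<^sub>R Res m y) = Res m y"
    by (rule Res_unique[OF l Res_mem[OF m]]) (use Res_right[OF m, of y] in \<open>simp add: algebra_simps\<close>)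
  then show ?thesis by (simp add: blinfun.bilinear_simps algebra_simps)
qed

lemma Res_commute:
  assumes l: "l > \<omega>" and m: "m > \<omega>"
  shows "Res l (Res m y) = Res m (Res l y)"
proof (cases "l = m")
  case False
  have "(m - l) *\<^sub>R Res l (Res m y) = - ((l - m) *\<^sub>R Res m (Res l y))"
    unfolding resolvent_identity[OF l m, symmetric] resolvent_identity[OF m l, symmetric] by simp
  also have "\<dots> = (m - l) *\<^sub>R Res m (Res l y)" by (simp add: algebra_simps)
  finally show ?thesis using False by simp
qed simp

lemma yosida_apply: "yosida D A n x = (real n)\<^sup>2 *\<^sub>R Res (real n) x - real n *\<^sub>R x"
  by (simp add: yosida_def Res_def blinfun.bilinear_simps)

lemma Res_yosida_commute:
  assumes "l > \<omega>" "real n > \<omega>"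
  shows "Res l (yosida D A n x) = yosida D A n (Res l x)"
  by (simp add: yosida_apply blinfun.bilinear_simps Res_commute[OF assms])

text \<open>
Formally, \<open>n\<^sup>2 R(n,A) - n = n A R(n,A)\<close> and \<open>n R(n,A) = 1 + A R(n,A)\<close>, so that the two sides of
\<open>R(l,A)\<^sup>2 A\<^sub>n = A R(l,A)\<^sup>2 + R(n,A) (A R(l,A))\<^sup>2\<close> agree. The proof reduces everything to
\<open>a = R(l,A) y\<close>, \<open>R(l,A) a\<close> and \<open>d = R(l,A)\<^sup>2 R(n,A) y\<close> by the resolvent identity.
\<close>

lemma yosida_identity:
  assumes l: "l > \<omega>" and n: "real n > \<omega>"
  shows "Res l (Res l (yosida D A n y)) = ARes l (Res l y) + Res (real n) (ARes l (ARes l y))"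
proof -
  define a where "a = Res l y"
  define d where "d = Res l (Res l (Res (real n) y))"
  have 1: "Res l (Res (real n) y) = Res l a - (real n - l) *\<^sub>R d"
    using resolvent_identity[OF l n, of a] Res_commute[OF l n, of y]
    by (simp add: a_def d_def algebra_simps)
  have 2: "Res (real n) y = a - (real n - l) *\<^sub>R Res l (Res (real n) y)"
    using resolvent_identity[OF l n, of y] by (simp add: a_def algebra_simps)
  have 3: "Res (real n) a = Res l (Res (real n) y)" "Res (real n) (Res l a) = d"
    by (simp_all add: a_def d_def Res_commute[OF l n])
  have lhs: "Res l (Res l (yosida D A n y)) = (real n)\<^sup>2 *\<^sub>R d - real n *\<^sub>R Res l a"
    by (simp add: yosida_apply blinfun.bilinear_simps a_def d_def)
  have "ARes l (Res l y) + Res (real n) (ARes l (ARes l y))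
      = l *\<^sub>R Res l a - a + (l\<^sup>2 *\<^sub>R Res (real n) (Res l a) - l *\<^sub>R Res (real n) a - l *\<^sub>R Res (real n) a + Res (real n) y)"
    by (simp add: ARes_def blinfun.bilinear_simps a_def[symmetric] power2_eq_square algebra_simps)
  also have "\<dots> = l *\<^sub>R Res l a - a + (l\<^sup>2 *\<^sub>R d - l *\<^sub>R Res l (Res (real n) y) - l *\<^sub>R Res l (Res (real n) y)
      + (a - (real n - l) *\<^sub>R Res l (Res (real n) y)))"
    by (simp only: 3 2[symmetric])
  also have "\<dots> = (real n)\<^sup>2 *\<^sub>R d - real n *\<^sub>R Res l a"
    unfolding 1 by (simp add: algebra_simps power2_eq_square)
  finally show ?thesis using lhs by simp
qed

subsection \<open>Growth\<close>

text \<open>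
\<open>N\<close> need not be differentiable, so the mean value inequality is applied to
\<open>exp (- \<omega> * r) *\<^sub>R E r (y t)\<close> for each \<open>r\<close> before the supremum over \<open>r\<close> is taken.
\<close>

lemma N_gronwall:
  assumes y: "\<And>t. t \<in> {0..T} \<Longrightarrow> (y has_vector_derivative F t) (at t within {0..T})"
    and a: "0 \<le> a" and F: "\<And>t. t \<in> {0..T} \<Longrightarrow> N (F t) \<le> a * N (y t)"
    and t: "t \<in> {0..T}"
  shows "N (y t) \<le> N (y 0) * exp (a * t)"
proof -
  have "continuous_on {0..T} y" by (rule continuous_on_vector_derivative[OF y])
  then have cont: "continuous_on {0..T} (\<lambda>s. N (y s))"
    by (rule continuous_on_compose2[OF N_continuous[of UNIV]]) auto
  have "N (y t) \<le> N (y 0) + a * integral {0..t} (\<lambda>s. N (y s))" if t: "t \<in> {0..T}" for t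
  proof -
    have "N (y t - y 0) \<le> a * integral {0..t} (\<lambda>s. N (y s)) - a * integral {0..0} (\<lambda>s. N (y s))"
    proof (rule N_least)
      fix r :: real assume r: "r \<ge> 0"
      have bl: "bounded_linear (\<lambda>x. exp (- \<omega> * r) *\<^sub>R E r x)"
        by (rule bounded_linear_scaleR_right[THEN bounded_linear_compose]) (rule blinfun.bounded_linear_right)
      have "norm (exp (- \<omega> * r) *\<^sub>R E r (y t) - exp (- \<omega> * r) *\<^sub>R E r (y 0))
          \<le> a * integral {0..t} (\<lambda>s. N (y s)) - a * integral {0..0} (\<lambda>s. N (y s))"
      proof (rule norm_diff_le_of_derivative)
        show "0 \<le> t" using t by simp
        fix s assume s: "s \<in> {0..t}"
        then have sT: "s \<in> {0..T}" using t by auto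
        have "(y has_vector_derivative F s) (at s within {0..t})"
          by (rule has_vector_derivative_within_subset[OF y[OF sT]]) (use t in auto)
        from bounded_linear.has_vector_derivative[OF bl this]
        show "((\<lambda>s. exp (- \<omega> * r) *\<^sub>R E r (y s)) has_vector_derivative exp (- \<omega> * r) *\<^sub>R E r (F s))
            (at s within {0..t})" .
        have "((\<lambda>s. integral {0..s} (\<lambda>s. N (y s))) has_vector_derivative N (y s)) (at s within {0..t})"
          by (rule integral_has_vector_derivative[OF continuous_on_subset[OF cont] s]) (use t in auto)
        from bounded_linear.has_vector_derivative[OF bounded_linear_mult_right this]
        show "((\<lambda>s. a * integral {0..s} (\<lambda>s. N (y s))) has_vector_derivative a * N (y s)) (at s within {0..t})" .
        show "norm (exp (- \<omega> * r) *\<^sub>R E r (F s)) \<le> a * N (y s)"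
          using N_term_le[OF r, of "F s"] F[OF sT] by simp
      qed
      then show "exp (- \<omega> * r) * norm (E r (y t - y 0))
          \<le> a * integral {0..t} (\<lambda>s. N (y s)) - a * integral {0..0} (\<lambda>s. N (y s))"
        by (simp add: blinfun.diff_right flip: scaleR_diff_right)
    qed
    then show ?thesis using N_add[of "y t - y 0" "y 0"] by simp
  qed
  from gronwall[OF cont a this t] show ?thesis by simp
qed

text \<open>
In the equation for \<open>exp (n * t) *\<^sub>R z t\<close> the part \<open>- n\<close> of the Yosida approximation cancels and
\<open>n\<^sup>2 R(n,A)\<close> is left, whose \<open>N\<close>-norm is at most \<open>n\<^sup>2 / (n - \<omega>)\<close>. Subtracting \<open>n\<close> again from the exponent leaves
\<open>n * \<omega> / (n - \<omega>)\<close>, which stays bounded for large \<open>n\<close>.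
\<close>

lemma yosida_growth:
  assumes n: "real n > \<omega>"
    and z: "\<And>t. t \<in> {0..T} \<Longrightarrow> (z has_vector_derivative yosida D A n (z t) + g t) (at t within {0..T})"
    and C: "0 \<le> C" and g: "\<And>t. t \<in> {0..T} \<Longrightarrow> norm (g t) \<le> C * norm (z t)"
    and t: "t \<in> {0..T}"
  shows "norm (z t) \<le> M * norm (z 0) * exp ((real n * \<omega> / (real n - \<omega>) + M * C) * t)"
proof -
  define y where "y t = exp (real n * t) *\<^sub>R z t" for t
  define a where "a = (real n)\<^sup>2 / (real n - \<omega>) + M * C"
  have "N (y t) \<le> N (y 0) * exp (a * t)"
  proof (rule N_gronwall[OF _ _ _ t])
    show "0 \<le> a" using n C M_ge by (simp add: a_def)
    fix s assume s: "s \<in> {0..T}"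
    have "((\<lambda>s. exp (real n * s)) has_real_derivative real n * exp (real n * s)) (at s within {0..T})"
      by (auto intro!: derivative_eq_intros)
    from has_vector_derivative_scaleR[OF this z[OF s]]
    show "(y has_vector_derivative exp (real n * s) *\<^sub>R ((real n)\<^sup>2 *\<^sub>R Res (real n) (z s) + g s)) (at s within {0..T})"
      unfolding y_def[abs_def] by (rule has_vector_derivative_eq_rhs) (simp add: yosida_apply algebra_simps)
    have "N ((real n)\<^sup>2 *\<^sub>R Res (real n) (z s) + g s) \<le> (real n)\<^sup>2 * N (Res (real n) (z s)) + N (g s)"
      using N_add[of "(real n)\<^sup>2 *\<^sub>R Res (real n) (z s)" "g s"] by (simp add: N_scaleR)
    also have "\<dots> \<le> (real n)\<^sup>2 * (N (z s) / (real n - \<omega>)) + M * C * N (z s)"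
    proof (intro add_mono mult_left_mono N_Res n)
      have "N (g s) \<le> M * (C * norm (z s))"
        using N_le_norm[of "g s"] mult_left_mono[OF g[OF s], of M] M_ge by linarith
      also have "\<dots> \<le> M * C * N (z s)"
        using norm_le_N[of "z s"] M_ge C by (simp add: mult.assoc mult_left_mono)
      finally show "N (g s) \<le> M * C * N (z s)" .
    qed simp
    also have "\<dots> = a * N (z s)" by (simp add: a_def algebra_simps)
    finally show "N (exp (real n * s) *\<^sub>R ((real n)\<^sup>2 *\<^sub>R Res (real n) (z s) + g s)) \<le> a * N (y s)"
      by (simp add: N_scaleR y_def)
  qed
  also have "N (y 0) \<le> M * norm (z 0)" using N_le_norm by (simp add: y_def)
  finally have "exp (real n * t) * norm (z t) \<le> M * norm (z 0) * exp (a * t)"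
    using norm_le_N[of "y t"] by (simp add: y_def mult_right_mono)
  then have "exp (- (real n * t)) * (exp (real n * t) * norm (z t)) \<le> exp (- (real n * t)) * (M * norm (z 0) * exp (a * t))"
    by (rule mult_left_mono) simp
  also have "exp (- (real n * t)) * (exp (real n * t) * norm (z t)) = norm (z t)"
    by (simp add: exp_add[symmetric] flip: mult.assoc)
  also have "exp (- (real n * t)) * (M * norm (z 0) * exp (a * t)) = M * norm (z 0) * exp ((a - real n) * t)"
    by (simp add: algebra_simps flip: exp_add)
  also have "a - real n = real n * \<omega> / (real n - \<omega>) + M * C"
    using n by (simp add: a_def field_simps power2_eq_square)
  finally show ?thesis .
qed

end

section \<open>Weak limits of approximate solutions are mild solutions\<close>

text \<open>
A strongly continuous semigroup with generator \<open>A\<close> enters through an injective operator \<open>R\<close> that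
commutes with it, in the role of a resolvent, and the bounded operator \<open>K\<close> in the role of \<open>A R\<close>. Differentiability of
\<open>F t (R x)\<close> is required only weakly, since in this form it passes to adjoints without further work.
\<close>

locale smoothed_semigroup =
  fixes F :: "real \<Rightarrow> ('h::{real_inner, polish_space} \<Rightarrow>\<^sub>L 'h)"
    and R K :: "'h \<Rightarrow>\<^sub>L 'h" and T c :: real
  assumes F_zero [simp]: "F 0 x = x"
    and F_add: "s \<ge> 0 \<Longrightarrow> t \<ge> 0 \<Longrightarrow> F (s + t) x = F s (F t x)"
    and F_continuous: "continuous_on {0..} (\<lambda>t. F t x)"
    and F_bound: "0 \<le> t \<Longrightarrow> t \<le> T \<Longrightarrow> norm (F t) \<le> c"
    and R_inj: "R x = 0 \<Longrightarrow> x = 0"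
    and R_F: "t \<ge> 0 \<Longrightarrow> R (F t x) = F t (R x)"
    and F_derivative: "t \<in> {0..b} \<Longrightarrow>
      ((\<lambda>t. y \<bullet> F t (R x)) has_real_derivative y \<bullet> F t (K x)) (at t within {0..b})"
    and T_nonneg: "0 \<le> T"
begin

lemma F_apply_bound: "0 \<le> t \<Longrightarrow> t \<le> T \<Longrightarrow> norm (F t x) \<le> c * norm x"
  by (rule order_trans[OF norm_blinfun mult_right_mono[OF F_bound]]) auto

lemma c_nonneg: "0 \<le> c"
  using order_trans[OF norm_ge_zero F_bound[of 0]] T_nonneg by simp

lemma dense_test_vectors: "closure (range (adj (R o\<^sub>L R))) = UNIV"
  by (rule closure_range_adj) (auto dest!: R_inj)

text \<open>
Right continuity is clear. For left continuity at \<open>t0\<close>, compare \<open>w\<close> on a neighbourhood of \<open>t0\<close> with the orbit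
that starts from \<open>w a\<close> at a time \<open>a\<close> slightly before \<open>t0\<close>: this orbit is continuous, and it is within \<open>C * (t - a)\<close> of
\<open>w t\<close>.
\<close>

lemma continuous_if_near_orbit:
  assumes near: "\<And>a t. 0 \<le> a \<Longrightarrow> a \<le> t \<Longrightarrow> t \<le> T \<Longrightarrow> norm (w t - F (t - a) (w a)) \<le> C * (t - a)"
    and C: "0 \<le> C"
  shows "continuous_on {0..T} w"
  unfolding continuous_on_def
proof
  fix t0 assume t0: "t0 \<in> {0..T}"
  show "(w \<longlongrightarrow> w t0) (at t0 within {0..T})"
  proof (rule tendstoI)
    fix e :: real assume e: "e > 0"
    \<comment> \<open>The starting time precedes \<open>t0\<close> strictly, unless \<open>t0 = 0\<close>, where it is \<open>t0\<close> itself.\<close>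
    define a where "a = max 0 (t0 - e / (4 * (C + 1)))"
    have a: "0 \<le> a" "a \<le> t0" using t0 e C by (auto simp: a_def)
    have small: "2 * (C * (t0 - a)) < e"
    proof -
      have "C * (t0 - a) \<le> (C + 1) * (e / (4 * (C + 1)))"
        using C e a t0 by (intro mult_mono) (auto simp: a_def)
      also have "\<dots> = e / 4" using C by (simp add: divide_simps)
      finally show ?thesis using e by linarith
    qed
    have ev: "\<forall>\<^sub>F t in at t0 within {0..T}. a \<le> t"
    proof (cases "t0 = 0")
      case True
      then have "a = 0" using a by simp
      then show ?thesis by (simp add: eventually_at_filter)
    next
      case False
      then have "a < t0" using t0 e C by (auto simp: a_def intro: divide_pos_pos)
      then have "\<forall>\<^sub>F t in nhds t0. a < t" by (rule order_tendstoD(1)[OF filterlim_ident])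
      then show ?thesis unfolding eventually_at_filter by eventually_elim simp
    qed
    define h where "h t = C * (t - a) + C * (t0 - a) + norm (F (max 0 (t - a)) (w a) - F (t0 - a) (w a))" for t
    have "continuous_on UNIV (\<lambda>t. F (max 0 (t - a)) (w a))"
      by (rule continuous_on_compose2[OF F_continuous]) (auto intro!: continuous_intros)
    then have "continuous_on UNIV h"
      unfolding h_def
      by (intro continuous_on_add continuous_on_norm continuous_on_diff continuous_on_mult
          continuous_on_const continuous_on_id)
    then have "(h \<longlongrightarrow> h t0) (at t0 within {0..T})"
      by (meson UNIV_I continuous_on_def tendsto_within_subset subset_UNIV)
    moreover have "h t0 < e" using small a by (simp add: h_def)
    ultimately have "\<forall>\<^sub>F t in at t0 within {0..T}. h t < e" by (rule order_tendstoD(2))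
    moreover have "\<forall>\<^sub>F t in at t0 within {0..T}. t \<in> {0..T}" by (simp add: eventually_at_filter)
    ultimately show "\<forall>\<^sub>F t in at t0 within {0..T}. dist (w t) (w t0) < e"
      using ev
    proof eventually_elim
      case (elim t)
      have "norm (w t - w t0) \<le> norm (w t - F (t - a) (w a)) + norm (w t0 - F (t0 - a) (w a))
          + norm (F (t - a) (w a) - F (t0 - a) (w a))"
      proof -
        have "w t - w t0 = (w t - F (t - a) (w a)) - (w t0 - F (t0 - a) (w a))
          + (F (t - a) (w a) - F (t0 - a) (w a))" by simp
        then show ?thesis
          using norm_triangle_ineq[of "(w t - F (t - a) (w a)) - (w t0 - F (t0 - a) (w a))" "F (t - a) (w a) - F (t0 - a) (w a)"]
            norm_triangle_ineq4[of "w t - F (t - a) (w a)" "w t0 - F (t0 - a) (w a)"] by simp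
      qed
      also have "\<dots> \<le> h t"
        unfolding h_def using near[of a t] near[of a t0] a elim t0 by (intro add_mono) auto
      finally show ?case using elim by (simp add: dist_norm)
    qed
  qed
qed

text \<open>
The functions \<open>R (R (w n t))\<close> are Lipschitz uniformly in \<open>n\<close>, because \<open>R (R (C n x))\<close> is bounded uniformly in \<open>n\<close>
even if \<open>C n\<close> is not.
\<close>

lemma weak_subsequence:
  fixes w f :: "nat \<Rightarrow> real \<Rightarrow> 'h" and C L :: "nat \<Rightarrow> 'h \<Rightarrow>\<^sub>L 'h"
  assumes w: "\<And>n t. t \<in> {0..T} \<Longrightarrow> (w n has_vector_derivative C n (w n t) + f n t) (at t within {0..T})"
    and w_bound: "\<And>n t. t \<in> {0..T} \<Longrightarrow> norm (w n t) \<le> cw"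
    and f_bound: "\<And>n t. t \<in> {0..T} \<Longrightarrow> norm (f n t) \<le> cf"
    and C: "\<And>n x. R (R (C n x)) = K (R x) + L n x"
    and L: "(\<lambda>n. norm (L n)) \<longlonglongrightarrow> 0"
  obtains k w' where "strict_mono (k :: nat \<Rightarrow> nat)"
    "\<And>t v. t \<in> {0..T} \<Longrightarrow> (\<lambda>n. w (k n) t \<bullet> v) \<longlonglongrightarrow> w' t \<bullet> v"
proof -
  obtain cL where cL: "\<And>n. norm (L n) \<le> cL"
    using convergent_imp_Bseq[OF convergentI[OF L]] by (auto simp: Bseq_def)
  have cL0: "0 \<le> cL" using order_trans[OF norm_ge_zero cL] .
  define B where "B = norm (K o\<^sub>L R) * cw + cL * cw + norm (R o\<^sub>L R) * cf"
  have lip': "norm ((R o\<^sub>L R) (w n t) - (R o\<^sub>L R) (w n s)) \<le> B * (t - s)"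
    if st: "0 \<le> s" "s \<le> t" "t \<le> T" for n s t
  proof (rule norm_diff_le_of_bounded_derivative[OF st(2)])
    fix r assume r: "r \<in> {s..t}"
    then have rT: "r \<in> {0..T}" using st by auto
    have "(w n has_vector_derivative C n (w n r) + f n r) (at r within {s..t})"
      by (rule has_vector_derivative_within_subset[OF w[OF rT]]) (use st in auto)
    from bounded_linear.has_vector_derivative[OF blinfun.bounded_linear_right this]
    show "((\<lambda>r. (R o\<^sub>L R) (w n r)) has_vector_derivative (R o\<^sub>L R) (C n (w n r) + f n r)) (at r within {s..t})" .
    have "(R o\<^sub>L R) (C n (w n r) + f n r) = (K o\<^sub>L R) (w n r) + L n (w n r) + (R o\<^sub>L R) (f n r)"
      by (simp add: blinfun.add_right C)
    moreover have "norm ((K o\<^sub>L R) (w n r) + L n (w n r) + (R o\<^sub>L R) (f n r)) \<le> B"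
      unfolding B_def
      by (intro order_trans[OF norm_triangle_ineq] add_mono order_trans[OF norm_blinfun] mult_mono
          order_refl norm_ge_zero cL cL0 w_bound[OF rT] f_bound[OF rT])
    ultimately show "norm ((R o\<^sub>L R) (C n (w n r) + f n r)) \<le> B" by simp
  qed
  have lip: "norm ((R o\<^sub>L R) (w n t) - (R o\<^sub>L R) (w n s)) \<le> B * \<bar>t - s\<bar>"
    if "s \<in> {0..T}" "t \<in> {0..T}" for n s t
  proof (cases "s \<le> t")
    case True
    with lip'[of s t n] that show ?thesis by simp
  next
    case False
    with lip'[of t s n] that show ?thesis by (simp add: norm_minus_commute)
  qed
  have inj: "x = 0" if "(R o\<^sub>L R) x = 0" for x
    using that R_inj by auto
  show thesis
  proof (rule weakly_convergent_subsequence[of T "R o\<^sub>L R" w cw B])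
    show "0 \<le> T" by (rule T_nonneg)
  qed (rule inj w_bound lip that; assumption)+
qed

text \<open>
Differentiating \<open>F (t - s) (R (R (w n s)))\<close> in \<open>s\<close> leaves only the error \<open>L n\<close> and the term with \<open>f n\<close>, since the terms
\<open>K (R (w n s))\<close> cancel. This gives a mild equation tested against \<open>adj (R o\<^sub>L R) y\<close>, in which dominated
convergence applies; density of these vectors and dominated convergence once more give all test vectors.
\<close>

lemma weak_mild_limit:
  fixes w f :: "nat \<Rightarrow> real \<Rightarrow> 'h" and C L :: "nat \<Rightarrow> 'h \<Rightarrow>\<^sub>L 'h" and w' f' :: "real \<Rightarrow> 'h"
  assumes w: "\<And>n t. t \<in> {0..T} \<Longrightarrow> (w n has_vector_derivative C n (w n t) + f n t) (at t within {0..T})"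
    and w_bound: "\<And>n t. t \<in> {0..T} \<Longrightarrow> norm (w n t) \<le> cw"
    and f_bound: "\<And>n t. t \<in> {0..T} \<Longrightarrow> norm (f n t) \<le> cf"
    and C: "\<And>n x. R (R (C n x)) = K (R x) + L n x"
    and L: "(\<lambda>n. norm (L n)) \<longlonglongrightarrow> 0"
    and w': "\<And>t v. t \<in> {0..T} \<Longrightarrow> (\<lambda>n. w n t \<bullet> v) \<longlonglongrightarrow> w' t \<bullet> v"
    and f': "\<And>t v. t \<in> {0..T} \<Longrightarrow> (\<lambda>n. f n t \<bullet> v) \<longlonglongrightarrow> f' t \<bullet> v"
    and at: "0 \<le> a" "a \<le> t" "t \<le> T"
  shows "((\<lambda>s. F (t - s) (f' s) \<bullet> v) has_integral (w' t \<bullet> v - F (t - a) (w' a) \<bullet> v)) {a..t}"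
proof -
  have cw: "0 \<le> cw" using order_trans[OF norm_ge_zero w_bound[of 0]] T_nonneg by simp
  have cf: "0 \<le> cf" using order_trans[OF norm_ge_zero f_bound[of 0]] T_nonneg by simp
  have f'_bound: "norm (f' s) \<le> cf" if "s \<in> {0..T}" for s
    by (rule norm_weak_limit_le[of "\<lambda>n. f n s"]) (use f' f_bound that in auto)
  define J where "J = R o\<^sub>L R"
  have J_F: "y \<bullet> F s (R (R x)) = F s x \<bullet> adj J y" if "s \<ge> 0" for s x y
    using that by (simp add: adj_inner_right J_def R_F inner_commute)
  have sT: "s \<in> {0..T}" "0 \<le> t - s" "t - s \<le> T" if "s \<in> {a..t}" for s
    using that at by auto
  have smooth: "((\<lambda>s. F (t - s) (f' s) \<bullet> adj J y) has_integral
      (w' t \<bullet> adj J y - F (t - a) (w' a) \<bullet> adj J y)) {a..t}" for y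
  proof -
    define X where "X s = blinfun_inner_right y o\<^sub>L (F (t - s) o\<^sub>L (R o\<^sub>L R))" for s
    have X: "X s x = y \<bullet> F (t - s) (R (R x))" for s x by (simp add: X_def)
    define g where "g n s = y \<bullet> F (t - s) (L n (w n s)) + y \<bullet> F (t - s) (R (R (f n s)))" for n s
    have g_int: "(g n has_integral (y \<bullet> R (R (w n t)) - y \<bullet> F (t - a) (R (R (w n a))))) {a..t}" for n
    proof -
      have "((\<lambda>s. X s (w n s)) has_vector_derivative g n s) (at s within {a..t})" if s: "s \<in> {a..t}" for s
      proof -
        have X_cont: "continuous_on {a..t} (\<lambda>s. X s x)" for x
          unfolding X
          by (rule continuous_on_inner[OF continuous_on_const continuous_on_compose2[OF F_continuous]])
            (auto intro!: continuous_intros)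
        have X_bound: "norm (X r) \<le> norm y * c * norm (R o\<^sub>L R)" if "r \<in> {a..t}" for r
        proof (rule norm_blinfun_bound)
          fix x
          have "norm (X r x) \<le> norm y * (c * norm ((R o\<^sub>L R) x))"
            unfolding X using F_apply_bound[OF sT(2,3)[OF that], of "R (R x)"]
            by (auto intro!: order_trans[OF Cauchy_Schwarz_ineq2] mult_left_mono)
          also have "\<dots> \<le> norm y * (c * (norm (R o\<^sub>L R) * norm x))"
            by (intro mult_left_mono norm_blinfun c_nonneg) auto
          finally show "norm (X r x) \<le> norm y * c * norm (R o\<^sub>L R) * norm x" by (simp add: mult.assoc)
        qed (simp add: c_nonneg)
        have "((\<lambda>r. t - r) has_real_derivative -1) (at s within {a..t})"
          by (auto intro!: derivative_eq_intros)
        moreover have "((\<lambda>r. y \<bullet> F r (R (R (w n s)))) has_real_derivative y \<bullet> F (t - s) (K (R (w n s))))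
            (at (t - s) within (\<lambda>r. t - r) ` {a..t})"
          by (rule DERIV_subset[OF F_derivative[where b = T]]) (use sT[OF s] at in auto)
        ultimately have "((\<lambda>r. y \<bullet> F (t - r) (R (R (w n s)))) has_real_derivative - (y \<bullet> F (t - s) (K (R (w n s)))))
            (at s within {a..t})"
          using DERIV_image_chain[of "\<lambda>r. y \<bullet> F r (R (R (w n s)))" _ "\<lambda>r. t - r" s "{a..t}" "-1"]
          by (simp add: o_def)
        then have dX: "((\<lambda>r. X r (w n s)) has_vector_derivative - (y \<bullet> F (t - s) (K (R (w n s))))) (at s within {a..t})"
          by (simp add: X has_real_derivative_iff_has_vector_derivative)
        have "(w n has_vector_derivative C n (w n s) + f n s) (at s within {a..t})"
          by (rule has_vector_derivative_within_subset[OF w[OF sT(1)[OF s]]]) (use at in auto)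
        from has_vector_derivative_strong_apply[OF s X_cont X_bound dX this]
        moreover have "X s (C n (w n s) + f n s) = y \<bullet> F (t - s) (K (R (w n s))) + g n s"
          unfolding X g_def blinfun.add_right C inner_add_right by simp
        ultimately show ?thesis by simp
      qed
      from ftc_has_integral[OF at(2) this] show ?thesis
        by (simp add: X)
    qed
    obtain cL where cL: "\<And>n. norm (L n) \<le> cL"
      using convergent_imp_Bseq[OF convergentI[OF L]] by (auto simp: Bseq_def)
    have cL0: "0 \<le> cL" using order_trans[OF norm_ge_zero cL] .
    define B where "B = norm y * (c * (cL * cw)) + norm y * (c * (norm J * cf))"
    have FB: "\<bar>y \<bullet> F (t - s) x\<bar> \<le> norm y * (c * r)" if "s \<in> {a..t}" "norm x \<le> r" for s x r
    proof -
      have "norm (F (t - s) x) \<le> c * norm x" by (rule F_apply_bound) (use sT that in auto)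
      also have "\<dots> \<le> c * r" by (intro mult_left_mono that c_nonneg)
      finally show ?thesis by (intro order_trans[OF Cauchy_Schwarz_ineq2] mult_left_mono) auto
    qed
    have g_bound: "norm (g n s) \<le> B" if s: "s \<in> {a..t}" for n s
    proof -
      have "norm (L n (w n s)) \<le> cL * cw"
        by (intro order_trans[OF norm_blinfun] mult_mono cL w_bound sT s cL0) simp
      moreover have "norm (R (R (f n s))) \<le> norm J * cf"
        using order_trans[OF norm_blinfun[of J "f n s"] mult_left_mono[OF f_bound[OF sT(1)[OF s]]]]
        by (simp add: J_def)
      ultimately show ?thesis
        unfolding g_def B_def real_norm_def
        by (intro order_trans[OF abs_triangle_ineq] add_mono FB s)
    qed
    have g_lim: "(\<lambda>n. g n s) \<longlonglongrightarrow> F (t - s) (f' s) \<bullet> adj J y" if s: "s \<in> {a..t}" for s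
    proof -
      have "(\<lambda>n. y \<bullet> F (t - s) (L n (w n s))) \<longlonglongrightarrow> 0"
      proof (rule Lim_null_comparison)
        show "\<forall>\<^sub>F n in sequentially. norm (y \<bullet> F (t - s) (L n (w n s))) \<le> norm y * (c * (norm (L n) * cw))"
        proof (rule always_eventually, rule allI)
          fix n
          have "norm (L n (w n s)) \<le> norm (L n) * cw"
            by (intro order_trans[OF norm_blinfun] mult_left_mono w_bound sT s) simp
          from FB[OF s this] show "norm (y \<bullet> F (t - s) (L n (w n s))) \<le> norm y * (c * (norm (L n) * cw))" by simp
        qed
        show "(\<lambda>n. norm y * (c * (norm (L n) * cw))) \<longlonglongrightarrow> 0"
          by (intro tendsto_mult_right_zero tendsto_mult_left_zero L)
      qed
      moreover have "(\<lambda>n. f n s \<bullet> adj (F (t - s)) (adj J y)) \<longlonglongrightarrow> f' s \<bullet> adj (F (t - s)) (adj J y)"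
        by (rule f'[OF sT(1)[OF s]])
      then have "(\<lambda>n. y \<bullet> F (t - s) (R (R (f n s)))) \<longlonglongrightarrow> F (t - s) (f' s) \<bullet> adj J y"
        using sT[OF s] by (simp add: J_F adj_inner_right)
      ultimately have "(\<lambda>n. y \<bullet> F (t - s) (L n (w n s)) + y \<bullet> F (t - s) (R (R (f n s))))
          \<longlonglongrightarrow> 0 + F (t - s) (f' s) \<bullet> adj J y"
        by (rule tendsto_add)
      then show ?thesis by (simp add: g_def)
    qed
    note dc = dominated_convergence[OF has_integral_integrable[OF g_int]
        continuous_integrable[OF continuous_on_const] g_bound g_lim]
    have int: "(\<lambda>s. F (t - s) (f' s) \<bullet> adj J y) integrable_on {a..t}"
      by (rule dc(1))
    have lim: "(\<lambda>n. integral {a..t} (g n)) \<longlonglongrightarrow> integral {a..t} (\<lambda>s. F (t - s) (f' s) \<bullet> adj J y)"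
      by (rule dc(2))
    have "(\<lambda>n. w n t \<bullet> adj J y - w n a \<bullet> adj (F (t - a)) (adj J y)) \<longlonglongrightarrow>
        w' t \<bullet> adj J y - w' a \<bullet> adj (F (t - a)) (adj J y)"
      by (intro tendsto_diff w') (use at in auto)
    moreover have "integral {a..t} (g n) = w n t \<bullet> adj J y - w n a \<bullet> adj (F (t - a)) (adj J y)" for n
      using integral_unique[OF g_int[of n]] J_F[of 0 y "w n t"] J_F[of "t - a" y "w n a"] at
      by (simp add: adj_inner_right)
    ultimately have "integral {a..t} (\<lambda>s. F (t - s) (f' s) \<bullet> adj J y)
        = w' t \<bullet> adj J y - w' a \<bullet> adj (F (t - a)) (adj J y)"
      using lim by (simp add: LIMSEQ_unique)
    then show ?thesis
      using integrable_integral[OF int] by (simp add: adj_inner_right)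
  qed
  have "v \<in> closure (range (adj J))"
    using dense_test_vectors by (simp add: J_def)
  then obtain x where x: "\<And>k. x k \<in> range (adj J)" "x \<longlonglongrightarrow> v"
    unfolding closure_sequential by blast
  then have "\<forall>k. \<exists>z. x k = adj J z" by blast
  then obtain y where "\<And>k. x k = adj J (y k)" unfolding choice_iff by blast
  then have "x = (\<lambda>k. adj J (y k))" by (rule ext)
  with x(2) have y: "(\<lambda>k. adj J (y k)) \<longlonglongrightarrow> v" by simp
  obtain cy where cy: "\<And>k. norm (adj J (y k)) \<le> cy"
    using convergent_imp_Bseq[OF convergentI[OF y]] by (auto simp: Bseq_def)
  have cy0: "0 \<le> cy" using order_trans[OF norm_ge_zero cy] .
  have int: "(\<lambda>s. F (t - s) (f' s) \<bullet> v) integrable_on {a..t}"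
    and lim: "(\<lambda>k. integral {a..t} (\<lambda>s. F (t - s) (f' s) \<bullet> adj J (y k)))
      \<longlonglongrightarrow> integral {a..t} (\<lambda>s. F (t - s) (f' s) \<bullet> v)"
  proof -
    have bound: "norm (F (t - s) (f' s) \<bullet> adj J (y k)) \<le> c * cf * cy" if s: "s \<in> {a..t}" for k s
    proof -
      have "norm (F (t - s) (f' s)) \<le> c * cf"
        by (rule order_trans[OF F_apply_bound]) (use sT[OF s] f'_bound c_nonneg in \<open>auto intro: mult_left_mono\<close>)
      then show ?thesis
        unfolding real_norm_def using cy[of k] c_nonneg cf
        by (intro order_trans[OF Cauchy_Schwarz_ineq2] mult_mono) auto
    qed
    have lim_s: "(\<lambda>k. F (t - s) (f' s) \<bullet> adj J (y k)) \<longlonglongrightarrow> F (t - s) (f' s) \<bullet> v" for s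
      by (intro tendsto_inner tendsto_const y)
    note dc = dominated_convergence[OF has_integral_integrable[OF smooth]
        continuous_integrable[OF continuous_on_const] bound lim_s]
    show "(\<lambda>s. F (t - s) (f' s) \<bullet> v) integrable_on {a..t}"
      by (rule dc(1))
    show "(\<lambda>k. integral {a..t} (\<lambda>s. F (t - s) (f' s) \<bullet> adj J (y k)))
      \<longlonglongrightarrow> integral {a..t} (\<lambda>s. F (t - s) (f' s) \<bullet> v)"
      by (rule dc(2))
  qed
  have "(\<lambda>k. w' t \<bullet> adj J (y k) - F (t - a) (w' a) \<bullet> adj J (y k)) \<longlonglongrightarrow> w' t \<bullet> v - F (t - a) (w' a) \<bullet> v"
    by (intro tendsto_intros y)
  with lim have "integral {a..t} (\<lambda>s. F (t - s) (f' s) \<bullet> v) = w' t \<bullet> v - F (t - a) (w' a) \<bullet> v"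
    by (simp add: integral_unique[OF smooth] LIMSEQ_unique)
  then show ?thesis using integrable_integral[OF int] by simp
qed

lemma weak_mild_continuous:
  assumes weak: "\<And>a t v. 0 \<le> a \<Longrightarrow> a \<le> t \<Longrightarrow> t \<le> T \<Longrightarrow>
      ((\<lambda>s. F (t - s) (f s) \<bullet> v) has_integral (w t \<bullet> v - F (t - a) (w a) \<bullet> v)) {a..t}"
    and f_bound: "\<And>t. t \<in> {0..T} \<Longrightarrow> norm (f t) \<le> cf"
  shows "continuous_on {0..T} w"
proof (rule continuous_if_near_orbit[where C = "c * cf"])
  have cf: "0 \<le> cf" using order_trans[OF norm_ge_zero f_bound[of 0]] T_nonneg by simp
  then show "0 \<le> c * cf" by (simp add: c_nonneg)
  fix a t :: real assume at: "0 \<le> a" "a \<le> t" "t \<le> T"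
  define v where "v = w t - F (t - a) (w a)"
  have "norm (w t \<bullet> v - F (t - a) (w a) \<bullet> v) \<le> c * cf * norm v * measure lborel {a..t}"
  proof (rule has_integral_bound_real[OF _ finite.emptyI weak[OF at]])
    show "0 \<le> c * cf * norm v" using cf by (simp add: c_nonneg)
    fix s assume "s \<in> {a..t} - {}"
    then have s: "s \<in> {0..T}" "0 \<le> t - s" "t - s \<le> T" using at by auto
    have "norm (F (t - s) (f s)) \<le> c * cf"
      by (rule order_trans[OF F_apply_bound]) (use s f_bound c_nonneg in \<open>auto intro: mult_left_mono\<close>)
    then show "norm (F (t - s) (f s) \<bullet> v) \<le> c * cf * norm v"
      unfolding real_norm_def by (intro order_trans[OF Cauchy_Schwarz_ineq2] mult_right_mono) auto
  qed
  moreover have "w t \<bullet> v - F (t - a) (w a) \<bullet> v = (w t - F (t - a) (w a)) \<bullet> v"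
    by (rule inner_diff_left[symmetric])
  moreover have "(w t - F (t - a) (w a)) \<bullet> v = norm v * norm v"
    unfolding v_def[symmetric] by (simp add: dot_square_norm power2_eq_square)
  ultimately have "norm v * norm v \<le> c * cf * (t - a) * norm v"
    using at by (simp add: mult_ac)
  moreover have "0 \<le> c * cf * (t - a)" using cf at c_nonneg by simp
  ultimately have "norm v \<le> c * cf * (t - a)" by (cases "norm v = 0") auto
  then show "norm (w t - F (t - a) (w a)) \<le> c * cf * (t - a)" by (simp only: v_def)
qed

lemma mild_equation:
  assumes weak: "\<And>v. ((\<lambda>s. F (t - s) (f s) \<bullet> v) has_integral (w t \<bullet> v - F t (w 0) \<bullet> v)) {0..t}"
    and f: "continuous_on {0..T} f" and t: "t \<in> {0..T}"
  shows "((\<lambda>s. F (t - s) (f s)) has_integral (w t - F t (w 0))) {0..t}"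
proof -
  have "continuous_on {0..t} (\<lambda>s. F (t - s) (f s))"
  proof (rule continuous_on_strong_apply)
    show "continuous_on {0..t} (\<lambda>s. F (t - s) x)" for x
      by (rule continuous_on_compose2[OF F_continuous]) (auto intro!: continuous_intros)
    show "norm (F (t - s)) \<le> c" if "s \<in> {0..t}" for s
      by (rule F_bound) (use that t in auto)
    show "continuous_on {0..t} f" by (rule continuous_on_subset[OF f]) (use t in auto)
  qed
  from continuous_integrable[OF this]
  obtain i where i: "((\<lambda>s. F (t - s) (f s)) has_integral i) {0..t}"
    unfolding integrable_on_def ..
  have "i \<bullet> v = (w t - F t (w 0)) \<bullet> v" for v
    using has_integral_unique[OF has_integral_linear[OF i bounded_linear_inner_left[of v], unfolded o_def] weak]
    by (simp add: inner_diff_left)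
  then have "i = w t - F t (w 0)" by (rule vector_eq_rdot[THEN iffD1, OF allI])
  with i show ?thesis by simp
qed

end

section \<open>The semigroup and its adjoint\<close>

context semigroup_generator
begin

lemma smoothed_semigroup_E:
  assumes l: "l > \<omega>" and T: "0 \<le> T"
  shows "smoothed_semigroup E (Res l) (ARes l) T (M * exp (\<bar>\<omega>\<bar> * T))"
proof
  fix t b :: real and x y
  assume t: "t \<in> {0..b}"
  show "((\<lambda>t. y \<bullet> E t (Res l x)) has_real_derivative y \<bullet> E t (ARes l x)) (at t within {0..b})"
    unfolding has_real_derivative_iff_has_vector_derivative
    by (rule bounded_linear.has_vector_derivative[OF bounded_linear_inner_right
        semigroup_Res_derivative[OF l t]])
next
  fix x assume "Res l x = 0"
  then show "x = 0" by (rule Res_injective[OF l])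
qed (simp_all add: E_add E_continuous norm_E_le Res_semigroup_commute l T)

text \<open>
Transposing \<open>E t (Res l w) - E s (Res l w)\<close>, whose norm is controlled by the derivative of the orbit, and testing with
the difference itself.
\<close>

lemma adj_semigroup_lipschitz:
  assumes l: "l > \<omega>" and st: "0 \<le> s" "s \<le> t" "t \<le> b"
  shows "norm (adj (E t) (adj (Res l) y) - adj (E s) (adj (Res l) y))
    \<le> M * exp (\<bar>\<omega>\<bar> * b) * norm (ARes l) * norm y * (t - s)"
proof -
  define w where "w = adj (E t) (adj (Res l) y) - adj (E s) (adj (Res l) y)"
  have "norm (E t (Res l w) - E s (Res l w)) \<le> M * exp (\<bar>\<omega>\<bar> * b) * (norm (ARes l) * norm w) * (t - s)"
  proof (rule norm_diff_le_of_bounded_derivative[OF st(2)])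
    fix r assume r: "r \<in> {s..t}"
    show "((\<lambda>r. E r (Res l w)) has_vector_derivative E r (ARes l w)) (at r within {s..t})"
      by (rule has_vector_derivative_within_subset[OF semigroup_Res_derivative[OF l, of r t]])
        (use r st in auto)
    show "norm (E r (ARes l w)) \<le> M * exp (\<bar>\<omega>\<bar> * b) * (norm (ARes l) * norm w)"
      using r st M_ge by (intro order_trans[OF norm_blinfun] mult_mono norm_E_le norm_blinfun) auto
  qed
  moreover have "norm w * norm w = (E t (Res l w) - E s (Res l w)) \<bullet> y"
  proof -
    have "norm w * norm w = w \<bullet> w" by (simp add: dot_square_norm power2_eq_square)
    also have "\<dots> = w \<bullet> (adj (E t) (adj (Res l) y) - adj (E s) (adj (Res l) y))"
      by (simp only: w_def)
    also have "\<dots> = (E t (Res l w) - E s (Res l w)) \<bullet> y"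
      by (simp only: inner_diff_right inner_diff_left adj_inner_right
          Res_semigroup_commute[OF l st(1)] Res_semigroup_commute[OF l order_trans[OF st(1,2)]])
    finally show ?thesis .
  qed
  moreover have "(E t (Res l w) - E s (Res l w)) \<bullet> y \<le> norm (E t (Res l w) - E s (Res l w)) * norm y"
    by (rule norm_cauchy_schwarz)
  ultimately have "norm w * norm w \<le> M * exp (\<bar>\<omega>\<bar> * b) * (norm (ARes l) * norm w) * (t - s) * norm y"
    by (smt (verit) mult_right_mono norm_ge_zero)
  then have "norm w * norm w \<le> (M * exp (\<bar>\<omega>\<bar> * b) * norm (ARes l) * norm y * (t - s)) * norm w"
    by (simp add: mult_ac)
  moreover have "0 \<le> M * exp (\<bar>\<omega>\<bar> * b) * norm (ARes l) * norm y * (t - s)"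
    using M_ge st by simp
  ultimately have "norm w \<le> M * exp (\<bar>\<omega>\<bar> * b) * norm (ARes l) * norm y * (t - s)"
    by (cases "norm w = 0") auto
  then show ?thesis by (simp only: w_def)
qed

text \<open>
Orbits of vectors in the range of the adjoint resolvent are Lipschitz on bounded intervals, and this
range is dense because the resolvent is injective.
\<close>

lemma adj_semigroup_continuous: "continuous_on {0..} (\<lambda>t. adj (E t) x)"
  unfolding continuous_on_def
proof
  fix t0 :: real assume t0: "t0 \<in> {0..}"
  define l where "l = \<omega> + 1"
  have l: "l > \<omega>" by (simp add: l_def)
  define b where "b = t0 + 1"
  define c where "c = M * exp (\<bar>\<omega>\<bar> * b)"
  have c: "c > 0" using M_ge by (simp add: c_def)
  have bound: "norm (adj (E t)) \<le> c" if "0 \<le> t" "t \<le> b" for t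
    using norm_adj_le norm_E_le[OF that] by (auto simp: c_def intro: order_trans)
  have near: "\<forall>\<^sub>F t in at t0 within {0..}. 0 \<le> t \<and> t \<le> b"
  proof -
    have "\<forall>\<^sub>F t in nhds t0. t < b" by (rule order_tendstoD(2)[OF filterlim_ident]) (simp add: b_def)
    then show ?thesis unfolding eventually_at_filter by eventually_elim auto
  qed
  show "((\<lambda>t. adj (E t) x) \<longlongrightarrow> adj (E t0) x) (at t0 within {0..})"
  proof (rule tendstoI)
    fix e :: real assume e: "e > 0"
    have "x \<in> closure (range (adj (Res l)))"
      using closure_range_adj[of "Res l"] Res_injective[OF l] by auto
    moreover have "e / (3 * c) > 0" using e c by simp
    ultimately obtain y where y: "dist (adj (Res l) y) x < e / (3 * c)"
      unfolding closure_approachable by blast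
    have close: "norm (adj (E t) x - adj (E t) (adj (Res l) y)) < e / 3" if "0 \<le> t" "t \<le> b" for t
    proof -
      have "norm (adj (E t) x - adj (E t) (adj (Res l) y)) \<le> c * norm (x - adj (Res l) y)"
        using order_trans[OF norm_blinfun mult_right_mono[OF bound[OF that] norm_ge_zero], of "x - adj (Res l) y"]
        by (simp add: blinfun.diff_right)
      also have "\<dots> < c * (e / (3 * c))"
        using y c by (intro mult_strict_left_mono) (auto simp: dist_norm norm_minus_commute)
      also have "\<dots> = e / 3" using c by simp
      finally show ?thesis .
    qed
    define k where "k = c * norm (ARes l) * norm y"
    have lip: "norm (adj (E t) (adj (Res l) y) - adj (E t0) (adj (Res l) y)) \<le> k * \<bar>t - t0\<bar>"
      if "0 \<le> t" "t \<le> b" for t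
    proof (cases "t0 \<le> t")
      case True
      then show ?thesis
        using adj_semigroup_lipschitz[OF l, of t0 t b y] t0 that by (simp add: k_def c_def)
    next
      case False
      then show ?thesis
        using adj_semigroup_lipschitz[OF l, of t t0 b y] t0 that
        by (simp add: k_def c_def b_def norm_minus_commute)
    qed
    have "((\<lambda>t. k * \<bar>t - t0\<bar>) \<longlongrightarrow> k * \<bar>t0 - t0\<bar>) (at t0 within {0..})"
      by (intro tendsto_intros)
    then have "\<forall>\<^sub>F t in at t0 within {0..}. k * \<bar>t - t0\<bar> < e / 3"
      by (rule order_tendstoD(2)) (use e in simp)
    with near show "\<forall>\<^sub>F t in at t0 within {0..}. dist (adj (E t) x) (adj (E t0) x) < e"
    proof eventually_elim
      case (elim t)
      have "dist (adj (E t) x) (adj (E t0) x) \<le> dist (adj (E t) x) (adj (E t) (adj (Res l) y))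
          + dist (adj (E t) (adj (Res l) y)) (adj (E t0) (adj (Res l) y))
          + dist (adj (E t0) (adj (Res l) y)) (adj (E t0) x)"
        using dist_triangle[of "adj (E t) x" "adj (E t0) x" "adj (E t) (adj (Res l) y)"]
          dist_triangle[of "adj (E t) (adj (Res l) y)" "adj (E t0) x" "adj (E t0) (adj (Res l) y)"] by linarith
      also have "\<dots> < e"
        using close[of t] close[of t0] lip[of t] elim t0
        by (simp add: dist_norm norm_minus_commute b_def)
      finally show ?case .
    qed
  qed
qed

text \<open>
The adjoint resolvent is injective because the range of the resolvent, which contains the domain of \<open>A\<close>, is
dense.
\<close>

lemma smoothed_semigroup_adj:
  assumes l: "l > \<omega>" and T: "0 \<le> T"
  shows "smoothed_semigroup (\<lambda>t. adj (E t)) (adj (Res l)) (adj (ARes l)) T (M * exp (\<bar>\<omega>\<bar> * T))"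
proof
  fix x show "adj (E 0) x = x"
    by (rule vector_eq_ldot[THEN iffD1]) (simp add: adj_inner_right)
next
  fix s t :: real and x assume "0 \<le> s" "0 \<le> t"
  then have "E (s + t) y = E t (E s y)" for y
    using E_add[of t s y] by (simp add: add.commute)
  then have "y \<bullet> adj (E (s + t)) x = y \<bullet> adj (E s) (adj (E t) x)" for y
    by (simp add: adj_inner_right)
  then show "adj (E (s + t)) x = adj (E s) (adj (E t) x)"
    by (rule vector_eq_ldot[THEN iffD1, OF allI])
next
  fix x show "continuous_on {0..} (\<lambda>t. adj (E t) x)" by (rule adj_semigroup_continuous)
next
  fix t assume "0 \<le> t" "t \<le> T"
  then show "norm (adj (E t)) \<le> M * exp (\<bar>\<omega>\<bar> * T)"
    by (intro order_trans[OF norm_adj_le norm_E_le])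
next
  fix x assume "adj (Res l) x = 0"
  then have orth: "z \<bullet> x = 0" if "z \<in> range (Res l)" for z
    using that by (auto simp flip: adj_inner_right)
  have "closed {z. z \<bullet> x = 0}" by (intro closed_Collect_eq continuous_intros)
  with orth have "closure (range (Res l)) \<subseteq> {z. z \<bullet> x = 0}" by (intro closure_minimal) auto
  then have "x \<in> {z. z \<bullet> x = 0}" unfolding dense_range_Res[OF l] by blast
  then show "x = 0" by simp
next
  fix t :: real and x assume "0 \<le> t"
  then have "y \<bullet> adj (Res l) (adj (E t) x) = y \<bullet> adj (E t) (adj (Res l) x)" for y
    by (simp add: adj_inner_right Res_semigroup_commute[OF l])
  then show "adj (Res l) (adj (E t) x) = adj (E t) (adj (Res l) x)"
    by (rule vector_eq_ldot[THEN iffD1, OF allI])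
next
  fix t b :: real and x y
  assume t: "t \<in> {0..b}"
  have "((\<lambda>t. E t (Res l y) \<bullet> x) has_real_derivative E t (ARes l y) \<bullet> x) (at t within {0..b})"
    unfolding has_real_derivative_iff_has_vector_derivative
    by (rule bounded_linear.has_vector_derivative[OF bounded_linear_inner_left
        semigroup_Res_derivative[OF l t]])
  then have deriv: "((\<lambda>t. E t (Res l y) \<bullet> x) has_real_derivative y \<bullet> adj (E t) (adj (ARes l) x)) (at t within {0..b})"
    using Res_semigroup_commute[OF l, of t y] t
    by (simp add: adj_inner_right ARes_def blinfun.bilinear_simps)
  show "((\<lambda>t. y \<bullet> adj (E t) (adj (Res l) x)) has_real_derivative y \<bullet> adj (E t) (adj (ARes l) x)) (at t within {0..b})"
    by (rule has_field_derivative_transform_within[OF deriv zero_less_one t])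
      (simp add: adj_inner_right Res_semigroup_commute[OF l])
qed (rule T)

definition yosida_error :: "real \<Rightarrow> nat \<Rightarrow> 'h \<Rightarrow>\<^sub>L 'h" where
  "yosida_error l n = Res (real n) o\<^sub>L ARes l o\<^sub>L ARes l"

lemma yosida_error_lim: "(\<lambda>n. norm (yosida_error l n)) \<longlonglongrightarrow> 0"
proof (rule Lim_null_comparison)
  obtain m :: nat where m: "\<omega> < real m" using reals_Archimedean2 by blast
  have "norm (yosida_error l n) \<le> M / (real n - \<omega>) * norm (ARes l) * norm (ARes l)" if "n \<ge> m" for n
    unfolding yosida_error_def using that m M_ge
    by (intro order_trans[OF norm_blinfun_compose] mult_mono norm_Res) auto
  then show "\<forall>\<^sub>F n in sequentially. norm (norm (yosida_error l n)) \<le> M / (real n - \<omega>) * norm (ARes l) * norm (ARes l)"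
    unfolding eventually_sequentially by auto
  have "filterlim (\<lambda>n. real n - \<omega>) at_top sequentially"
    using filterlim_tendsto_add_at_top[OF tendsto_const filterlim_real_sequentially, of "- \<omega>"] by simp
  then have "(\<lambda>n. M / (real n - \<omega>)) \<longlonglongrightarrow> 0"
    by (intro tendsto_divide_0[OF tendsto_const] filterlim_at_top_imp_at_infinity)
  then show "(\<lambda>n. M / (real n - \<omega>) * norm (ARes l) * norm (ARes l)) \<longlonglongrightarrow> 0"
    by (intro tendsto_mult_left_zero)
qed

lemma smooth_yosida:
  assumes "l > \<omega>" "real n > \<omega>"
  shows "Res l (Res l (yosida D A n x)) = ARes l (Res l x) + yosida_error l n x"
  using yosida_identity[OF assms] by (simp add: yosida_error_def)

text \<open>
The transposed identity: the resolvent may be moved to the other side of the Yosida approximation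
because they commute.
\<close>

lemma smooth_adj_yosida:
  assumes l: "l > \<omega>" and n: "real n > \<omega>"
  shows "adj (Res l) (adj (Res l) (adj (yosida D A n) x)) = adj (ARes l) (adj (Res l) x) + adj (yosida_error l n) x"
proof (rule vector_eq_ldot[THEN iffD1, OF allI])
  fix y
  have "y \<bullet> adj (Res l) (adj (Res l) (adj (yosida D A n) x)) = Res l (Res l (yosida D A n y)) \<bullet> x"
    by (simp add: adj_inner_right Res_yosida_commute[OF l n])
  also have "\<dots> = y \<bullet> (adj (ARes l) (adj (Res l) x) + adj (yosida_error l n) x)"
    by (simp add: smooth_yosida[OF l n] inner_add_left inner_add_right adj_inner_right Res_ARes_commute)
  finally show "y \<bullet> adj (Res l) (adj (Res l) (adj (yosida D A n) x))
    = y \<bullet> (adj (ARes l) (adj (Res l) x) + adj (yosida_error l n) x)" .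
qed

end

section \<open>The mean field game\<close>

theorem theorem3p4:
  fixes D :: "'h::{real_inner, polish_space} set"
    and A :: "'h \<Rightarrow> 'h"
    and E :: "real \<Rightarrow> ('h \<Rightarrow>\<^sub>L 'h)"
    and B :: "'u::{real_inner, polish_space} \<Rightarrow>\<^sub>L 'h"
    and R :: "'u \<Rightarrow>\<^sub>L 'u"
    and Q QT Qbar QTbar S ST :: "'h \<Rightarrow>\<^sub>L 'h"
    and \<sigma> :: "'k::{real_inner, polish_space} \<Rightarrow>\<^sub>L 'h"
    and \<epsilon> M \<omega> T :: real
    and z0 :: 'h
    and P :: "real \<Rightarrow> ('h \<Rightarrow>\<^sub>L 'h)"
    and \<eta> :: "nat \<Rightarrow> real \<Rightarrow> ('h \<Rightarrow>\<^sub>L 'h)"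
  assumes A_closed: "closed ((\<lambda>x. (x, A x)) ` D)"
    and A_dense: "closure D = UNIV"
    and A_gen: "generates D A E"
    and growth: "M \<ge> 1" "\<And>t. t \<ge> 0 \<Longrightarrow> norm (E t) \<le> M * exp (\<omega> * t)"
    and Q: "Q \<in> nonneg_ops" "QT \<in> nonneg_ops"
    and Qbar: "Qbar \<in> selfadjoint_ops" "QTbar \<in> selfadjoint_ops"
    and Q_Qbar: "Q + Qbar \<in> nonneg_ops" "QT + QTbar \<in> nonneg_ops"
    and R: "R \<in> selfadjoint_ops" "\<epsilon> > 0" "\<And>\<alpha>. R \<alpha> \<bullet> \<alpha> \<ge> \<epsilon> * (norm \<alpha>)\<^sup>2"
    and T: "T > 0"
    and P: "riccati_mild_solution E B R Q QT Qbar QTbar T P"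
    and trace_defined: "trace_term_defined \<sigma> T P"
    and H1: "\<And>n. n > 0 \<Longrightarrow> real n > \<omega> \<Longrightarrow>
        eta_strict_solution (yosida D A n) B R Qbar QTbar S ST T P (\<eta> n)"
    and H2: "bdd_above {norm (\<eta> n t) | n t. n > 0 \<and> real n > \<omega> \<and> t \<in> {0..T}}"
  shows "\<exists>r z s. LQM_mild_solution E B R Q QT Qbar QTbar S ST \<sigma> T z0 P r z s"
proof -
  interpret semigroup_generator D A E M \<omega>
    by unfold_locales (fact A_closed A_dense A_gen growth)+
  have T0: "0 \<le> T" using T by simp
  define G where "G = BRB B R"
  have "P \<in> C_s T nonneg_ops" using P by (simp add: riccati_mild_solution_def)
  then have P_cont: "\<And>x. continuous_on {0..T} (\<lambda>t. P t x)"
    and P_adj: "\<And>t. t \<in> {0..T} \<Longrightarrow> adj (P t) = P t"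
    by (auto simp: C_s_def nonneg_ops_def selfadjoint_ops_def)
  have "\<exists>c. \<forall>t\<in>{0..T}. norm (P t x) \<le> c" for x
    using compact_imp_bounded[OF compact_continuous_image[OF P_cont compact_Icc], of x]
    by (auto simp: bounded_iff)
  then obtain cP where cP: "cP \<ge> 0" "\<And>t. t \<in> {0..T} \<Longrightarrow> norm (P t) \<le> cP"
    by (rule uniform_boundedness[of "{0..T}" P]) (rule that)
  obtain c\<eta>' where "\<And>x. x \<in> {norm (\<eta> n t) | n t. n > 0 \<and> real n > \<omega> \<and> t \<in> {0..T}} \<Longrightarrow> x \<le> c\<eta>'"
    using H2 unfolding bdd_above_def by blast
  then have c\<eta>': "norm (\<eta> n t) \<le> c\<eta>'" if "n > 0" "real n > \<omega>" "t \<in> {0..T}" for n t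
    using that by blast
  define c\<eta> where "c\<eta> = max 0 c\<eta>'"
  \<comment> \<open>Only indices from \<open>m\<close> on are used; for them \<open>n - \<omega> \<ge> n / 2\<close>, so \<open>n / (n - \<omega>) \<le> 2\<close>.\<close>
  obtain m :: nat where m: "2 * \<bar>\<omega>\<bar> + 1 \<le> real m" using real_arch_simple by blast
  have n_pos: "m + n > 0" and n_gt: "real (m + n) > \<omega>" for n
    using m by (auto intro: Suc_leI)
  have n_ratio: "real (m + n) * \<omega> / (real (m + n) - \<omega>) \<le> 2 * \<bar>\<omega>\<bar>" for n
  proof -
    have "real (m + n) * \<omega> \<le> real (m + n) * \<bar>\<omega>\<bar>" by (intro mult_left_mono) auto
    also have "\<dots> \<le> (2 * (real (m + n) - \<omega>)) * \<bar>\<omega>\<bar>" using m by (intro mult_right_mono) auto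
    finally show ?thesis using n_gt[of n] by (simp add: pos_divide_le_eq mult_ac)
  qed
  define Y where "Y n = yosida D A (m + n)" for n
  define e where "e n = \<eta> (m + n)" for n
  have strict: "eta_strict_solution (Y n) B R Qbar QTbar S ST T P (e n)" for n
    unfolding Y_def e_def by (rule H1[OF n_pos n_gt])
  have c\<eta>: "0 \<le> c\<eta>" "norm (e n t) \<le> c\<eta>" if "t \<in> {0..T}" for n t
    using c\<eta>'[OF n_pos n_gt that, of n] by (auto simp: c\<eta>_def e_def)
  have c\<eta>0: "0 \<le> c\<eta>" by (simp add: c\<eta>_def)
  have e_T: "e n T x = - QTbar (ST x)" for n x
    using strict[of n] by (simp add: eta_strict_solution_def blinfun.minus_left)
  have e_deriv: "((\<lambda>t. e n t x) has_vector_derivative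
      P t (G (e n t x)) - adj (Y n) (e n t x) - (e n t (Y n x) - e n t (G (P t x))) + Qbar (S x) + e n t (G (e n t x)))
      (at t within {0..T})" if "t \<in> {0..T}" for n t x
    using strict[of n] that
    by (simp add: eta_strict_solution_def G_def blinfun.bilinear_simps)
  have e_cont: "continuous_on {0..T} (\<lambda>t. e n t x)" for n x
    by (rule continuous_on_vector_derivative[OF e_deriv])
  \<comment> \<open>The state equation for the Yosida approximation, with the feedback \<open>r = \<eta> z\<close> inserted.\<close>
  define g where "g n t x = - G (P t x) - G (e n t x)" for n t x
  have "\<exists>z. z 0 = z0 \<and> (\<forall>t\<in>{0..T}. (z has_vector_derivative Y n (z t) + g n t (z t)) (at t within {0..T}))" for n
  proof -
    define L where "L t = Y n - (G o\<^sub>L P t) - (G o\<^sub>L e n t)" for t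
    have L: "L t x = Y n x + g n t x" for t x
      by (simp add: L_def g_def blinfun.bilinear_simps)
    have "continuous_on {0..T} (\<lambda>t. L t x)" for x
      unfolding L g_def
      by (intro continuous_on_add continuous_on_diff continuous_on_minus continuous_on_const
          bounded_linear.continuous_on[OF blinfun.bounded_linear_right] P_cont e_cont)
    moreover have "norm (L t) \<le> norm (Y n) + norm G * cP + norm G * c\<eta>" if "t \<in> {0..T}" for t
      unfolding L_def
      by (intro order_trans[OF norm_triangle_ineq4] add_mono order_trans[OF norm_blinfun_compose]
          mult_left_mono cP c\<eta> that order_refl norm_ge_zero)
    ultimately obtain z where "z 0 = z0"
      "\<And>t. t \<in> {0..T} \<Longrightarrow> (z has_vector_derivative L t (z t)) (at t within {0..T})"
      by (rule linear_ode_solution[OF T0, where ?z0.0 = z0]) (assumption, rule that)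
    then show ?thesis unfolding L by blast
  qed
  then obtain z where z_0: "\<And>n. z n 0 = z0"
    and z_deriv: "\<And>n t. t \<in> {0..T} \<Longrightarrow> (z n has_vector_derivative Y n (z n t) + g n t (z n t)) (at t within {0..T})"
    by metis
  define Cg where "Cg = norm G * cP + norm G * c\<eta>"
  have Cg: "0 \<le> Cg" using cP c\<eta>0 by (simp add: Cg_def)
  have g_le: "norm (g n t x) \<le> Cg * norm x" if "t \<in> {0..T}" for n t x
  proof -
    have "norm (G (P t x)) \<le> norm G * (cP * norm x)"
      by (intro order_trans[OF norm_blinfun] mult_left_mono mult_right_mono cP that norm_ge_zero)
    moreover have "norm (G (e n t x)) \<le> norm G * (c\<eta> * norm x)"
      by (intro order_trans[OF norm_blinfun] mult_left_mono mult_right_mono c\<eta> that norm_ge_zero)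
    ultimately show ?thesis
      unfolding g_def Cg_def using norm_triangle_ineq4[of "- G (P t x)" "G (e n t x)"]
      by (simp add: algebra_simps)
  qed
  define cz where "cz = M * norm z0 * exp ((2 * \<bar>\<omega>\<bar> + M * Cg) * T)"
  have z_bound: "norm (z n t) \<le> cz" if t: "t \<in> {0..T}" for n t
  proof -
    have "norm (z n t) \<le> M * norm (z n 0) * exp ((real (m + n) * \<omega> / (real (m + n) - \<omega>) + M * Cg) * t)"
      by (rule yosida_growth[OF n_gt z_deriv[unfolded Y_def] Cg g_le t])
    also have "\<dots> \<le> cz"
    proof -
      have "(real (m + n) * \<omega> / (real (m + n) - \<omega>) + M * Cg) * t \<le> (2 * \<bar>\<omega>\<bar> + M * Cg) * t"
        using n_ratio[of n] t by (intro mult_right_mono) auto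
      also have "\<dots> \<le> (2 * \<bar>\<omega>\<bar> + M * Cg) * T"
        using t M_ge Cg by (intro mult_left_mono) auto
      finally show ?thesis using M_ge by (simp add: cz_def z_0 mult_left_mono)
    qed
    finally show ?thesis .
  qed
  have cz: "0 \<le> cz" using order_trans[OF norm_ge_zero z_bound[of 0 0]] T0 by simp
  \<comment> \<open>The Riccati equation for \<open>\<eta>\<close> is designed so that the terms with \<open>\<eta> A\<^sub>n\<close> and \<open>\<eta> G\<close> cancel in the derivative of \<open>\<eta> z\<close>.\<close>
  define r where "r n t = e n t (z n t)" for n t
  have r_bound: "norm (r n t) \<le> c\<eta> * cz" if "t \<in> {0..T}" for n t
    unfolding r_def by (intro order_trans[OF norm_blinfun] mult_mono c\<eta> z_bound that norm_ge_zero c\<eta>0)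
  have r_deriv: "(r n has_vector_derivative P t (G (r n t)) - adj (Y n) (r n t) + Qbar (S (z n t)))
      (at t within {0..T})" if t: "t \<in> {0..T}" for n t
  proof -
    have "e n t (Y n (z n t) + g n t (z n t))
        = e n t (Y n (z n t)) - e n t (G (P t (z n t))) - e n t (G (e n t (z n t)))"
      by (simp add: g_def blinfun.add_right blinfun.diff_right blinfun.minus_right)
    with has_vector_derivative_strong_apply[OF t e_cont c\<eta>(2) e_deriv[OF t] z_deriv[OF t], of n n]
    show ?thesis by (simp add: r_def[abs_def])
  qed
  \<comment> \<open>In reversed time the costate equation is a forward equation for the adjoint.\<close>
  define \<rho> where "\<rho> n t = r n (T - t)" for n t
  define h where "h n t = - P (T - t) (G (\<rho> n t)) - Qbar (S (z n (T - t)))" for n t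
  have rev: "T - t \<in> {0..T}" if "t \<in> {0..T}" for t using that by auto
  have \<rho>_deriv: "(\<rho> n has_vector_derivative adj (Y n) (\<rho> n t) + h n t) (at t within {0..T})"
    if t: "t \<in> {0..T}" for n t
  proof -
    have img: "(\<lambda>t. T - t) ` {0..T} = {0..T}" by (simp add: image_diff_atLeastAtMost)
    have "((\<lambda>t. T - t) has_vector_derivative -1) (at t within {0..T})"
      unfolding has_real_derivative_iff_has_vector_derivative[symmetric]
      by (auto intro!: derivative_eq_intros)
    from vector_diff_chain_within[OF this, of "r n", unfolded img, OF r_deriv[OF rev[OF t]]]
    have "((r n \<circ> (\<lambda>t. T - t)) has_vector_derivative - (P (T - t) (G (r n (T - t)))
        - adj (Y n) (r n (T - t)) + Qbar (S (z n (T - t))))) (at t within {0..T})"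
      by simp
    then show ?thesis
      unfolding \<rho>_def[abs_def] h_def o_def
      by (rule has_vector_derivative_eq_rhs) simp
  qed
  have \<rho>_bound: "norm (\<rho> n t) \<le> c\<eta> * cz" if "t \<in> {0..T}" for n t
    unfolding \<rho>_def by (rule r_bound[OF rev[OF that]])
  define ch where "ch = cP * (norm G * (c\<eta> * cz)) + norm Qbar * (norm S * cz)"
  have h_bound: "norm (h n t) \<le> ch" if t: "t \<in> {0..T}" for n t
  proof -
    have "norm (P (T - t) (G (\<rho> n t))) \<le> cP * (norm G * (c\<eta> * cz))"
      by (intro order_trans[OF norm_blinfun] mult_mono mult_left_mono cP rev[OF t] \<rho>_bound[OF t] norm_ge_zero)
    moreover have "norm (Qbar (S (z n (T - t)))) \<le> norm Qbar * (norm S * cz)"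
      by (intro order_trans[OF norm_blinfun] mult_left_mono z_bound rev[OF t] norm_ge_zero)
    ultimately show ?thesis
      unfolding h_def ch_def using norm_triangle_ineq4[of "- P (T - t) (G (\<rho> n t))" "Qbar (S (z n (T - t)))"]
      by simp
  qed
  have gz_bound: "norm (g n t (z n t)) \<le> Cg * cz" if t: "t \<in> {0..T}" for n t
    by (rule order_trans[OF g_le[OF t] mult_left_mono[OF z_bound[OF t] Cg]])
  \<comment> \<open>Any \<open>l > \<omega>\<close> serves for the regularisation; it stays fixed while \<open>n\<close> tends to infinity.\<close>
  define l where "l = \<omega> + 1"
  have l: "l > \<omega>" by (simp add: l_def)
  have err: "(\<lambda>n. norm (yosida_error l (m + n))) \<longlonglongrightarrow> 0"
    using LIMSEQ_ignore_initial_segment[OF yosida_error_lim, of l m] by (simp add: add.commute)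
  have adj_err: "(\<lambda>n. norm (adj (yosida_error l (m + n)))) \<longlonglongrightarrow> 0"
    by (rule Lim_null_comparison[OF _ err]) (simp add: norm_adj_le)
  interpret sE: smoothed_semigroup E "semigroup_generator.Res D A l" "semigroup_generator.ARes D A l"
      T "M * exp (\<bar>\<omega>\<bar> * T)"
    by (rule smoothed_semigroup_E[OF l T0])
  interpret sA: smoothed_semigroup "\<lambda>t. adj (E t)" "adj (semigroup_generator.Res D A l)"
      "adj (semigroup_generator.ARes D A l)" T "M * exp (\<bar>\<omega>\<bar> * T)"
    by (rule smoothed_semigroup_adj[OF l T0])
  note smooth_Y = smooth_yosida[OF l n_gt, folded Y_def]
  note smooth_adj_Y = smooth_adj_yosida[OF l n_gt, folded Y_def]
  obtain k1 z' where k1: "strict_mono (k1 :: nat \<Rightarrow> nat)"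
    and z'1: "\<And>t v. t \<in> {0..T} \<Longrightarrow> (\<lambda>n. z (k1 n) t \<bullet> v) \<longlonglongrightarrow> z' t \<bullet> v"
    using sE.weak_subsequence[OF z_deriv z_bound gz_bound smooth_Y err] by metis
  obtain k2 \<rho>' where k2: "strict_mono (k2 :: nat \<Rightarrow> nat)"
    and \<rho>'1: "\<And>t v. t \<in> {0..T} \<Longrightarrow> (\<lambda>n. \<rho> (k1 (k2 n)) t \<bullet> v) \<longlonglongrightarrow> \<rho>' t \<bullet> v"
    using sA.weak_subsequence[of "\<lambda>n. \<rho> (k1 n)" "\<lambda>n. adj (Y (k1 n))" "\<lambda>n. h (k1 n)" "c\<eta> * cz" ch
        "\<lambda>n. adj (yosida_error l (m + k1 n))",
        OF \<rho>_deriv \<rho>_bound h_bound smooth_adj_Y LIMSEQ_subseq_LIMSEQ[OF adj_err k1, unfolded o_def]] by metis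
  define k where "k n = k1 (k2 n)" for n
  have k: "strict_mono k"
    using strict_mono_o[OF k1 k2] by (simp add: k_def[abs_def] o_def)
  have z': "(\<lambda>n. z (k n) t \<bullet> v) \<longlonglongrightarrow> z' t \<bullet> v" if "t \<in> {0..T}" for t v
    using LIMSEQ_subseq_LIMSEQ[OF z'1[OF that] k2] by (simp add: k_def o_def)
  have \<rho>': "(\<lambda>n. \<rho> (k n) t \<bullet> v) \<longlonglongrightarrow> \<rho>' t \<bullet> v" if "t \<in> {0..T}" for t v
    using \<rho>'1[OF that] by (simp add: k_def)
  define r' where "r' t = \<rho>' (T - t)" for t
  define g' where "g' t = - G (P t (z' t)) - G (r' t)" for t
  define h' where "h' t = - P (T - t) (G (\<rho>' t)) - Qbar (S (z' (T - t)))" for t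
  have g': "(\<lambda>n. g (k n) t (z (k n) t) \<bullet> v) \<longlonglongrightarrow> g' t \<bullet> v" if t: "t \<in> {0..T}" for t v
  proof -
    have "(\<lambda>n. - (z (k n) t \<bullet> adj (G o\<^sub>L P t) v) - \<rho> (k n) (T - t) \<bullet> adj G v)
        \<longlonglongrightarrow> - (z' t \<bullet> adj (G o\<^sub>L P t) v) - \<rho>' (T - t) \<bullet> adj G v"
      by (intro tendsto_diff tendsto_minus z' \<rho>' t rev[OF t])
    then show ?thesis
      by (simp add: g_def g'_def r'_def \<rho>_def r_def adj_inner_right inner_diff_left inner_minus_left)
  qed
  have h': "(\<lambda>n. h (k n) t \<bullet> v) \<longlonglongrightarrow> h' t \<bullet> v" if t: "t \<in> {0..T}" for t v
  proof -
    have "(\<lambda>n. - (\<rho> (k n) t \<bullet> adj (P (T - t) o\<^sub>L G) v) - z (k n) (T - t) \<bullet> adj (Qbar o\<^sub>L S) v)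
        \<longlonglongrightarrow> - (\<rho>' t \<bullet> adj (P (T - t) o\<^sub>L G) v) - z' (T - t) \<bullet> adj (Qbar o\<^sub>L S) v"
      by (intro tendsto_diff tendsto_minus z' \<rho>' t rev[OF t])
    then show ?thesis
      by (simp add: h_def h'_def adj_inner_right inner_diff_left inner_minus_left)
  qed
  have g'_bound: "norm (g' t) \<le> Cg * cz" if t: "t \<in> {0..T}" for t
    by (rule norm_weak_limit_le[OF g'[OF t] gz_bound[OF t]])
  have h'_bound: "norm (h' t) \<le> ch" if t: "t \<in> {0..T}" for t
    by (rule norm_weak_limit_le[OF h'[OF t] h_bound[OF t]])
  \<comment> \<open>At this stage \<open>z'\<close> and \<open>\<rho>'\<close> are just bounded functions of time, and the mild equations hold weakly.\<close>
  have z_weak: "((\<lambda>s. E (t - s) (g' s) \<bullet> v) has_integral (z' t \<bullet> v - E (t - a) (z' a) \<bullet> v)) {a..t}"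
    if "0 \<le> a" "a \<le> t" "t \<le> T" for a t v
    by (rule sE.weak_mild_limit[where w = "\<lambda>n. z (k n)" and f = "\<lambda>n t. g (k n) t (z (k n) t)" and C = "\<lambda>n. Y (k n)"
        and L = "\<lambda>n. yosida_error l (m + k n)", OF z_deriv z_bound gz_bound smooth_Y
        LIMSEQ_subseq_LIMSEQ[OF err k, unfolded o_def] z' g' that])
  have \<rho>_weak: "((\<lambda>s. adj (E (t - s)) (h' s) \<bullet> v) has_integral (\<rho>' t \<bullet> v - adj (E (t - a)) (\<rho>' a) \<bullet> v)) {a..t}"
    if "0 \<le> a" "a \<le> t" "t \<le> T" for a t v
    by (rule sA.weak_mild_limit[where w = "\<lambda>n. \<rho> (k n)" and f = "\<lambda>n. h (k n)" and C = "\<lambda>n. adj (Y (k n))"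
        and L = "\<lambda>n. adj (yosida_error l (m + k n))", OF \<rho>_deriv \<rho>_bound h_bound smooth_adj_Y
        LIMSEQ_subseq_LIMSEQ[OF adj_err k, unfolded o_def] \<rho>' h' that])
  have z'_cont: "continuous_on {0..T} z'"
    by (rule sE.weak_mild_continuous[OF z_weak g'_bound])
  have \<rho>'_cont: "continuous_on {0..T} \<rho>'"
    by (rule sA.weak_mild_continuous[OF \<rho>_weak h'_bound])
  have rev_cont: "continuous_on {0..T} (\<lambda>t. f (T - t))" if "continuous_on {0..T} f" for f :: "real \<Rightarrow> 'h"
    by (rule continuous_on_compose2[OF that]) (auto intro!: continuous_intros)
  have r'_cont: "continuous_on {0..T} r'"
    unfolding r'_def by (rule rev_cont[OF \<rho>'_cont])
  note apply_cont = bounded_linear.continuous_on[OF blinfun.bounded_linear_right]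
  have Pz_cont: "continuous_on {0..T} (\<lambda>t. P t (z' t))"
    by (rule continuous_on_strong_apply[OF P_cont cP(2) z'_cont])
  have PGr_cont: "continuous_on {0..T} (\<lambda>t. P t (G (r' t)))"
    by (rule continuous_on_strong_apply[OF P_cont cP(2) apply_cont[OF r'_cont]])
  have g'_cont: "continuous_on {0..T} g'"
    unfolding g'_def by (intro continuous_on_diff continuous_on_minus apply_cont Pz_cont r'_cont)
  have h'_rev: "h' (T - t) = - P t (G (r' t)) - Qbar (S (z' t))" for t
    by (simp add: h'_def r'_def)
  have "continuous_on {0..T} (\<lambda>t. h' (T - t))"
    unfolding h'_rev by (intro continuous_on_diff continuous_on_minus apply_cont PGr_cont z'_cont)
  from rev_cont[OF this] have h'_cont: "continuous_on {0..T} h'" by simp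
  have z'_0: "z' 0 = z0"
  proof (rule weak_limit_unique)
    show "(\<lambda>n. z (k n) 0 \<bullet> v) \<longlonglongrightarrow> z' 0 \<bullet> v" for v by (rule z') (use T0 in simp)
    show "(\<lambda>n. z (k n) 0 \<bullet> v) \<longlonglongrightarrow> z0 \<bullet> v" for v by (simp add: z_0)
  qed
  have r'_T: "r' T = - QTbar (ST (z' T))"
  proof (rule weak_limit_unique[where u = "\<lambda>n. \<rho> (k n) 0"])
    show "(\<lambda>n. \<rho> (k n) 0 \<bullet> v) \<longlonglongrightarrow> r' T \<bullet> v" for v
      unfolding r'_def using \<rho>'[of 0 v] T0 by simp
    have "(\<lambda>n. - (z (k n) T \<bullet> adj (QTbar o\<^sub>L ST) v)) \<longlonglongrightarrow> - (z' T \<bullet> adj (QTbar o\<^sub>L ST) v)" for v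
      by (intro tendsto_minus z') (use T0 in auto)
    then show "(\<lambda>n. \<rho> (k n) 0 \<bullet> v) \<longlonglongrightarrow> - QTbar (ST (z' T)) \<bullet> v" for v
      by (simp add: \<rho>_def r_def e_T adj_inner_right)
  qed
  have z_eq: "z' t = E t z0 - integral {0..t} (\<lambda>u. (E (t - u) o\<^sub>L G o\<^sub>L P u) (z' u))
      - integral {0..t} (\<lambda>u. (E (t - u) o\<^sub>L G) (r' u))" if t: "t \<in> {0..T}" for t
  proof -
    have cont: "continuous_on {0..t} (\<lambda>s. E (t - s) (f s))" if f: "continuous_on {0..T} f" for f
    proof (rule continuous_on_strong_apply)
      show "continuous_on {0..t} (\<lambda>s. E (t - s) x)" for x
        by (rule continuous_on_compose2[OF E_continuous]) (auto intro!: continuous_intros)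
      show "norm (E (t - s)) \<le> M * exp (\<bar>\<omega>\<bar> * T)" if "s \<in> {0..t}" for s
        by (rule norm_E_le) (use that t in auto)
      show "continuous_on {0..t} f" by (rule continuous_on_subset[OF f]) (use t in auto)
    qed
    have "((\<lambda>s. E (t - s) (g' s)) has_integral (z' t - E t (z' 0))) {0..t}"
      by (rule sE.mild_equation[OF _ g'_cont t]) (use z_weak[of 0 t] t in simp)
    moreover have "((\<lambda>s. - E (t - s) (G (P s (z' s))) - E (t - s) (G (r' s))) has_integral
        - integral {0..t} (\<lambda>s. E (t - s) (G (P s (z' s)))) - integral {0..t} (\<lambda>s. E (t - s) (G (r' s)))) {0..t}"
      by (intro has_integral_diff has_integral_neg integrable_integral continuous_integrable cont apply_cont Pz_cont r'_cont)
    moreover have "E (t - s) (g' s) = - E (t - s) (G (P s (z' s))) - E (t - s) (G (r' s))" for s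
      by (simp add: g'_def blinfun.diff_right blinfun.minus_right)
    ultimately have "z' t - E t (z' 0) = - integral {0..t} (\<lambda>s. E (t - s) (G (P s (z' s))))
        - integral {0..t} (\<lambda>s. E (t - s) (G (r' s)))"
      by (simp only: has_integral_unique)
    then show ?thesis by (simp add: z'_0 algebra_simps)
  qed
  have r_eq: "r' t = - ((adj (E (T - t)) o\<^sub>L QTbar o\<^sub>L ST) (z' T))
      - integral {t..T} (\<lambda>u. (adj (E (u - t)) o\<^sub>L P u o\<^sub>L G) (r' u))
      - integral {t..T} (\<lambda>u. (adj (E (u - t)) o\<^sub>L Qbar o\<^sub>L S) (z' u))" if t: "t \<in> {0..T}" for t
  proof -
    have cont: "continuous_on {t..T} (\<lambda>u. adj (E (u - t)) (f u))" if f: "continuous_on {0..T} f" for f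
    proof (rule continuous_on_strong_apply)
      show "continuous_on {t..T} (\<lambda>u. adj (E (u - t)) x)" for x
        by (rule continuous_on_compose2[OF adj_semigroup_continuous]) (auto intro!: continuous_intros)
      show "norm (adj (E (u - t))) \<le> M * exp (\<bar>\<omega>\<bar> * T)" if "u \<in> {t..T}" for u
        by (rule order_trans[OF norm_adj_le norm_E_le]) (use that t in auto)
      show "continuous_on {t..T} f" by (rule continuous_on_subset[OF f]) (use t in auto)
    qed
    have "((\<lambda>s. adj (E (T - t - s)) (h' s)) has_integral (\<rho>' (T - t) - adj (E (T - t)) (\<rho>' 0))) {0..T - t}"
      by (rule sA.mild_equation[OF _ h'_cont rev[OF t]]) (use \<rho>_weak[of 0 "T - t"] t in simp)
    from has_integral_reverse[OF this] t
    have "((\<lambda>u. adj (E (u - t)) (h' (T - u))) has_integral (r' t - adj (E (T - t)) (r' T))) {t..T}"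
      by (simp add: r'_def)
    moreover have "((\<lambda>u. - adj (E (u - t)) (P u (G (r' u))) - adj (E (u - t)) (Qbar (S (z' u)))) has_integral
        - integral {t..T} (\<lambda>u. adj (E (u - t)) (P u (G (r' u))))
        - integral {t..T} (\<lambda>u. adj (E (u - t)) (Qbar (S (z' u))))) {t..T}"
      by (intro has_integral_diff has_integral_neg integrable_integral continuous_integrable cont apply_cont PGr_cont z'_cont)
    moreover have "adj (E (u - t)) (h' (T - u)) = - adj (E (u - t)) (P u (G (r' u))) - adj (E (u - t)) (Qbar (S (z' u)))" for u
      by (simp add: h'_rev blinfun.diff_right blinfun.minus_right)
    ultimately have "r' t - adj (E (T - t)) (r' T) = - integral {t..T} (\<lambda>u. adj (E (u - t)) (P u (G (r' u))))
        - integral {t..T} (\<lambda>u. adj (E (u - t)) (Qbar (S (z' u))))"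
      by (simp only: has_integral_unique)
    then have "r' t = (- integral {t..T} (\<lambda>u. adj (E (u - t)) (P u (G (r' u))))
        - integral {t..T} (\<lambda>u. adj (E (u - t)) (Qbar (S (z' u))))) + adj (E (T - t)) (r' T)"
      by (simp only: diff_eq_eq)
    then show ?thesis by (simp add: r'_T blinfun.minus_right)
  qed
  define q where "q u = 1/2 * trace_op (\<sigma> o\<^sub>L adj \<sigma> o\<^sub>L P u) - 1/2 * (G (r' u) \<bullet> r' u)
      + 1/2 * (Qbar (S (z' u)) \<bullet> S (z' u))" for u
  define s where "s t = 1/2 * (QTbar (ST (z' T)) \<bullet> ST (z' T)) + integral {t..T} q" for t
  have "(\<lambda>u. trace_op (\<sigma> o\<^sub>L adj \<sigma> o\<^sub>L P u)) integrable_on {0..T}"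
    using trace_defined by (simp add: trace_term_defined_def)
  from integrable_on_mult_right[OF this, of "1/2"]
  have "q integrable_on {0..T}"
    unfolding q_def
    by (rule integrable_add[OF integrable_diff])
      (intro continuous_integrable continuous_on_mult continuous_on_const continuous_on_inner
        apply_cont z'_cont r'_cont)+
  then have s_cont: "continuous_on {0..T} s"
    unfolding s_def by (intro continuous_on_add continuous_on_const indefinite_integral_continuous_1')
  have "LQM_mild_solution E B R Q QT Qbar QTbar S ST \<sigma> T z0 P r' z' s"
    unfolding LQM_mild_solution_def G_def[symmetric]
    by (intro conjI ballI P r'_cont z'_cont s_cont z_eq r_eq trace_defined)
      (simp_all add: s_def q_def[abs_def])
  then show ?thesis by blast
qed

end
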